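(* Let $\mathfrak{s}$ be the Lie algebra of a shearing subgroup $S$ (in dimension $d$), and let $X_2,\ldots,X_d$ be the canonical basis of $\mathfrak{s}$, given by $$X_i=E_{1,i}+\sum_{j=2}^d\sum_{k=j+1}^d d_{i,j,k}E_{j,k}$$ with suitable coefficients $d_{i,j,k}$. Let $Y=\mathrm{diag}(1,\lambda_2,\ldots,\lambda_d)$ with $\lambda_i\in\mathbb{R}$. Then $[Y,\mathfrak{s}]\subset\mathfrak{s}$ if and only if $\lambda_i=1+\mu_i$ for all $i=2,\ldots,d$, where the vector $(\mu_2,\ldots,\mu_d)$ is a solution of the system of linear equations $$\mu_i+\mu_j=\mu_k\quad\text{for all }(i,j,k)\in\{2,\ldots,d\}^3\text{ with }d_{i,j,k}\ne0.\qquad( * )$$ In particular, $(\mu_2,\ldots,\mu_d)\mapsto(1,1+\mu_2,\ldots,1+\mu_d)$ (the vector of diagonal entries of the infinitesimal generator) sets up a bijection between the nonzero solutions of $( * )$ and the anisotropic scaling subgroups $D$ compatible with $S$.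
   Context: $[A,B]=AB-BA$. $E_{i,j}$ is the $d\times d$ matrix with entry one in row $i$, column $j$, and zeros elsewhere; thus $d_{i,j,k}$ is the $(j,k)$ entry of $X_i$ (zero unless $k>j$). Shearing subgroups. For a closed subgroup $H<\mathrm{GL}(d,\mathbb{R})$ let $G=\mathbb{R}^d\rtimes H$ with product $(x,h)(y,g)=(x+hy,hg)$ and quasi-regular representation $[\pi(x,h)f](y)=|\det h|^{-1/2}f(h^{-1}(y-x))$ on $L^2(\mathbb{R}^d)$. $H$ is irreducibly admissible if $\pi$ is an irreducible square-integrable representation; equivalently, the dual action $(\xi,h)\mapsto h^T\xi$ has a single open orbit, of full measure, with compact stabilizers. Let $T(d,\mathbb{R})$ be the group of upper triangular real $d\times d$ matrices with ones on the diagonal. An irreducibly admissible $H$ is a generalized shearlet dilation group if there are closed subgroups $S,D<H$ such that: (i) $S$ is a connected abelian Lie subgroup of $T(d,\mathbb{R})$; (ii) $D=\{\exp(rY):r\in\mathbb{R}\}$ with $Y$ a diagonal matrix; (iii) every $h\in H$ can be written uniquely as $h=\pm ds$ with $d\in D$, $s\in S$. A group $S$ is a shearing subgroup if it occurs in this way for some generalized shearlet dilation group. Canonical basis. The Lie algebra $\mathfrak{s}$ of a shearing subgroup has a unique basis $X_2,\ldots,X_d$ with $X_i^Te_1=e_i$ for $i=2,\ldots,d$ ($e_1,\ldots,e_d$ the canonical basis of $\mathbb{R}^d$); this is called the canonical basis of $\mathfrak{s}$. Compatible scaling subgroups. A one-parameter group $D=\exp(\mathbb{R}Y)$ with $Y\ne0$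 diagonal is compatible with $S$ if $DS\cup(-DS)$ is a generalized shearlet dilation group. Known fact: this holds if and only if $[X,Y]\in\mathfrak{s}$ for all $X\in\mathfrak{s}$ and the first diagonal entry of $Y$ is nonzero; since $Y$ and $rY$ ($r\ne0$) generate the same group, the infinitesimal generator of a compatible $D$ is normalized to have first diagonal entry $1$. $D$ is isotropic if this normalized generator is $I_d$, and anisotropic otherwise. *)

theory Defs
  imports "HOL-Analysis.Analysis" "HOL-Algebra.Group"
begin

section \<open>Matrices\<close>

type_synonym 'n sqmat = "((real, 'n) vec, 'n) vec"

text \<open>The index set \<open>{1..d}\<close> is a finite well-ordered type \<open>'n\<close>. Its least element plays the role
  of the index 1, and \<open>{first_ix<..}\<close> that of \<open>{2..d}\<close>.\<close>

definition first_ix :: "'n::{finite,wellorder}" where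
  "first_ix = Min UNIV"

definition unit_mat :: "'n \<Rightarrow> 'n \<Rightarrow> 'n::finite sqmat" where
  "unit_mat i j = (\<chi> a b. if a = i \<and> b = j then 1 else 0)"

definition diag_mat :: "('n \<Rightarrow> real) \<Rightarrow> 'n::finite sqmat" where
  "diag_mat v = (\<chi> i j. if i = j then v i else 0)"

definition diagonal_mat :: "'n::finite sqmat \<Rightarrow> bool" where
  "diagonal_mat A \<longleftrightarrow> (\<forall>i j. i \<noteq> j \<longrightarrow> A $ i $ j = 0)"

definition commutator :: "'n::finite sqmat \<Rightarrow> 'n sqmat \<Rightarrow> 'n sqmat" where
  "commutator A B = A ** B - B ** A"

definition mat_power :: "'n::finite sqmat \<Rightarrow> nat \<Rightarrow> 'n sqmat" where
  "mat_power A k = ((**) A ^^ k) (mat 1)"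

text \<open>The type \<open>'n sqmat\<close> carries no multiplication with unit \<open>mat 1\<close> as a type class operation
  (\<open>*\<close> on vectors is componentwise), so the library function \<open>exp\<close> does not apply.\<close>

definition mat_exp :: "'n::finite sqmat \<Rightarrow> 'n sqmat" where
  "mat_exp A = (\<Sum>k. mat_power A k /\<^sub>R fact k)"

definition one_param :: "'n::finite sqmat \<Rightarrow> 'n sqmat set" where
  "one_param Y = {mat_exp (r *\<^sub>R Y) | r. True}"

definition GL :: "'n::finite sqmat monoid" where
  "GL = \<lparr>carrier = {A. invertible A}, mult = (**), one = mat 1\<rparr>"

definition closed_subgroup :: "'n::finite sqmat set \<Rightarrow> bool" where
  "closed_subgroup H \<longleftrightarrow> subgroup H GL \<and> closedin (top_of_set (carrier GL)) H"

definition unitriangular :: "'n::{finite,wellorder} sqmat set" where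
  "unitriangular = {A. (\<forall>i. A $ i $ i = 1) \<and> (\<forall>i j. j < i \<longrightarrow> A $ i $ j = 0)}"

text \<open>The Lie algebra of a closed subgroup of the general linear group.\<close>

definition lie_algebra :: "'n::finite sqmat set \<Rightarrow> 'n sqmat set" where
  "lie_algebra S = {A. \<forall>t. mat_exp (t *\<^sub>R A) \<in> S}"


section \<open>The quasi-regular representation\<close>

definition semidirect :: "'n::finite sqmat set \<Rightarrow> ((real^'n) \<times> 'n sqmat) monoid" where
  "semidirect H = \<lparr>carrier = UNIV \<times> H,
     mult = (\<lambda>(x, h) (y, g). (x + h *v y, h ** g)),
     one = (0, mat 1)\<rparr>"

text \<open>Haar measures on a group whose carrier, with the subspace topology, is locally compact and
  second countable; for these, local finiteness implies regularity.\<close>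

definition left_haar :: "('g::topological_space) monoid \<Rightarrow> 'g measure \<Rightarrow> bool" where
  "left_haar G M \<longleftrightarrow>
     sets M = sets (restrict_space borel (carrier G)) \<and>
     emeasure M (carrier G) \<noteq> 0 \<and>
     (\<forall>K. compact K \<and> K \<subseteq> carrier G \<longrightarrow> emeasure M K < \<infinity>) \<and>
     (\<forall>g\<in>carrier G. \<forall>A\<in>sets M. emeasure M ((\<lambda>x. g \<otimes>\<^bsub>G\<^esub> x) ` A) = emeasure M A)"

text \<open>Elements of \<open>L\<^sup>2\<close> are represented by functions, not by classes modulo null sets.\<close>

definition L2 :: "'a measure \<Rightarrow> ('a \<Rightarrow> complex) set" where
  "L2 M = {f \<in> borel_measurable M. integrable M (\<lambda>x. (cmod (f x))\<^sup>2)}"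

definition L2_inner :: "'a measure \<Rightarrow> ('a \<Rightarrow> complex) \<Rightarrow> ('a \<Rightarrow> complex) \<Rightarrow> complex" where
  "L2_inner M f g = (LINT x|M. f x * cnj (g x))"

definition L2_dist :: "'a measure \<Rightarrow> ('a \<Rightarrow> complex) \<Rightarrow> ('a \<Rightarrow> complex) \<Rightarrow> real" where
  "L2_dist M f g = sqrt (LINT x|M. (cmod (f x - g x))\<^sup>2)"

definition L2_null :: "'a measure \<Rightarrow> ('a \<Rightarrow> complex) set" where
  "L2_null M = {f \<in> L2 M. AE x in M. f x = 0}"

text \<open>By the closure condition, a closed subspace is a union of classes modulo null sets.\<close>

definition L2_closed_subspace :: "'a measure \<Rightarrow> ('a \<Rightarrow> complex) set \<Rightarrow> bool" where
  "L2_closed_subspace M V \<longleftrightarrow>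
     V \<subseteq> L2 M \<and> (\<lambda>x. 0) \<in> V \<and>
     (\<forall>f\<in>V. \<forall>g\<in>V. (\<lambda>x. f x + g x) \<in> V) \<and>
     (\<forall>c. \<forall>f\<in>V. (\<lambda>x. c * f x) \<in> V) \<and>
     (\<forall>u f. (\<forall>n. u n \<in> V) \<and> f \<in> L2 M \<and> (\<lambda>n. L2_dist M (u n) f) \<longlonglongrightarrow> 0 \<longrightarrow> f \<in> V)"

definition irreducible_rep ::
    "'g monoid \<Rightarrow> 'a measure \<Rightarrow> ('g \<Rightarrow> ('a \<Rightarrow> complex) \<Rightarrow> 'a \<Rightarrow> complex) \<Rightarrow> bool" where
  "irreducible_rep G M \<rho> \<longleftrightarrow>
     (\<forall>V. L2_closed_subspace M V \<and> (\<forall>g\<in>carrier G. \<forall>f\<in>V. \<rho> g f \<in> V)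
        \<longrightarrow> V = L2_null M \<or> V = L2 M)"

text \<open>Left Haar measures are unique up to positive factors, so it is irrelevant which one is used.\<close>

definition square_integrable_rep ::
    "('g::topological_space) monoid \<Rightarrow> 'a measure \<Rightarrow>
     ('g \<Rightarrow> ('a \<Rightarrow> complex) \<Rightarrow> 'a \<Rightarrow> complex) \<Rightarrow> bool" where
  "square_integrable_rep G M \<rho> \<longleftrightarrow>
     (\<exists>m \<psi>. left_haar G m \<and> \<psi> \<in> L2 M - L2_null M \<and>
        (\<lambda>g. L2_inner M \<psi> (\<rho> g \<psi>)) \<in> L2 m)"

definition quasi_regular ::
    "(real^'n) \<times> 'n::finite sqmat \<Rightarrow> (real^'n \<Rightarrow> complex) \<Rightarrow> real^'n \<Rightarrow> complex" where
  "quasi_regular = (\<lambda>(x, h) f y.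
     complex_of_real (\<bar>det h\<bar> powr (-1/2)) * f (matrix_inv h *v (y - x)))"

definition irreducibly_admissible :: "'n::finite sqmat set \<Rightarrow> bool" where
  "irreducibly_admissible H \<longleftrightarrow>
     closed_subgroup H \<and>
     irreducible_rep (semidirect H) lborel quasi_regular \<and>
     square_integrable_rep (semidirect H) lborel quasi_regular"


section \<open>Shearing and scaling subgroups\<close>

text \<open>Closed subgroups of the general linear group are automatically Lie subgroups.\<close>

definition shearlet_decomposition ::
    "'n::{finite,wellorder} sqmat set \<Rightarrow> 'n sqmat set \<Rightarrow> 'n sqmat set \<Rightarrow> bool" where
  "shearlet_decomposition H S D \<longleftrightarrow>
     closed_subgroup S \<and> S \<subseteq> H \<and> closed_subgroup D \<and> D \<subseteq> H \<and>
     S \<subseteq> unitriangular \<and> connected S \<and> (\<forall>a\<in>S. \<forall>b\<in>S. a ** b = b ** a) \<and>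
     (\<exists>Y. diagonal_mat Y \<and> D = one_param Y) \<and>
     (\<forall>h\<in>H. \<exists>!(\<epsilon>, d, s). \<epsilon> \<in> {1, -1 :: real} \<and> d \<in> D \<and> s \<in> S \<and> h = \<epsilon> *\<^sub>R (d ** s))"

definition shearlet_dilation_group :: "'n::{finite,wellorder} sqmat set \<Rightarrow> bool" where
  "shearlet_dilation_group H \<longleftrightarrow>
     irreducibly_admissible H \<and> (\<exists>S D. shearlet_decomposition H S D)"

definition shearing_subgroup :: "'n::{finite,wellorder} sqmat set \<Rightarrow> bool" where
  "shearing_subgroup S \<longleftrightarrow>
     (\<exists>H D. irreducibly_admissible H \<and> shearlet_decomposition H S D)"

text \<open>Only the values of \<open>X\<close> on \<open>{first_ix<..}\<close> matter.\<close>

definition canonical_basis ::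
    "'n::{finite,wellorder} sqmat set \<Rightarrow> ('n \<Rightarrow> 'n sqmat) \<Rightarrow> bool" where
  "canonical_basis \<ss> X \<longleftrightarrow>
     inj_on X {first_ix<..} \<and> independent (X ` {first_ix<..}) \<and> span (X ` {first_ix<..}) = \<ss> \<and>
     (\<forall>i>first_ix. transpose (X i) *v axis first_ix 1 = axis i 1)"

definition compatible :: "'n::{finite,wellorder} sqmat set \<Rightarrow> 'n sqmat set \<Rightarrow> bool" where
  "compatible S D \<longleftrightarrow>
     (\<exists>Y. diagonal_mat Y \<and> Y \<noteq> 0 \<and> D = one_param Y) \<and>
     shearlet_dilation_group
       ({d ** s | d s. d \<in> D \<and> s \<in> S} \<union> {- (d ** s) | d s. d \<in> D \<and> s \<in> S})"

definition normalized_generator ::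
    "'n::{finite,wellorder} sqmat set \<Rightarrow> 'n sqmat \<Rightarrow> bool" where
  "normalized_generator D Y \<longleftrightarrow>
     diagonal_mat Y \<and> Y $ first_ix $ first_ix = 1 \<and> D = one_param Y"

definition isotropic :: "'n::{finite,wellorder} sqmat set \<Rightarrow> bool" where
  "isotropic D \<longleftrightarrow> normalized_generator D (mat 1)"

text \<open>Vectors indexed by \<open>{2..d}\<close> are extensional functions on \<open>{first_ix<..}\<close>.\<close>

definition solutions ::
    "('n \<Rightarrow> 'n \<Rightarrow> 'n \<Rightarrow> real) \<Rightarrow> ('n::{finite,wellorder} \<Rightarrow> real) set" where
  "solutions c = {\<mu> \<in> {first_ix<..} \<rightarrow>\<^sub>E UNIV.
     \<forall>i>first_ix. \<forall>j>first_ix. \<forall>k>first_ix. c i j k \<noteq> 0 \<longrightarrow> \<mu> i + \<mu> j = \<mu> k}"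

definition nonzero_solutions ::
    "('n \<Rightarrow> 'n \<Rightarrow> 'n \<Rightarrow> real) \<Rightarrow> ('n::{finite,wellorder} \<Rightarrow> real) set" where
  "nonzero_solutions c = {\<mu> \<in> solutions c. \<exists>i>first_ix. \<mu> i \<noteq> 0}"

end

theory Submission
  imports Defs "HOL-Probability.Probability"
begin

text \<open>
  The theorem combines a computation with structure constants and a piece of harmonic analysis.

  Let \<open>X\<^sub>i\<close> be the canonical basis of the Lie algebra \<open>\<ss>\<close> of \<open>S\<close>. An element of \<open>\<ss>\<close> is determined by its first row, and \<open>X\<^sub>i\<close> has first row \<open>e\<^sub>i\<close>.
  For a diagonal matrix \<open>Y\<close> with entries \<open>v\<close> and \<open>v\<^sub>1 = 1\<close>, the first row of \<open>[Y, X\<^sub>i]\<close> is \<open>(1 - v\<^sub>i) e\<^sub>i\<close>; so if \<open>[Y, X\<^sub>i]\<close>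
  lies in \<open>\<ss>\<close> at all, it equals \<open>(1 - v\<^sub>i) X\<^sub>i\<close>. Comparing entries gives \<open>v\<^sub>j - v\<^sub>k = 1 - v\<^sub>i\<close> whenever the \<open>(j, k)\<close> entry of \<open>X\<^sub>i\<close> is
  nonzero, which is the linear system for \<open>\<mu> = v - 1\<close>. Such \<open>v\<close> are called adapted below
  (\<open>commutator_invariant_iff\<close>, \<open>adapted_iff_solution\<close>).

  For the bijection it must be shown that a scaling group is compatible if and only if it has an adapted generator. Such a generator is unique,
  because its first entry is \<open>1\<close>. The first step is to identify the group \<open>S\<close>. Because \<open>e\<^sub>1\<close> is a cyclic row vector for the commuting matrices \<open>X\<^sub>i\<close>, the
  space \<open>\<real> 1 + \<ss>\<close> is its own commutant (\<open>commutant_eq_L\<close>), hence an algebra. A filtration argument puts \<open>1 + \<ss>\<close> inside \<open>S\<close>, and the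
  elements of the abelian group \<open>S\<close> commute with \<open>\<ss>\<close>, so \<open>S = 1 + \<ss>\<close> (\<open>S_eq\<close>). For adapted \<open>v\<close> it follows that
  \<open>H = \<plusminus> D S\<close> is a closed group and that \<open>h \<mapsto> h\<^sup>T e\<^sub>1\<close>, the first row, is a homeomorphism from \<open>H\<close> onto the
  orbit \<open>{\<xi>. \<xi>\<^sub>1 \<noteq> 0}\<close>; its inverse is called \<open>q\<close>.

  On the Fourier side the quasi-regular representation acts by modulations and by \<open>F \<mapsto> F (h\<^sup>T \<omega>)\<close>. If \<open>g\<close> is orthogonal to the
  orbit of \<open>f\<close>, then for each \<open>h\<close> the integrable function \<open>G(\<omega>) cnj (F (h\<^sup>T \<omega>))\<close> has vanishing Fourier transform, so it is zero;
  as the orbit maps are smooth and onto the orbit, Fubini's theorem forces \<open>F = 0\<close> or \<open>G = 0\<close> (\<open>H_irreducible\<close>). For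
  square-integrability, Lebesgue measure in the coordinates \<open>(x, \<xi>) \<mapsto> (x, q(\<xi>)\<^sup>-\<^sup>1)\<close> is a left Haar measure
  (\<open>left_haar_haar\<close>), and Plancherel's formula bounds the matrix coefficients of a function whose
  Fourier transform is supported in a compact part of the orbit (\<open>H_square_integrable\<close>). Plancherel's formula and the injectivity of the Fourier
  transform are obtained from Gaussian summation and the continuity of translations in the mean.

  Conversely, let \<open>D\<close> be compatible. If the first entry of a generator were zero, the
  dilations would preserve \<open>\<bar>\<omega>\<^sub>1\<bar>\<close> and band-limited functions would form a proper invariant subspace (\<open>band_limited_reducible\<close>). So the generator can be
  normalized, and comparing diagonals in the group \<open>\<plusminus> D S\<close> shows that \<open>D\<close> normalizes \<open>S\<close>, whence adaptedness (\<open>compatible_adapted\<close>).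
\<close>

section \<open>The matrix exponential\<close>

text \<open>A submultiplicative norm; it dominates every entry, so convergence can be checked entrywise.\<close>

definition entry_norm :: "'n::finite sqmat \<Rightarrow> real" where
  "entry_norm A = (\<Sum>i\<in>UNIV. \<Sum>j\<in>UNIV. \<bar>A $ i $ j\<bar>)"

lemma entry_norm_nonneg [simp]: "0 \<le> entry_norm A"
  by (simp add: entry_norm_def sum_nonneg)

lemma entry_le_entry_norm: "\<bar>A $ i $ j\<bar> \<le> entry_norm A"
proof -
  have "\<bar>A $ i $ j\<bar> \<le> (\<Sum>j\<in>UNIV. \<bar>A $ i $ j\<bar>)" by (rule member_le_sum) auto
  also have "\<dots> \<le> entry_norm A"
    unfolding entry_norm_def by (rule member_le_sum[of i UNIV "\<lambda>i. \<Sum>j\<in>UNIV. \<bar>A $ i $ j\<bar>"]) (auto intro: sum_nonneg)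
  finally show ?thesis .
qed

lemma entry_norm_mult: "entry_norm (A ** B) \<le> entry_norm A * entry_norm B"
proof -
  have "entry_norm (A ** B) \<le> (\<Sum>i\<in>UNIV. \<Sum>j\<in>UNIV. \<Sum>k\<in>UNIV. \<bar>A $ i $ k\<bar> * \<bar>B $ k $ j\<bar>)"
    unfolding entry_norm_def matrix_matrix_mult_def
    by (auto intro!: sum_mono order_trans[OF sum_abs] simp: abs_mult)
  also have "\<dots> = (\<Sum>i\<in>UNIV. \<Sum>k\<in>UNIV. \<bar>A $ i $ k\<bar> * (\<Sum>j\<in>UNIV. \<bar>B $ k $ j\<bar>))"
    by (subst sum.swap) (simp add: sum_distrib_left)
  also have "\<dots> \<le> (\<Sum>i\<in>UNIV. \<Sum>k\<in>UNIV. \<bar>A $ i $ k\<bar> * entry_norm B)"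
  proof (intro sum_mono mult_left_mono)
    fix k show "(\<Sum>j\<in>UNIV. \<bar>B $ k $ j\<bar>) \<le> entry_norm B"
      unfolding entry_norm_def by (rule member_le_sum[of k UNIV "\<lambda>k. \<Sum>j\<in>UNIV. \<bar>B $ k $ j\<bar>"]) (auto intro: sum_nonneg)
  qed auto
  also have "\<dots> = entry_norm A * entry_norm B" by (simp add: entry_norm_def[of A] sum_distrib_right)
  finally show ?thesis .
qed

lemma mat_power_0 [simp]: "mat_power A 0 = mat 1"
  by (simp add: mat_power_def)

lemma mat_power_Suc [simp]: "mat_power A (Suc k) = A ** mat_power A k"
  by (simp add: mat_power_def)

lemma mat_power_scaleR: "mat_power (t *\<^sub>R A) k = t ^ k *\<^sub>R mat_power A k"
  by (induction k) (simp_all add: scalar_matrix_assoc matrix_scalar_ac mult.commute)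

lemma entry_norm_power: "entry_norm (mat_power A k) \<le> entry_norm (mat 1 :: 'n::finite sqmat) * entry_norm A ^ k"
  for A :: "'n::finite sqmat"
proof (induction k)
  case (Suc k)
  have "entry_norm (mat_power A (Suc k)) \<le> entry_norm A * entry_norm (mat_power A k)"
    by (simp add: entry_norm_mult)
  also have "\<dots> \<le> entry_norm A * (entry_norm (mat 1 :: 'n sqmat) * entry_norm A ^ k)"
    by (intro mult_left_mono Suc) simp
  finally show ?case by (simp add: mult_ac)
qed simp

lemma mat_exp_entry_summable: "summable (\<lambda>k. mat_power A k $ i $ j / fact k)"
  for A :: "'n::finite sqmat"
proof (rule summable_comparison_test')
  have "summable (\<lambda>k. inverse (fact k) * entry_norm A ^ k)" by (rule summable_exp)
  then show "summable (\<lambda>k. entry_norm (mat 1 :: 'n sqmat) * (inverse (fact k) * entry_norm A ^ k))"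
    by (rule summable_mult)
  fix k :: nat assume "k \<ge> 0"
  show "norm (mat_power A k $ i $ j / fact k) \<le> entry_norm (mat 1 :: 'n sqmat) * (inverse (fact k) * entry_norm A ^ k)"
    using order_trans[OF entry_le_entry_norm entry_norm_power[of A k], of i j]
    by (simp add: field_simps)
qed

lemma mat_exp_entry: "mat_exp A $ i $ j = (\<Sum>k. mat_power A k $ i $ j / fact k)"
  for A :: "'n::finite sqmat"
proof -
  define E :: "'n sqmat" where "E = (\<chi> i j. \<Sum>k. mat_power A k $ i $ j / fact k)"
  have "(\<lambda>k. mat_power A k /\<^sub>R fact k) sums E"
    unfolding sums_def
  proof (intro vec_tendstoI)
    fix i j
    have "(\<lambda>n. \<Sum>k<n. mat_power A k $ i $ j / fact k) \<longlonglongrightarrow> E $ i $ j"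
      unfolding E_def using summable_LIMSEQ[OF mat_exp_entry_summable[of A i j]] by simp
    then show "(\<lambda>n. (\<Sum>k<n. mat_power A k /\<^sub>R fact k) $ i $ j) \<longlonglongrightarrow> E $ i $ j"
      by (simp add: divide_inverse mult.commute)
  qed
  then have "mat_exp A = E" unfolding mat_exp_def by (rule sums_unique[symmetric])
  then show ?thesis by (simp add: E_def)
qed

lemma DERIV_mat_exp_entry_0: "((\<lambda>t. mat_exp (t *\<^sub>R A) $ i $ j) has_real_derivative A $ i $ j) (at 0)"
  for A :: "'n::finite sqmat"
proof -
  define c where "c k = mat_power A k $ i $ j / fact k" for k
  have e: "mat_exp (t *\<^sub>R A) $ i $ j = (\<Sum>k. c k * t ^ k)" for t
    by (simp add: mat_exp_entry mat_power_scaleR c_def mult.commute)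
  have "summable (\<lambda>k. c k * t ^ k)" for t
    using mat_exp_entry_summable[of "t *\<^sub>R A" i j] by (simp add: mat_power_scaleR c_def mult.commute)
  then have "DERIV (\<lambda>t. \<Sum>k. c k * t ^ k) 0 :> (\<Sum>k. diffs c k * 0 ^ k)"
    by (rule termdiffs_strong_converges_everywhere)
  also have "(\<Sum>k. diffs c k * 0 ^ k) = A $ i $ j"
    by (subst powser_zero) (simp add: diffs_def c_def)
  finally show ?thesis by (simp add: e)
qed

lemma DERIV_sum_mat_exp_left:
  "((\<lambda>t. (mat_exp (t *\<^sub>R A) ** B) $ i $ j) has_real_derivative (A ** B) $ i $ j) (at 0)"
  for A :: "'n::finite sqmat"
  unfolding matrix_matrix_mult_def
  by (auto intro!: derivative_eq_intros DERIV_mat_exp_entry_0)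

lemma DERIV_sum_mat_exp_right:
  "((\<lambda>t. (B ** mat_exp (t *\<^sub>R A)) $ i $ j) has_real_derivative (B ** A) $ i $ j) (at 0)"
  for A :: "'n::finite sqmat"
  unfolding matrix_matrix_mult_def
  by (auto intro!: derivative_eq_intros DERIV_mat_exp_entry_0 simp: mult.commute)

text \<open>Differentiating at \<open>t = 0\<close> turns relations in the group into relations in the Lie algebra.\<close>

lemma commute_of_mat_exp_commute:
  fixes A B :: "'n::finite sqmat"
  assumes "\<And>t. mat_exp (t *\<^sub>R A) ** B = B ** mat_exp (t *\<^sub>R A)"
  shows "A ** B = B ** A"
proof -
  have "(A ** B) $ i $ j = (B ** A) $ i $ j" for i j
    using DERIV_unique[OF DERIV_sum_mat_exp_left[of A B i j]] DERIV_sum_mat_exp_right[of B A i j] assms by simp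
  then show ?thesis by (simp add: vec_eq_iff)
qed

lemma mat_power_diag: "mat_power (diag_mat v) k = diag_mat (\<lambda>i. v i ^ k)"
proof (induction k)
  case 0 show ?case by (simp add: diag_mat_def mat_def)
next
  case (Suc k)
  show ?case unfolding mat_power_Suc Suc
    by (simp add: vec_eq_iff diag_mat_def matrix_matrix_mult_def if_distrib[of "\<lambda>z. _ * z"] mult_delta_left cong: if_cong)
qed

lemma mat_exp_diag: "mat_exp (diag_mat v) = diag_mat (\<lambda>i. exp (v i))" for v :: "'n::finite \<Rightarrow> real"
proof -
  have "mat_exp (diag_mat v) $ i $ j = diag_mat (\<lambda>i. exp (v i)) $ i $ j" for i j
    unfolding mat_exp_entry mat_power_diag
    by (auto simp: diag_mat_def exp_def divide_inverse mult.commute)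
  then show ?thesis by (simp add: vec_eq_iff)
qed

lemma scaleR_diag: "r *\<^sub>R diag_mat v = diag_mat (\<lambda>i. r * v i)"
  by (simp add: vec_eq_iff diag_mat_def)

lemma one_param_diag: "one_param (diag_mat v) = {diag_mat (\<lambda>i. exp (r * v i)) | r. True}"
  by (simp add: one_param_def scaleR_diag mat_exp_diag)

lemma diag_mat_eq_iff: "diag_mat v = diag_mat w \<longleftrightarrow> v = w"
  by (auto simp: vec_eq_iff diag_mat_def fun_eq_iff)

lemma diagonal_matE:
  assumes "diagonal_mat Y" obtains v where "Y = diag_mat v"
proof
  show "Y = diag_mat (\<lambda>i. Y $ i $ i)" using assms by (auto simp: diagonal_mat_def diag_mat_def vec_eq_iff)
qed

lemma diagonal_diag_mat: "diagonal_mat (diag_mat v)"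
  by (simp add: diagonal_mat_def diag_mat_def)

lemma diag_mat_mult_left: "(diag_mat v ** A) $ i $ j = v i * A $ i $ j"
  by (simp add: diag_mat_def matrix_matrix_mult_def mult_delta_left)

lemma diag_mat_mult_right: "(A ** diag_mat v) $ i $ j = A $ i $ j * v j"
  by (simp add: diag_mat_def matrix_matrix_mult_def mult_delta_right)

lemma diag_mat_mult: "diag_mat v ** diag_mat w = diag_mat (\<lambda>i. v i * w i)"
  by (simp add: vec_eq_iff diag_mat_mult_left) (simp add: diag_mat_def)

lemma diag_mat_one: "diag_mat (\<lambda>_. 1) = mat 1"
  by (simp add: diag_mat_def mat_def)

section \<open>Matrix groups\<close>

lemma matrix_inv_mult:
  fixes A :: "'n::finite sqmat"
  assumes "invertible A"
  shows "matrix_inv A ** A = mat 1" "A ** matrix_inv A = mat 1"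
proof -
  have "A ** matrix_inv A = mat 1 \<and> matrix_inv A ** A = mat 1"
    unfolding matrix_inv_def by (rule someI_ex) (use assms in \<open>simp add: invertible_def\<close>)
  then show "matrix_inv A ** A = mat 1" "A ** matrix_inv A = mat 1" by auto
qed

lemma matrix_inv_unique:
  fixes A :: "'n::finite sqmat"
  assumes "B ** A = mat 1"
  shows "invertible A" "matrix_inv A = B" "A ** B = mat 1"
proof -
  show AB: "A ** B = mat 1" using assms matrix_left_right_inverse by blast
  show inv: "invertible A" unfolding invertible_def using assms AB by blast
  have "matrix_inv A = (B ** A) ** matrix_inv A" using assms by simp
  also have "\<dots> = B" by (simp add: matrix_mul_assoc[symmetric] matrix_inv_mult[OF inv])
  finally show "matrix_inv A = B" .
qed

lemma GL_simps [simp]: "carrier GL = {A. invertible A}" "mult GL = (**)" "one GL = mat 1"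
  by (simp_all add: GL_def)

lemma inv_GL:
  fixes A :: "'n::finite sqmat"
  assumes "invertible A" shows "m_inv GL A = matrix_inv A"
  unfolding m_inv_def
proof (rule the_equality)
  show "matrix_inv A \<in> carrier GL \<and> A \<otimes>\<^bsub>GL\<^esub> matrix_inv A = \<one>\<^bsub>GL\<^esub> \<and> matrix_inv A \<otimes>\<^bsub>GL\<^esub> A = \<one>\<^bsub>GL\<^esub>"
    using matrix_inv_mult[OF assms] by (auto simp: invertible_def)
  fix B assume "B \<in> carrier GL \<and> A \<otimes>\<^bsub>GL\<^esub> B = \<one>\<^bsub>GL\<^esub> \<and> B \<otimes>\<^bsub>GL\<^esub> A = \<one>\<^bsub>GL\<^esub>"
  then have "B ** A = mat 1" by simp
  then show "B = matrix_inv A" by (simp add: matrix_inv_unique)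
qed

lemma subgroup_GL_iff:
  "subgroup H GL \<longleftrightarrow> (\<forall>h\<in>H. invertible h) \<and> mat 1 \<in> H \<and> (\<forall>a\<in>H. \<forall>b\<in>H. a ** b \<in> H) \<and> (\<forall>a\<in>H. matrix_inv a \<in> H)"
  for H :: "'n::finite sqmat set"
  unfolding subgroup_def by (auto simp: inv_GL subset_iff)

section \<open>The Hilbert space of square-integrable functions\<close>

lemma borel_measurable_cnj [measurable]: "cnj \<in> borel_measurable borel"
  by (intro borel_measurable_continuous_onI continuous_intros)

definition sq_norm :: "'a measure \<Rightarrow> ('a \<Rightarrow> complex) \<Rightarrow> real" where
  "sq_norm M f = (LINT x|M. (cmod (f x))\<^sup>2)"

lemma sq_norm_nonneg [simp]: "0 \<le> sq_norm M f"
  by (simp add: sq_norm_def)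

lemma L2_inner_self: "L2_inner M f f = of_real (sq_norm M f)"
proof -
  have "L2_inner M f f = (LINT x|M. complex_of_real ((cmod (f x))\<^sup>2))"
    unfolding L2_inner_def by (simp only: complex_norm_square)
  then show ?thesis unfolding sq_norm_def by (simp only: integral_complex_of_real)
qed

lemma L2_dist_eq_sqrt: "L2_dist M f g = sqrt (sq_norm M (\<lambda>x. f x - g x))"
  by (simp add: L2_dist_def sq_norm_def)

lemma L2_measurable: "f \<in> L2 M \<Longrightarrow> f \<in> borel_measurable M"
  by (simp add: L2_def)

lemma L2_integrable_sq: "f \<in> L2 M \<Longrightarrow> integrable M (\<lambda>x. (cmod (f x))\<^sup>2)"
  by (simp add: L2_def)

lemma L2_integrable_norm_mult:
  assumes "f \<in> L2 M" "g \<in> L2 M"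
  shows "integrable M (\<lambda>x. cmod (f x) * cmod (g x))"
proof (rule Bochner_Integration.integrable_bound)
  show "integrable M (\<lambda>x. (cmod (f x))\<^sup>2 + (cmod (g x))\<^sup>2)"
    using assms by (auto simp: L2_def)
  show "(\<lambda>x. cmod (f x) * cmod (g x)) \<in> borel_measurable M"
    using assms by (auto simp: L2_def)
  have "a * b \<le> a\<^sup>2 + b\<^sup>2" for a b :: real
  proof -
    have "2 * (a * b) \<le> a\<^sup>2 + b\<^sup>2" using sum_squares_bound[of a b] by simp
    moreover have "0 \<le> a\<^sup>2 + b\<^sup>2" by simp
    ultimately show ?thesis by linarith
  qed
  then show "AE x in M. norm (cmod (f x) * cmod (g x)) \<le> norm ((cmod (f x))\<^sup>2 + (cmod (g x))\<^sup>2)"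
    by (auto simp: abs_mult)
qed

lemma L2_integrable_mult:
  assumes "f \<in> L2 M" "g \<in> L2 M"
  shows "integrable M (\<lambda>x. f x * cnj (g x))"
proof (rule Bochner_Integration.integrable_bound[OF L2_integrable_norm_mult[OF assms]])
  show "(\<lambda>x. f x * cnj (g x)) \<in> borel_measurable M"
    using assms by (auto simp: L2_def)
  show "AE x in M. cmod (f x * cnj (g x)) \<le> norm (cmod (f x) * cmod (g x))"
    by (rule AE_I2) (simp add: norm_mult)
qed

lemma L2_zero [simp]: "(\<lambda>x. 0) \<in> L2 M"
  by (simp add: L2_def)

lemma L2_cmult:
  assumes "f \<in> L2 M"
  shows "(\<lambda>x. c * f x) \<in> L2 M"
proof -
  have "(\<lambda>x. c * f x) \<in> borel_measurable M"
    using L2_measurable[OF assms] by measurable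
  moreover have "integrable M (\<lambda>x. (cmod c)\<^sup>2 * (cmod (f x))\<^sup>2)"
    using L2_integrable_sq[OF assms] by (rule integrable_mult_right)
  ultimately show ?thesis by (simp add: L2_def norm_mult power_mult_distrib)
qed

lemma L2_add:
  assumes "f \<in> L2 M" "g \<in> L2 M"
  shows "(\<lambda>x. f x + g x) \<in> L2 M"
proof -
  have "integrable M (\<lambda>x. (cmod (f x + g x))\<^sup>2)"
  proof (rule Bochner_Integration.integrable_bound)
    show "integrable M (\<lambda>x. (cmod (f x))\<^sup>2 + (cmod (g x))\<^sup>2 + 2 * (cmod (f x) * cmod (g x)))"
      using assms L2_integrable_norm_mult[OF assms] by (auto simp: L2_def)
    show "(\<lambda>x. (cmod (f x + g x))\<^sup>2) \<in> borel_measurable M"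
      using assms by (auto simp: L2_def)
    have "(cmod (f x + g x))\<^sup>2 \<le> (cmod (f x))\<^sup>2 + (cmod (g x))\<^sup>2 + 2 * (cmod (f x) * cmod (g x))" for x
      using power_mono[OF norm_triangle_ineq[of "f x" "g x"], of 2]
      by (simp add: power2_sum mult.assoc)
    then show "AE x in M. norm ((cmod (f x + g x))\<^sup>2)
        \<le> norm ((cmod (f x))\<^sup>2 + (cmod (g x))\<^sup>2 + 2 * (cmod (f x) * cmod (g x)))"
      by auto
  qed
  then show ?thesis using assms by (auto simp: L2_def)
qed

lemma L2_uminus: "f \<in> L2 M \<Longrightarrow> (\<lambda>x. - f x) \<in> L2 M"
  using L2_cmult[of f M "-1"] by simp

lemma L2_diff:
  assumes "f \<in> L2 M" "g \<in> L2 M"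
  shows "(\<lambda>x. f x - g x) \<in> L2 M"
  using L2_add[OF assms(1) L2_uminus[OF assms(2)]] by simp

lemma sq_norm_cmult: "sq_norm M (\<lambda>x. c * f x) = (cmod c)\<^sup>2 * sq_norm M f"
  by (simp add: sq_norm_def norm_mult power_mult_distrib)

lemma L2_inner_add_left:
  assumes "f \<in> L2 M" "g \<in> L2 M" "h \<in> L2 M"
  shows "L2_inner M (\<lambda>x. f x + g x) h = L2_inner M f h + L2_inner M g h"
  unfolding L2_inner_def using L2_integrable_mult[OF assms(1,3)] L2_integrable_mult[OF assms(2,3)]
  by (simp add: distrib_right)

lemma L2_inner_cmult_left: "L2_inner M (\<lambda>x. c * f x) g = c * L2_inner M f g"
  unfolding L2_inner_def mult.assoc by (rule integral_mult_right_zero)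

lemma L2_inner_cnj: "cnj (L2_inner M f g) = L2_inner M g f"
proof -
  have "cnj (L2_inner M f g) = (LINT x|M. cnj (f x * cnj (g x)))"
    unfolding L2_inner_def by (rule Bochner_Integration.integral_cnj[symmetric])
  also have "(\<lambda>x. cnj (f x * cnj (g x))) = (\<lambda>x. g x * cnj (f x))"
    by (auto simp: mult.commute)
  finally show ?thesis by (simp add: L2_inner_def)
qed

lemma L2_inner_diff_left:
  assumes "f \<in> L2 M" "g \<in> L2 M" "h \<in> L2 M"
  shows "L2_inner M (\<lambda>x. f x - g x) h = L2_inner M f h - L2_inner M g h"
  unfolding L2_inner_def using L2_integrable_mult[OF assms(1,3)] L2_integrable_mult[OF assms(2,3)]
  by (simp add: left_diff_distrib)

lemma L2_inner_add_right:
  assumes "f \<in> L2 M" "g \<in> L2 M" "h \<in> L2 M"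
  shows "L2_inner M h (\<lambda>x. f x + g x) = L2_inner M h f + L2_inner M h g"
  unfolding L2_inner_cnj[of M _ h, symmetric] L2_inner_add_left[OF assms] by simp

lemma L2_inner_diff_right:
  assumes "f \<in> L2 M" "g \<in> L2 M" "h \<in> L2 M"
  shows "L2_inner M h (\<lambda>x. f x - g x) = L2_inner M h f - L2_inner M h g"
  unfolding L2_inner_cnj[of M _ h, symmetric] L2_inner_diff_left[OF assms] by simp

lemma L2_inner_cmult_right: "L2_inner M f (\<lambda>x. c * g x) = cnj c * L2_inner M f g"
  unfolding L2_inner_cnj[of M _ f, symmetric] L2_inner_cmult_left by simp

lemma sq_norm_add:
  assumes "f \<in> L2 M" "g \<in> L2 M"
  shows "sq_norm M (\<lambda>x. f x + g x) = sq_norm M f + sq_norm M g + 2 * Re (L2_inner M f g)"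
proof -
  let ?h = "\<lambda>x. f x + g x"
  have h: "?h \<in> L2 M" using L2_add[OF assms] .
  have "complex_of_real (sq_norm M ?h) = L2_inner M f f + L2_inner M f g + (L2_inner M g f + L2_inner M g g)"
    using L2_inner_add_left[OF assms h] L2_inner_add_right[OF assms assms(1)]
      L2_inner_add_right[OF assms assms(2)] by (simp add: L2_inner_self)
  also have "L2_inner M g f = cnj (L2_inner M f g)" by (simp add: L2_inner_cnj)
  finally have "Re (complex_of_real (sq_norm M ?h)) = Re (L2_inner M f f + L2_inner M f g + (cnj (L2_inner M f g) + L2_inner M g g))"
    by simp
  then show ?thesis by (simp add: L2_inner_self)
qed

lemma sq_norm_diff:
  assumes "f \<in> L2 M" "g \<in> L2 M"
  shows "sq_norm M (\<lambda>x. f x - g x) = sq_norm M f + sq_norm M g - 2 * Re (L2_inner M f g)"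
  using sq_norm_add[OF assms(1) L2_uminus[OF assms(2)]] sq_norm_cmult[of M "-1" g]
    L2_inner_cmult_right[of M f "-1" g] by simp

lemma parallelogram_law:
  assumes "f \<in> L2 M" "g \<in> L2 M"
  shows "sq_norm M (\<lambda>x. f x + g x) + sq_norm M (\<lambda>x. f x - g x) = 2 * sq_norm M f + 2 * sq_norm M g"
  using sq_norm_add[OF assms] sq_norm_diff[OF assms] by simp

lemma polarization_identity:
  assumes "f \<in> L2 M" "g \<in> L2 M"
  shows "L2_inner M f g = Complex ((sq_norm M (\<lambda>x. f x + g x) - sq_norm M f - sq_norm M g) / 2)
           ((sq_norm M (\<lambda>x. f x + \<i> * g x) - sq_norm M f - sq_norm M g) / 2)"
  using sq_norm_add[OF assms] sq_norm_add[OF assms(1) L2_cmult[OF assms(2), of \<i>]]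
    L2_inner_cmult_right[of M f \<i> g] sq_norm_cmult[of M \<i> g]
  by (simp add: complex_eq_iff)

lemma Cauchy_Schwarz_L2:
  assumes "f \<in> L2 M" "g \<in> L2 M"
  shows "cmod (L2_inner M f g) \<le> sqrt (sq_norm M f) * sqrt (sq_norm M g)"
proof -
  define s where "s = (LINT x|M. cmod (f x) * cmod (g x))"
  define a b where "a = sq_norm M f" and "b = sq_norm M g"
  have "cmod (L2_inner M f g) \<le> s"
    unfolding L2_inner_def s_def
    by (rule order_trans[OF integral_norm_bound]) (simp add: norm_mult)
  have quad: "0 \<le> a - 2 * t * s + t\<^sup>2 * b" for t
  proof -
    have i: "integrable M (\<lambda>x. (cmod (f x))\<^sup>2)" "integrable M (\<lambda>x. (cmod (g x))\<^sup>2)"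
      "integrable M (\<lambda>x. cmod (f x) * cmod (g x))"
      using assms L2_integrable_norm_mult[OF assms] by (auto simp: L2_def)
    have "0 \<le> (LINT x|M. (cmod (f x) - t * cmod (g x))\<^sup>2)" by simp
    also have "\<dots> = (LINT x|M. (cmod (f x))\<^sup>2 - 2 * t * (cmod (f x) * cmod (g x)) + t\<^sup>2 * (cmod (g x))\<^sup>2)"
      by (intro Bochner_Integration.integral_cong) (auto simp: power2_diff power_mult_distrib)
    also have "\<dots> = a - 2 * t * s + t\<^sup>2 * b"
      using i by (simp add: a_def b_def s_def sq_norm_def)
    finally show ?thesis .
  qed
  have ab: "0 \<le> a" "0 \<le> b" by (auto simp: a_def b_def)
  have "s\<^sup>2 \<le> a * b"
  proof (cases "b = 0")
    case True
    have "s = 0"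
    proof (rule ccontr)
      assume "s \<noteq> 0"
      with quad[of "(a + 1) / (2 * s)"] True show False by simp
    qed
    then show ?thesis using ab by simp
  next
    case False
    then have "b > 0" using ab by simp
    from quad[of "s / b"] have "0 \<le> a - s\<^sup>2 / b"
      using False by (simp add: power2_eq_square field_simps)
    then show ?thesis using \<open>b > 0\<close> by (simp add: field_simps)
  qed
  then have "s \<le> sqrt (a * b)" by (rule real_le_rsqrt)
  then show ?thesis using \<open>cmod (L2_inner M f g) \<le> s\<close> by (simp add: a_def b_def real_sqrt_mult)
qed

lemma Minkowski_L2:
  assumes "f \<in> L2 M" "g \<in> L2 M"
  shows "sqrt (sq_norm M (\<lambda>x. f x + g x)) \<le> sqrt (sq_norm M f) + sqrt (sq_norm M g)"
proof (rule real_le_lsqrt)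
  have "Re (L2_inner M f g) \<le> sqrt (sq_norm M f) * sqrt (sq_norm M g)"
    using Cauchy_Schwarz_L2[OF assms] complex_Re_le_cmod order_trans by blast
  then show "sq_norm M (\<lambda>x. f x + g x) \<le> (sqrt (sq_norm M f) + sqrt (sq_norm M g))\<^sup>2"
    using sq_norm_add[OF assms] by (simp add: power2_sum)
qed auto

lemma L2_dist_triangle:
  assumes "f \<in> L2 M" "g \<in> L2 M" "h \<in> L2 M"
  shows "L2_dist M f h \<le> L2_dist M f g + L2_dist M g h"
  using Minkowski_L2[OF L2_diff[OF assms(1,2)] L2_diff[OF assms(2,3)]]
  by (simp add: L2_dist_eq_sqrt)

lemma L2_dist_commute: "L2_dist M f g = L2_dist M g f"
  by (simp add: L2_dist_def norm_minus_commute)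

lemma L2_dist_nonneg [simp]: "0 \<le> L2_dist M f g"
  by (simp add: L2_dist_def)

lemma tendsto_L2_inner:
  assumes "\<And>n. u n \<in> L2 M" "\<And>n. v n \<in> L2 M" "f \<in> L2 M" "g \<in> L2 M"
    and u: "(\<lambda>n. L2_dist M (u n) f) \<longlonglongrightarrow> 0" and v: "(\<lambda>n. L2_dist M (v n) g) \<longlonglongrightarrow> 0"
  shows "(\<lambda>n. L2_inner M (u n) (v n)) \<longlonglongrightarrow> L2_inner M f g"
proof -
  let ?e = "\<lambda>n. L2_dist M (u n) f * L2_dist M (v n) g + L2_dist M (u n) f * sqrt (sq_norm M g)
      + sqrt (sq_norm M f) * L2_dist M (v n) g"
  have "?e \<longlonglongrightarrow> 0 * 0 + 0 * sqrt (sq_norm M g) + sqrt (sq_norm M f) * 0"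
    by (intro tendsto_intros u v)
  then have e: "?e \<longlonglongrightarrow> 0" by simp
  have b: "cmod (L2_inner M (u n) (v n) - L2_inner M f g) \<le> ?e n" for n
  proof -
    note d = L2_diff[OF assms(1)[of n] assms(3)] and d' = L2_diff[OF assms(2)[of n] assms(4)]
    define A B C where "A = L2_inner M (\<lambda>x. u n x - f x) (\<lambda>x. v n x - g x)"
      and "B = L2_inner M (\<lambda>x. u n x - f x) g" and "C = L2_inner M f (\<lambda>x. v n x - g x)"
    have eq: "L2_inner M (u n) (v n) - L2_inner M f g = A + B + C"
      using assms(1-4) d d' by (simp add: A_def B_def C_def L2_inner_diff_left L2_inner_diff_right)
    have "cmod (A + B + C) \<le> cmod A + cmod B + cmod C"
      by (meson norm_triangle_ineq norm_triangle_le add_right_mono order_trans)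
    moreover have "cmod A \<le> L2_dist M (u n) f * L2_dist M (v n) g"
      "cmod B \<le> L2_dist M (u n) f * sqrt (sq_norm M g)"
      "cmod C \<le> sqrt (sq_norm M f) * L2_dist M (v n) g"
      using Cauchy_Schwarz_L2[OF d d'] Cauchy_Schwarz_L2[OF d assms(4)] Cauchy_Schwarz_L2[OF assms(3) d']
      by (simp_all add: L2_dist_eq_sqrt A_def B_def C_def)
    ultimately show ?thesis unfolding eq by linarith
  qed
  have "(\<lambda>n. L2_inner M (u n) (v n) - L2_inner M f g) \<longlonglongrightarrow> 0"
    by (rule Lim_null_comparison[OF always_eventually e]) (use b in blast)
  then show ?thesis by (simp add: LIM_zero_iff)
qed

lemma sq_norm_eq_0_iff:
  assumes "f \<in> L2 M"
  shows "sq_norm M f = 0 \<longleftrightarrow> (AE x in M. f x = 0)"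
  unfolding sq_norm_def using integral_nonneg_eq_0_iff_AE[OF L2_integrable_sq[OF assms]] by simp

lemma L2_null_iff: "f \<in> L2_null M \<longleftrightarrow> f \<in> L2 M \<and> sq_norm M f = 0"
  using sq_norm_eq_0_iff by (auto simp: L2_null_def)

lemma sq_norm_ennreal:
  assumes "f \<in> L2 M"
  shows "(\<integral>\<^sup>+x. ennreal ((cmod (f x))\<^sup>2) \<partial>M) = ennreal (sq_norm M f)"
  unfolding sq_norm_def by (rule nn_integral_eq_integral[OF L2_integrable_sq[OF assms]]) simp

lemma L2_iff_nn_integral:
  assumes "f \<in> borel_measurable M"
  shows "f \<in> L2 M \<longleftrightarrow> (\<integral>\<^sup>+x. ennreal ((cmod (f x))\<^sup>2) \<partial>M) < \<infinity>"
  using assms by (auto simp: L2_def integrable_iff_bounded)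

text \<open>Along a subsequence the increments \<open>v k\<close> satisfy \<open>\<parallel>v k\<parallel>\<^sup>2 \<le> 4 ^ (- k)\<close>, so \<open>\<Sum>k. 2 ^ k * \<bar>v k\<bar>\<^sup>2\<close> is
  integrable; hence \<open>v k = O(2 ^ (- k / 2))\<close> almost everywhere and the subsequence converges almost
  everywhere. Fatou's lemma turns this into convergence of the whole sequence in the mean.\<close>

theorem L2_complete:
  assumes u: "\<And>n. u n \<in> L2 M"
    and Cauchy: "\<And>e. e > 0 \<Longrightarrow> \<exists>N. \<forall>m\<ge>N. \<forall>n\<ge>N. L2_dist M (u m) (u n) < e"
  obtains f where "f \<in> L2 M" "(\<lambda>n. L2_dist M (u n) f) \<longlonglongrightarrow> 0"
proof -
  have [measurable]: "u n \<in> borel_measurable M" for n using u by (rule L2_measurable)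
  have "\<forall>k. \<exists>N. \<forall>m\<ge>N. \<forall>n\<ge>N. L2_dist M (u m) (u n) < (1/2) ^ k"
    using Cauchy by simp
  then obtain N where N: "\<And>k m n. m \<ge> N k \<Longrightarrow> n \<ge> N k \<Longrightarrow> L2_dist M (u m) (u n) < (1/2) ^ k"
    by metis
  define r where "r k = (\<Sum>i\<le>k. N i) + k" for k
  have rN: "N k \<le> r k" for k
    unfolding r_def by (rule trans_le_add1, rule member_le_sum) auto
  have rmono: "r k \<le> r (Suc k)" for k by (simp add: r_def)
  have rk: "k \<le> r k" for k by (simp add: r_def)
  define v where "v k = (\<lambda>x. u (r (Suc k)) x - u (r k) x)" for k
  have vL: "v k \<in> L2 M" for k unfolding v_def by (intro L2_diff u)
  have v_small: "sq_norm M (v k) \<le> (1/4) ^ k" for k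
  proof -
    have "sqrt (sq_norm M (v k)) \<le> (1/2) ^ k"
      using N[of k "r (Suc k)" "r k"] rN[of k] rmono[of k] unfolding v_def L2_dist_eq_sqrt by simp
    then have "sq_norm M (v k) \<le> ((1/2) ^ k)\<^sup>2" by (rule sqrt_le_D)
    also have "\<dots> = (1/4) ^ k" by (simp add: power2_eq_square flip: power_mult_distrib)
    finally show ?thesis .
  qed
  define F where "F x = (\<Sum>k. ennreal (2 ^ k * (cmod (v k x))\<^sup>2))" for x
  have [measurable]: "v k \<in> borel_measurable M" for k unfolding v_def by measurable
  have [measurable]: "F \<in> borel_measurable M" unfolding F_def by measurable
  have "(\<integral>\<^sup>+x. F x \<partial>M) = (\<Sum>k. \<integral>\<^sup>+x. ennreal (2 ^ k * (cmod (v k x))\<^sup>2) \<partial>M)"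
    unfolding F_def by (rule nn_integral_suminf) measurable
  also have "\<dots> \<le> (\<Sum>k. ennreal ((1/2) ^ k))"
  proof (intro suminf_le)
    fix k
    have "(\<integral>\<^sup>+x. ennreal (2 ^ k * (cmod (v k x))\<^sup>2) \<partial>M) = ennreal (2 ^ k) * ennreal (sq_norm M (v k))"
      unfolding sq_norm_ennreal[OF vL, symmetric]
      by (subst nn_integral_cmult[symmetric]) (auto simp: ennreal_mult)
    also have "\<dots> = ennreal (2 ^ k * sq_norm M (v k))" by (simp add: ennreal_mult)
    also have "\<dots> \<le> ennreal (2 ^ k * (1/4) ^ k)" using v_small[of k] by (intro ennreal_leI mult_left_mono) auto
    also have "(2::real) ^ k * (1/4) ^ k = (1/2) ^ k" by (simp add: power_mult_distrib[symmetric])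
    finally show "(\<integral>\<^sup>+x. ennreal (2 ^ k * (cmod (v k x))\<^sup>2) \<partial>M) \<le> ennreal ((1/2) ^ k)" .
  qed auto
  also have "\<dots> = ennreal (\<Sum>k. (1/2) ^ k)"
    by (rule suminf_ennreal2) (auto intro: summable_geometric)
  finally have "(\<integral>\<^sup>+x. F x \<partial>M) \<noteq> \<infinity>" by (auto simp: top_unique)
  then have "AE x in M. F x \<noteq> \<infinity>"
    by (intro nn_integral_noteq_infinite) auto
  then have conv: "AE x in M. convergent (\<lambda>k. u (r k) x)"
  proof (rule eventually_mono)
    fix x assume fin: "F x \<noteq> \<infinity>"
    define C where "C = enn2real (F x)"
    have C: "C \<ge> 0" "F x = ennreal C"
      using fin ennreal_enn2real[of "F x"] by (simp_all add: C_def less_top)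
    have b: "2 ^ k * (cmod (v k x))\<^sup>2 \<le> C" for k
    proof -
      have "ennreal (2 ^ k * (cmod (v k x))\<^sup>2) \<le> F x"
      proof -
        have "sum (\<lambda>k. ennreal (2 ^ k * (cmod (v k x))\<^sup>2)) {k} \<le> F x"
          unfolding F_def by (rule sum_le_suminf) auto
        then show ?thesis by (simp only: sum.insert[OF finite.emptyI empty_iff[THEN iffD1, THEN notI]] sum.empty add_0_right)
      qed
      then show ?thesis unfolding C(2) by (rule ennreal_le_iff[OF C(1), THEN iffD1])
    qed
    have "summable (\<lambda>k. v k x)"
    proof (rule summable_comparison_test')
      show "summable (\<lambda>k. sqrt C * (1 / sqrt 2) ^ k)"
        by (intro summable_mult summable_geometric) simp
      fix k :: nat assume "k \<ge> 0"
      have "(cmod (v k x))\<^sup>2 \<le> C / 2 ^ k" using b[of k] by (simp add: field_simps)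
      then have "cmod (v k x) \<le> sqrt (C / 2 ^ k)" by (rule real_le_rsqrt)
      also have "\<dots> = sqrt C * (1 / sqrt 2) ^ k"
        by (simp add: divide_inverse real_sqrt_mult real_sqrt_inverse real_sqrt_power power_inverse)
      finally show "norm (v k x) \<le> sqrt C * (1 / sqrt 2) ^ k" .
    qed
    then have "convergent (\<lambda>n. \<Sum>k<n. v k x)" by (simp add: summable_iff_convergent)
    moreover have "(\<Sum>k<n. v k x) = u (r n) x - u (r 0) x" for n
      unfolding v_def by (rule sum_lessThan_telescope)
    ultimately have "convergent (\<lambda>n. u (r n) x - u (r 0) x)" by simp
    then obtain l where "(\<lambda>n. u (r n) x - u (r 0) x) \<longlonglongrightarrow> l" by (auto simp: convergent_def)
    then have "(\<lambda>n. (u (r n) x - u (r 0) x) + u (r 0) x) \<longlonglongrightarrow> l + u (r 0) x" by (intro tendsto_intros)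
    then show "convergent (\<lambda>k. u (r k) x)" by (auto simp: convergent_def)
  qed
  define f where "f x = lim (\<lambda>k. u (r k) x)" for x
  have [measurable]: "f \<in> borel_measurable M" unfolding f_def by measurable
  have fatou: "(\<integral>\<^sup>+x. ennreal ((cmod (u m x - f x))\<^sup>2) \<partial>M) \<le> ennreal (e\<^sup>2)"
    if e: "e > 0" and m: "\<forall>n\<ge>K. L2_dist M (u m) (u n) < e" for m K e
  proof -
    have "(\<integral>\<^sup>+x. ennreal ((cmod (u m x - f x))\<^sup>2) \<partial>M)
        = (\<integral>\<^sup>+x. liminf (\<lambda>k. ennreal ((cmod (u m x - u (r k) x))\<^sup>2)) \<partial>M)"
    proof (rule nn_integral_cong_AE, use conv in \<open>rule eventually_mono\<close>)
      fix x assume "convergent (\<lambda>k. u (r k) x)"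
      then have "(\<lambda>k. u (r k) x) \<longlonglongrightarrow> f x" by (simp add: f_def convergent_LIMSEQ_iff)
      then have "(\<lambda>k. ennreal ((cmod (u m x - u (r k) x))\<^sup>2)) \<longlonglongrightarrow> ennreal ((cmod (u m x - f x))\<^sup>2)"
        by (intro tendsto_intros)
      then show "ennreal ((cmod (u m x - f x))\<^sup>2) = liminf (\<lambda>k. ennreal ((cmod (u m x - u (r k) x))\<^sup>2))"
        by (rule lim_imp_Liminf[OF sequentially_bot, symmetric])
    qed
    also have "\<dots> \<le> liminf (\<lambda>k. \<integral>\<^sup>+x. ennreal ((cmod (u m x - u (r k) x))\<^sup>2) \<partial>M)"
      by (rule nn_integral_liminf) measurable
    also have "\<dots> \<le> liminf (\<lambda>k. ennreal (e\<^sup>2))"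
    proof (rule Liminf_mono, rule eventually_sequentiallyI)
      fix k assume "K \<le> k"
      then have "sqrt (sq_norm M (\<lambda>x. u m x - u (r k) x)) < e"
        using m rk[of k] by (simp add: L2_dist_eq_sqrt)
      then have "sq_norm M (\<lambda>x. u m x - u (r k) x) \<le> e\<^sup>2"
        by (intro sqrt_le_D) simp
      then show "(\<integral>\<^sup>+x. ennreal ((cmod (u m x - u (r k) x))\<^sup>2) \<partial>M) \<le> ennreal (e\<^sup>2)"
        by (subst sq_norm_ennreal[OF L2_diff[OF u u]]) (rule ennreal_leI)
    qed
    also have "\<dots> = ennreal (e\<^sup>2)" by (simp add: Liminf_const)
    finally show ?thesis .
  qed
  have fL: "f \<in> L2 M"
  proof -
    obtain K where K: "\<forall>m\<ge>K. \<forall>n\<ge>K. L2_dist M (u m) (u n) < 1" using Cauchy[of 1] by auto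
    have "(\<integral>\<^sup>+x. ennreal ((cmod (u K x - f x))\<^sup>2) \<partial>M) \<le> ennreal (1\<^sup>2)"
      using K by (intro fatou[of 1 K]) auto
    then have "(\<lambda>x. u K x - f x) \<in> L2 M"
      by (subst L2_iff_nn_integral) (auto simp: le_less_trans)
    from L2_diff[OF u[of K] this] show ?thesis by simp
  qed
  have "(\<lambda>n. L2_dist M (u n) f) \<longlonglongrightarrow> 0"
  proof (rule LIMSEQ_I)
    fix e :: real assume "e > 0"
    then obtain K where K: "\<forall>m\<ge>K. \<forall>n\<ge>K. L2_dist M (u m) (u n) < e / 2" using Cauchy[of "e/2"] by auto
    have "norm (L2_dist M (u m) f - 0) < e" if "m \<ge> K" for m
    proof -
      have "(\<integral>\<^sup>+x. ennreal ((cmod (u m x - f x))\<^sup>2) \<partial>M) \<le> ennreal ((e/2)\<^sup>2)"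
        using K that \<open>e > 0\<close> by (intro fatou[of "e/2" K]) auto
      then have "sq_norm M (\<lambda>x. u m x - f x) \<le> (e/2)\<^sup>2"
        by (subst (asm) sq_norm_ennreal[OF L2_diff[OF u fL]]) simp
      then have "L2_dist M (u m) f \<le> e / 2"
        unfolding L2_dist_eq_sqrt using \<open>e > 0\<close> by (intro real_le_lsqrt) auto
      then show ?thesis using \<open>e > 0\<close> by simp
    qed
    then show "\<exists>no. \<forall>n\<ge>no. norm (L2_dist M (u n) f - 0) < e" by blast
  qed
  with fL show ?thesis by (rule that)
qed

lemma L2_closed_subspaceD:
  assumes "L2_closed_subspace M V"
  shows "V \<subseteq> L2 M" "(\<lambda>x. 0) \<in> V" "f \<in> V \<Longrightarrow> g \<in> V \<Longrightarrow> (\<lambda>x. f x + g x) \<in> V"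
    "f \<in> V \<Longrightarrow> (\<lambda>x. c * f x) \<in> V"
    "(\<And>n. u n \<in> V) \<Longrightarrow> f \<in> L2 M \<Longrightarrow> (\<lambda>n. L2_dist M (u n) f) \<longlonglongrightarrow> 0 \<Longrightarrow> f \<in> V"
  using assms unfolding L2_closed_subspace_def by blast+

lemma L2_closed_subspace_null:
  assumes V: "L2_closed_subspace M V"
  shows "L2_null M \<subseteq> V"
proof
  fix f assume f: "f \<in> L2_null M"
  then have "L2_dist M (\<lambda>x. 0) f = 0"
    by (simp add: L2_dist_eq_sqrt L2_null_iff sq_norm_def)
  then show "f \<in> V"
    using L2_closed_subspaceD(5)[OF V, of "\<lambda>_ _. 0" f] L2_closed_subspaceD(2)[OF V] f
    by (simp add: L2_null_iff)
qed

text \<open>The orthogonal projection: a minimizing sequence for the distance from \<open>g\<close> to \<open>V\<close> is Cauchy by the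
  parallelogram law, and the difference of \<open>g\<close> and its limit is orthogonal to \<open>V\<close>.\<close>

theorem L2_orthogonal_complement_nontrivial:
  assumes V: "L2_closed_subspace M V" and "V \<noteq> L2 M"
  obtains g where "g \<in> L2 M" "g \<notin> L2_null M" "\<And>f. f \<in> V \<Longrightarrow> L2_inner M g f = 0"
proof -
  note VD = L2_closed_subspaceD[OF V]
  obtain g where g: "g \<in> L2 M" "g \<notin> V" using assms VD(1) by blast
  have VL: "f \<in> V \<Longrightarrow> f \<in> L2 M" for f using VD(1) by blast
  define d where "d f = sq_norm M (\<lambda>x. g x - f x)" for f
  define \<delta> where "\<delta> = (INF f\<in>V. d f)"
  have bdd: "bdd_below (d ` V)" by (rule bdd_belowI[of _ 0]) (auto simp: d_def)
  have V0: "V \<noteq> {}" using VD(2) by blast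
  have \<delta>_le: "\<delta> \<le> d f" if "f \<in> V" for f unfolding \<delta>_def using bdd that by (rule cINF_lower)
  have "\<exists>f\<in>V. d f < \<delta> + 1 / Suc n" for n
    using cINF_less_iff[OF V0 bdd, of "\<delta> + 1 / Suc n"] by (simp add: \<delta>_def[symmetric])
  then obtain u where uV: "\<And>n. u n \<in> V" and ud: "\<And>n. d (u n) < \<delta> + 1 / Suc n" by metis
  have close: "sq_norm M (\<lambda>x. u m x - u n x) \<le> 2 * (d (u m) - \<delta>) + 2 * (d (u n) - \<delta>)" for m n
  proof -
    have mid: "(\<lambda>x. 1/2 * (u m x + u n x)) \<in> V" by (intro VD(4) VD(3) uV)
    have "sq_norm M (\<lambda>x. (g x - u m x) + (g x - u n x)) + sq_norm M (\<lambda>x. (g x - u m x) - (g x - u n x))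
        = 2 * d (u m) + 2 * d (u n)"
      unfolding d_def by (rule parallelogram_law) (intro L2_diff g VL uV)+
    moreover have "sq_norm M (\<lambda>x. (g x - u m x) + (g x - u n x)) = 4 * d (\<lambda>x. 1/2 * (u m x + u n x))"
    proof -
      have "(\<lambda>x. (g x - u m x) + (g x - u n x)) = (\<lambda>x. 2 * (g x - 1/2 * (u m x + u n x)))"
        by (auto simp: algebra_simps)
      then show ?thesis unfolding d_def by (simp only: sq_norm_cmult) simp
    qed
    moreover have "sq_norm M (\<lambda>x. (g x - u m x) - (g x - u n x)) = sq_norm M (\<lambda>x. u m x - u n x)"
      using sq_norm_cmult[of M "-1" "\<lambda>x. u m x - u n x"] by (simp add: algebra_simps)
    ultimately show ?thesis using \<delta>_le[OF mid] by simp
  qed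
  obtain v where v: "v \<in> L2 M" "(\<lambda>n. L2_dist M (u n) v) \<longlonglongrightarrow> 0"
  proof (rule L2_complete[of u M])
    fix e :: real assume e: "e > 0"
    obtain N :: nat where N: "4 / Suc N < e\<^sup>2"
      using reals_Archimedean[of "e\<^sup>2 / 4"] e by (auto simp: field_simps)
    have "L2_dist M (u m) (u n) < e" if "m \<ge> N" "n \<ge> N" for m n
    proof -
      have a: "d (u k) - \<delta> \<le> 1 / Suc N" if "k \<ge> N" for k
      proof -
        have "1 / Suc k \<le> 1 / Suc N" using that by (intro divide_left_mono) auto
        then show ?thesis using ud[of k] by linarith
      qed
      have "sq_norm M (\<lambda>x. u m x - u n x) \<le> 4 / Suc N"
        using close[of m n] a[OF that(1)] a[OF that(2)] by simp
      then have "sq_norm M (\<lambda>x. u m x - u n x) < e\<^sup>2" using N by simp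
      then show ?thesis unfolding L2_dist_eq_sqrt using e real_sqrt_less_mono by fastforce
    qed
    then show "\<exists>N. \<forall>m\<ge>N. \<forall>n\<ge>N. L2_dist M (u m) (u n) < e" by blast
  qed (use uV VL in auto)
  have vV: "v \<in> V" using VD(5)[OF uV v] .
  define w where "w = (\<lambda>x. g x - v x)"
  have wL: "w \<in> L2 M" unfolding w_def by (intro L2_diff g v)
  have "w \<notin> L2_null M"
  proof
    assume "w \<in> L2_null M"
    then have "w \<in> V" using L2_closed_subspace_null[OF V] by blast
    then have "(\<lambda>x. w x + v x) \<in> V" using vV by (rule VD(3))
    then show False using g by (simp add: w_def)
  qed
  have dw: "sq_norm M w \<le> sq_norm M (\<lambda>x. w x - f x)" if f: "f \<in> V" for f
  proof -
    have "(\<lambda>n. L2_inner M (\<lambda>x. g x - u n x) (\<lambda>x. g x - u n x)) \<longlonglongrightarrow> L2_inner M w w"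
      unfolding w_def
      by (intro tendsto_L2_inner L2_diff g v VL uV)
         (use v(2) in \<open>simp_all add: L2_dist_def norm_minus_commute\<close>)
    then have "(\<lambda>n. d (u n)) \<longlonglongrightarrow> sq_norm M w"
      by (simp add: L2_inner_self d_def tendsto_of_real_iff)
    moreover have "d (u n) \<le> \<delta> + 1 / Suc n" for n using ud[of n] by simp
    moreover have "(\<lambda>n. \<delta> + 1 / real (Suc n)) \<longlonglongrightarrow> \<delta> + 0"
      by (intro tendsto_intros LIMSEQ_inverse_real_of_nat[unfolded inverse_eq_divide])
    ultimately have "sq_norm M w \<le> \<delta>" using LIMSEQ_le by fastforce
    also have "\<delta> \<le> d (\<lambda>x. v x + f x)" using VD(3)[OF vV f] by (rule \<delta>_le)
    also have "\<dots> = sq_norm M (\<lambda>x. w x - f x)" by (simp add: d_def w_def diff_diff_eq)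
    finally show ?thesis .
  qed
  have orth: "L2_inner M w f = 0" if f: "f \<in> V" for f
  proof (rule ccontr)
    define s b where "s = L2_inner M w f" and "b = sq_norm M f"
    assume "L2_inner M w f \<noteq> 0"
    then have s: "cmod s > 0" by (simp add: s_def)
    have ineq: "2 * t * (cmod s)\<^sup>2 \<le> t\<^sup>2 * (cmod s)\<^sup>2 * b" for t :: real
    proof -
      have "sq_norm M w \<le> sq_norm M (\<lambda>x. w x - (of_real t * s) * f x)" by (intro dw VD(4) f)
      also have "\<dots> = sq_norm M w + (cmod (of_real t * s))\<^sup>2 * b - 2 * Re (cnj (of_real t * s) * s)"
        by (subst sq_norm_diff[OF wL L2_cmult[OF VL[OF f]]])
           (simp add: sq_norm_cmult L2_inner_cmult_right b_def s_def)
      also have "cnj (of_real t * s) * s = of_real (t * (cmod s)\<^sup>2)"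
        by (simp only: of_real_mult complex_norm_square) simp
      finally show ?thesis by (simp only: Re_complex_of_real) (simp add: norm_mult power_mult_distrib)
    qed
    have b0: "b \<ge> 0" by (simp add: b_def)
    define t where "t = 1 / (b + 1)"
    have t: "t > 0" "t * b < 1" using b0 by (auto simp: t_def)
    have "(2 * t) * (cmod s)\<^sup>2 \<le> (t\<^sup>2 * b) * (cmod s)\<^sup>2" using ineq[of t] by (simp add: mult_ac)
    then have "2 * t \<le> t\<^sup>2 * b" using s by simp
    then have "t * 2 \<le> t * (t * b)" by (simp add: power2_eq_square mult_ac)
    then have "2 \<le> t * b" using t by simp
    with t show False by simp
  qed
  show ?thesis by (rule that[OF wL \<open>w \<notin> L2_null M\<close> orth])
qed

section \<open>Translations and linear substitutions in Lebesgue integrals\<close>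

lemma lborel_shift:
  fixes c :: "'a::euclidean_space"
  shows "distr lborel borel (\<lambda>x. x + c) = lborel"
proof -
  have "(\<lambda>x. x + c) = (+) c" by (auto simp: add.commute)
  then show ?thesis using lborel_distr_plus[of c] by simp
qed

lemma integral_shift:
  fixes f :: "'a::euclidean_space \<Rightarrow> 'b::{banach, second_countable_topology}"
  assumes [measurable]: "f \<in> borel_measurable borel"
  shows "(LINT x|lborel. f (x + c)) = (LINT x|lborel. f x)"
  by (subst (2) lborel_shift[of c, symmetric], subst integral_distr) auto

lemma integrable_shift:
  fixes f :: "'a::euclidean_space \<Rightarrow> 'b::{banach, second_countable_topology}"
  assumes "integrable lborel f"
  shows "integrable lborel (\<lambda>x. f (x + c))"
  using assms by (subst (asm) lborel_shift[of c, symmetric], subst (asm) integrable_distr_eq) auto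

lemma matrix_mult_measurable [measurable]:
  "(\<lambda>x. A *v x) \<in> borel_measurable (borel :: (real^'n) measure)"
  by (intro borel_measurable_continuous_onI linear_continuous_on linear_linear[THEN iffD2] matrix_vector_mul_linear)

text \<open>Both measures agree on boxes, where the claim is the volume formula for images under linear maps.\<close>

lemma lborel_linear:
  fixes A :: "'n::{finite,wellorder} sqmat"
  assumes A: "invertible A"
  shows "density (distr lborel borel ((*v) A)) (\<lambda>_. ennreal \<bar>det A\<bar>) = lborel"
proof (rule lborel_eqI[symmetric])
  fix l u :: "(real, 'n) vec" assume lu: "\<And>b. b \<in> Basis \<Longrightarrow> l \<bullet> b \<le> u \<bullet> b"
  have d: "det A \<noteq> 0" using A by (simp add: invertible_det_nz)
  define B where "B = matrix_inv A"
  have BA: "B ** A = mat 1" "A ** B = mat 1" using A by (simp_all add: B_def matrix_inv_mult)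
  have dB: "det B * det A = 1" using BA(1) det_mul[of B A] by simp
  have pre: "(*v) A -` box l u = (*v) B ` box l u"
  proof (rule equalityI; rule subsetI)
    fix x assume "x \<in> (*v) A -` box l u"
    moreover have "x = B *v (A *v x)" by (simp add: matrix_vector_mul_assoc BA)
    ultimately show "x \<in> (*v) B ` box l u" by blast
  next
    fix x assume "x \<in> (*v) B ` box l u"
    then show "x \<in> (*v) A -` box l u" by (auto simp: matrix_vector_mul_assoc BA)
  qed
  have m: "box l u \<in> lmeasurable" by simp
  have "emeasure lborel ((*v) A -` box l u) = emeasure lebesgue ((*v) B ` box l u)"
    unfolding pre[symmetric] using measurable_sets[OF matrix_mult_measurable[of A], of "box l u"] by simp
  also have "\<dots> = ennreal (measure lebesgue ((*v) B ` box l u))"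
    by (rule emeasure_eq_measure2) (use measurable_linear_image[OF matrix_vector_mul_linear m, of B] in simp)
  also have "\<dots> = ennreal (\<bar>det B\<bar> * measure lebesgue (box l u))"
    by (subst measure_linear_image[OF matrix_vector_mul_linear m]) simp
  finally have e: "emeasure lborel ((*v) A -` box l u) = ennreal (\<bar>det B\<bar> * measure lebesgue (box l u))" .
  have "emeasure (density (distr lborel borel ((*v) A)) (\<lambda>_. ennreal \<bar>det A\<bar>)) (box l u)
      = ennreal \<bar>det A\<bar> * emeasure lborel ((*v) A -` box l u)"
    by (simp add: emeasure_density_const emeasure_distr)
  also have "\<dots> = ennreal (\<bar>det A\<bar> * \<bar>det B\<bar> * measure lebesgue (box l u))"
    unfolding e by (simp add: ennreal_mult'[symmetric] mult.assoc)
  also have "\<bar>det A\<bar> * \<bar>det B\<bar> = 1" using dB by (metis abs_mult abs_one mult.commute)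
  also have "measure lebesgue (box l u) = (\<Prod>b\<in>Basis. (u - l) \<bullet> b)" using lu by (simp add: measure_lborel_box_eq)
  finally show "emeasure (density (distr lborel borel ((*v) A)) (\<lambda>_. ennreal \<bar>det A\<bar>)) (box l u)
      = ennreal (\<Prod>b\<in>Basis. (u - l) \<bullet> b)" by simp
qed simp

lemma nn_integral_linear:
  fixes A :: "'n::{finite,wellorder} sqmat"
  assumes A: "invertible A" and [measurable]: "f \<in> borel_measurable borel"
  shows "(\<integral>\<^sup>+x. f x \<partial>lborel) = ennreal \<bar>det A\<bar> * (\<integral>\<^sup>+x. f (A *v x) \<partial>lborel)"
  by (subst lborel_linear[OF A, symmetric], subst nn_integral_density)
     (auto simp: nn_integral_distr nn_integral_cmult)

lemma integral_linear:
  fixes A :: "'n::{finite,wellorder} sqmat" and f :: "(real, 'n) vec \<Rightarrow> 'b::{banach, second_countable_topology}"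
  assumes A: "invertible A" and [measurable]: "f \<in> borel_measurable borel"
  shows "(LINT x|lborel. f x) = \<bar>det A\<bar> *\<^sub>R (LINT x|lborel. f (A *v x))"
  by (subst lborel_linear[OF A, symmetric], subst integral_density)
     (auto simp: integral_distr)

lemma integrable_linear_iff:
  fixes A :: "'n::{finite,wellorder} sqmat" and f :: "(real, 'n) vec \<Rightarrow> 'b::{banach, second_countable_topology}"
  assumes A: "invertible A" and [measurable]: "f \<in> borel_measurable borel"
  shows "integrable lborel (\<lambda>x. f (A *v x)) \<longleftrightarrow> integrable lborel f"
proof -
  have d: "det A \<noteq> 0" using A by (simp add: invertible_det_nz)
  have "integrable lborel f \<longleftrightarrow> integrable lborel (\<lambda>x. \<bar>det A\<bar> *\<^sub>R f (A *v x))"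
    by (subst lborel_linear[OF A, symmetric], subst integrable_density) (auto simp: integrable_distr_eq)
  also have "\<dots> \<longleftrightarrow> integrable lborel (\<lambda>x. f (A *v x))"
  proof
    assume "integrable lborel (\<lambda>x. \<bar>det A\<bar> *\<^sub>R f (A *v x))"
    then have "integrable lborel (\<lambda>x. (1 / \<bar>det A\<bar>) *\<^sub>R \<bar>det A\<bar> *\<^sub>R f (A *v x))"
      by (rule integrable_scaleR_right)
    then show "integrable lborel (\<lambda>x. f (A *v x))" using d by simp
  qed (intro integrable_scaleR_right)
  finally show ?thesis by simp
qed

lemma integral_scale:
  fixes f :: "real^'n::{finite,wellorder} \<Rightarrow> 'b::{banach, second_countable_topology}"
  assumes c: "c > 0" and [measurable]: "f \<in> borel_measurable borel"
  shows "(LINT x|lborel. f x) = c ^ CARD('n) *\<^sub>R (LINT x|lborel. f (c *\<^sub>R x))"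
proof -
  let ?A = "matrix ((*\<^sub>R) c) :: 'n sqmat"
  have d: "det ?A = c ^ CARD('n)" by (rule det_matrix_scaleR)
  then have "invertible ?A" using c by (simp add: invertible_det_nz)
  moreover have "?A *v x = c *\<^sub>R x" for x 
    by (simp add: matrix_scaleR vec_eq_iff matrix_vector_mult_def mat_def mult_delta_left)
  ultimately show ?thesis using integral_linear[of ?A f] c by (simp add: d)
qed

section \<open>Continuity of translations in the mean\<close>

definition translation_continuous :: "('a::euclidean_space \<Rightarrow> complex) \<Rightarrow> bool" where
  "translation_continuous u \<longleftrightarrow>
     (\<forall>t. t \<longlonglongrightarrow> 0 \<longrightarrow> (\<lambda>n. LINT y|lborel. cmod (u y - u (y + t n))) \<longlonglongrightarrow> 0)"

text \<open>The class of translation-continuous functions is closed in the mean: translation is an isometry, so an \<open>e / 3\<close>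
  argument applies.\<close>

lemma translation_continuous_approx:
  fixes u :: "'a::euclidean_space \<Rightarrow> complex"
  assumes u: "integrable lborel u"
    and ex: "\<And>e. e > 0 \<Longrightarrow> \<exists>v. integrable lborel v \<and> translation_continuous v \<and> (LINT y|lborel. cmod (u y - v y)) < e"
  shows "translation_continuous u"
  unfolding translation_continuous_def
proof (intro allI impI LIMSEQ_I)
  fix t :: "nat \<Rightarrow> 'a" and e :: real assume t: "t \<longlonglongrightarrow> 0" and e: "e > 0"
  obtain v where v: "integrable lborel v" "translation_continuous v" "(LINT y|lborel. cmod (u y - v y)) < e / 3"
    using ex[of "e/3"] e by auto
  have [measurable]: "u \<in> borel_measurable borel" "v \<in> borel_measurable borel"
    using u v by (auto dest: borel_measurable_integrable)
  obtain N where N: "\<And>n. n \<ge> N \<Longrightarrow> (LINT y|lborel. cmod (v y - v (y + t n))) < e / 3"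
    using LIMSEQ_D[of _ 0 "e/3"] v(2) t e unfolding translation_continuous_def by fastforce
  have "(LINT y|lborel. cmod (u y - u (y + t n))) < e" if "n \<ge> N" for n
  proof -
    have "(LINT y|lborel. cmod (u y - u (y + t n)))
      \<le> (LINT y|lborel. cmod (u y - v y) + cmod (v y - v (y + t n)) + cmod (u (y + t n) - v (y + t n)))"
    proof (rule integral_mono)
      show "cmod (u y - u (y + t n)) \<le> cmod (u y - v y) + cmod (v y - v (y + t n)) + cmod (u (y + t n) - v (y + t n))" for y
        using norm_triangle_ineq[of "u y - v y" "v y - v (y + t n)"]
          norm_triangle_ineq[of "u y - v (y + t n)" "v (y + t n) - u (y + t n)"]
        by (simp add: norm_minus_commute)
    qed (intro Bochner_Integration.integrable_add integrable_norm Bochner_Integration.integrable_diff integrable_shift u v)+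
    also have "\<dots> = (LINT y|lborel. cmod (u y - v y)) + (LINT y|lborel. cmod (v y - v (y + t n)))
        + (LINT y|lborel. cmod (u (y + t n) - v (y + t n)))"
      by (simp add: integrable_shift u v)
    also have "(LINT y|lborel. cmod (u (y + t n) - v (y + t n))) = (LINT y|lborel. cmod (u y - v y))"
      by (rule integral_shift) measurable
    finally show ?thesis using N[OF that] v(3) by simp
  qed
  then show "\<exists>no. \<forall>n\<ge>no. norm ((LINT y|lborel. cmod (u y - u (y + t n))) - 0) < e" by auto
qed

lemma translation_continuous_open:
  fixes U :: "'a::euclidean_space set"
  assumes U: "open U" "emeasure lborel U < \<infinity>"
  shows "translation_continuous (\<lambda>y. indicator U y *\<^sub>R c)"
  unfolding translation_continuous_def
proof (intro allI impI)
  fix t :: "nat \<Rightarrow> 'a" assume t: "t \<longlonglongrightarrow> 0"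
  have [measurable]: "U \<in> sets borel" using U by simp
  have int: "integrable lborel (indicator U :: 'a \<Rightarrow> real)" using U by (simp add: integrable_indicator_iff)
  define D where "D s = (LINT y|lborel. indicator U y * (1 - indicator U (y + s) :: real))" for s
  have iD: "integrable lborel (\<lambda>y. indicator U y * (1 - indicator U (y + s) :: real))" for s
    by (rule Bochner_Integration.integrable_bound[OF int]) (auto simp: indicator_def)
  have D: "(\<lambda>n. D (s n)) \<longlonglongrightarrow> 0" if s: "s \<longlonglongrightarrow> 0" for s
  proof -
    have "(\<lambda>n. D (s n)) \<longlonglongrightarrow> (LINT y::'a|lborel. 0::real)"
      unfolding D_def
    proof (rule integral_dominated_convergence[where w = "indicator U"])
      show "AE y in lborel. (\<lambda>n. indicator U y * (1 - indicator U (y + s n)) :: real) \<longlonglongrightarrow> 0"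
      proof (rule AE_I2)
        fix y
        show "(\<lambda>n. indicator U y * (1 - indicator U (y + s n)) :: real) \<longlonglongrightarrow> 0"
        proof (cases "y \<in> U")
          case True
          have "(\<lambda>n. y + s n) \<longlonglongrightarrow> y + 0" by (intro tendsto_intros s)
          then have "eventually (\<lambda>n. y + s n \<in> U) sequentially"
            using topological_tendstoD[OF _ U(1)] True by fastforce
          then have "eventually (\<lambda>n. indicator U y * (1 - indicator U (y + s n)) = (0::real)) sequentially"
            by (rule eventually_mono) simp
          then show ?thesis by (rule tendsto_eventually)
        qed simp
      qed
      show "AE y in lborel. norm (indicator U y * (1 - indicator U (y + s n)) :: real) \<le> indicator U y" for n
        by (auto simp: indicator_def)
    qed (use int in auto)
    then show ?thesis by simp
  qed
  have "(LINT y|lborel. cmod (indicator U y *\<^sub>R c - indicator U (y + t n) *\<^sub>R c)) = cmod c * (D (t n) + D (- t n))" for n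
  proof -
    have "D (- t n) = (LINT y|lborel. indicator U (y + t n) * (1 - indicator U y :: real))"
      unfolding D_def
      by (subst integral_shift[of "\<lambda>y. indicator U y * (1 - indicator U (y + - t n) :: real)" "t n", symmetric]) simp_all
    moreover have "integrable lborel (\<lambda>y. indicator U (y + t n) * (1 - indicator U y :: real))"
      using integrable_shift[OF iD[of "- t n"], of "t n"] by simp
    moreover have "(LINT y|lborel. cmod (indicator U y *\<^sub>R c - indicator U (y + t n) *\<^sub>R c))
      = (LINT y|lborel. cmod c * (indicator U y * (1 - indicator U (y + t n)) + indicator U (y + t n) * (1 - indicator U y)))"
      by (intro Bochner_Integration.integral_cong) (auto simp: indicator_def)
    ultimately show ?thesis by (simp add: iD D_def)
  qed
  moreover have "(\<lambda>n. cmod c * (D (t n) + D (- t n))) \<longlonglongrightarrow> cmod c * (0 + 0)"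
    by (intro tendsto_intros D t) (use tendsto_minus[OF t] in simp)
  ultimately show "(\<lambda>n. LINT y|lborel. cmod (indicator U y *\<^sub>R c - indicator U (y + t n) *\<^sub>R c)) \<longlonglongrightarrow> 0"
    by simp
qed

text \<open>Indicators of open sets are handled by dominated convergence; outer regularity and approximation
  in the mean extend the claim to all integrable functions.\<close>

theorem translation_continuous_integrable:
  fixes u :: "'a::euclidean_space \<Rightarrow> complex"
  assumes "integrable lborel u"
  shows "translation_continuous u"
  using assms
proof (induction u rule: integrable_induct)
  case (base A c)
  then have [measurable]: "A \<in> sets borel" by simp
  show ?case
  proof (rule translation_continuous_approx)
    show "integrable lborel (\<lambda>x. indicator A x *\<^sub>R c)" using base by (simp add: integrable_indicator_iff)
    fix e :: real assume e: "e > 0"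
    define e' where "e' = e / (cmod c + 1)"
    have e': "e' > 0" using e by (simp add: e'_def add_nonneg_pos)
    obtain U where U: "open U" "A \<subseteq> U" "emeasure lborel (U - A) < ennreal e'"
      using outer_regular_lborel[OF _ e', of A] by auto
    have [measurable]: "U \<in> sets borel" using U by simp
    have "emeasure lborel U \<le> emeasure lborel (U - A) + emeasure lborel A"
      using U(2) by (metis Diff_partition emeasure_subadditive sets_lborel \<open>A \<in> sets borel\<close> \<open>U \<in> sets borel\<close> sets.Diff sup_commute)
    also have "\<dots> < \<infinity>"
      using order.strict_trans[OF U(3) ennreal_less_top] base(2) by simp
    finally have fin: "emeasure lborel U < \<infinity>" .
    have "(LINT y|lborel. cmod (indicator A y *\<^sub>R c - indicator U y *\<^sub>R c)) = (LINT y|lborel. cmod c * indicator (U - A) y)"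
      using U(2) by (intro Bochner_Integration.integral_cong) (auto simp: indicator_def)
    also have "\<dots> = cmod c * measure lborel (U - A)" by simp
    also have "\<dots> \<le> cmod c * e'"
    proof -
      have "measure lborel (U - A) \<le> e'"
        unfolding measure_def using U(3) e' by (intro enn2real_leI) auto
      then show ?thesis by (intro mult_left_mono) auto
    qed
    also have "\<dots> < (cmod c + 1) * e'" using e' by simp
    also have "\<dots> = e" by (simp add: e'_def add_nonneg_eq_0_iff)
    finally have "(LINT y|lborel. cmod (indicator A y *\<^sub>R c - indicator U y *\<^sub>R c)) < e" .
    then show "\<exists>v. integrable lborel v \<and> translation_continuous v \<and> (LINT y|lborel. cmod (indicator A y *\<^sub>R c - v y)) < e"
      using translation_continuous_open[OF U(1) fin, of c] fin
      by (intro exI[of _ "\<lambda>y. indicator U y *\<^sub>R c"]) (simp add: integrable_indicator_iff)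
  qed
next
  case (add f g)
  show ?case unfolding translation_continuous_def
  proof (intro allI impI)
    fix t :: "nat \<Rightarrow> 'a" assume t: "t \<longlonglongrightarrow> 0"
    have lim: "(\<lambda>n. (LINT y|lborel. cmod (f y - f (y + t n))) + (LINT y|lborel. cmod (g y - g (y + t n)))) \<longlonglongrightarrow> 0"
      using tendsto_add[of _ 0 sequentially _ 0] add t unfolding translation_continuous_def by fastforce
    show "(\<lambda>n. LINT y|lborel. cmod (f y + g y - (f (y + t n) + g (y + t n)))) \<longlonglongrightarrow> 0"
    proof (rule tendsto_sandwich[OF _ _ tendsto_const lim])
      show "\<forall>\<^sub>F n in sequentially. (LINT y|lborel. cmod (f y + g y - (f (y + t n) + g (y + t n))))
        \<le> (LINT y|lborel. cmod (f y - f (y + t n))) + (LINT y|lborel. cmod (g y - g (y + t n)))"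
      proof (rule always_eventually, rule allI)
        fix n
        have i: "integrable lborel (\<lambda>y. cmod (f y - f (y + t n)))" "integrable lborel (\<lambda>y. cmod (g y - g (y + t n)))"
          by (intro integrable_norm Bochner_Integration.integrable_diff integrable_shift add)+
        have "(LINT y|lborel. cmod (f y + g y - (f (y + t n) + g (y + t n))))
          \<le> (LINT y|lborel. cmod (f y - f (y + t n)) + cmod (g y - g (y + t n)))"
        proof (rule integral_mono)
          show "cmod (f y + g y - (f (y + t n) + g (y + t n))) \<le> cmod (f y - f (y + t n)) + cmod (g y - g (y + t n))" for y
            using norm_triangle_ineq[of "f y - f (y + t n)" "g y - g (y + t n)"] by (simp add: algebra_simps)
        qed (intro integrable_norm Bochner_Integration.integrable_diff Bochner_Integration.integrable_add integrable_shift add i)+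
        then show "(LINT y|lborel. cmod (f y + g y - (f (y + t n) + g (y + t n))))
          \<le> (LINT y|lborel. cmod (f y - f (y + t n))) + (LINT y|lborel. cmod (g y - g (y + t n)))"
          using i by simp
      qed
    qed simp
  qed
next
  case (lim f s)
  show ?case
  proof (rule translation_continuous_approx[OF lim(4)])
    fix e :: real assume e: "e > 0"
    have [measurable]: "f \<in> borel_measurable borel" "s i \<in> borel_measurable borel" for i
      using lim by (auto dest: borel_measurable_integrable)
    have "(\<lambda>i. LINT y|lborel. cmod (f y - s i y)) \<longlonglongrightarrow> (LINT y::'a|lborel. 0::real)"
    proof (rule integral_dominated_convergence[where w = "\<lambda>y. 3 * cmod (f y)"])
      show "AE y in lborel. (\<lambda>i. cmod (f y - s i y)) \<longlonglongrightarrow> 0"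
      proof (rule AE_I2)
        fix y
        have "(\<lambda>i. cmod (f y - s i y)) \<longlonglongrightarrow> cmod (f y - f y)"
          using lim(2)[of y] by (intro tendsto_intros) simp
        then show "(\<lambda>i. cmod (f y - s i y)) \<longlonglongrightarrow> 0" by simp
      qed
      show "AE y in lborel. norm (cmod (f y - s i y)) \<le> 3 * cmod (f y)" for i
      proof (rule AE_I2)
        fix y
        show "norm (cmod (f y - s i y)) \<le> 3 * cmod (f y)"
          using lim(3)[of y i] norm_triangle_ineq4[of "f y" "s i y"] by simp
      qed
      show "integrable lborel (\<lambda>y. 3 * cmod (f y))" using lim(4) by simp
    qed measurable
    then obtain i where "(LINT y|lborel. cmod (f y - s i y)) < e"
      using order_tendstoD(2)[of _ 0 sequentially e] e by (auto simp: eventually_sequentially)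
    then show "\<exists>v. integrable lborel v \<and> translation_continuous v \<and> (LINT y|lborel. cmod (f y - v y)) < e"
      using lim(1,5) by blast
  qed
qed

section \<open>The Fourier transform\<close>

text \<open>The kernel carries no normalization, hence the factor \<open>(2 \<pi>)\<^sup>d\<close> in Plancherel's formula.\<close>

definition fourier :: "('a::euclidean_space \<Rightarrow> complex) \<Rightarrow> 'a \<Rightarrow> complex" where
  "fourier f \<omega> = (LINT y|lborel. f y * cis (\<omega> \<bullet> y))"

text \<open>Bounded functions with bounded support: integrable and square-integrable, dense in \<open>L\<^sup>2\<close>, and stable under
  the representation.\<close>

definition test_fun :: "('a::euclidean_space \<Rightarrow> complex) set" where
  "test_fun = {f \<in> borel_measurable borel. (\<exists>C. \<forall>x. cmod (f x) \<le> C) \<and> (\<exists>R. \<forall>x. norm x > R \<longrightarrow> f x = 0)}"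

lemma test_fun_measurable: "f \<in> test_fun \<Longrightarrow> f \<in> borel_measurable borel"
  by (simp add: test_fun_def)

lemma borel_measurable_cis [measurable]: "cis \<in> borel_measurable borel"
  by (intro borel_measurable_continuous_onI continuous_intros)

lemma test_funI:
  assumes "f \<in> borel_measurable borel" "\<And>x. cmod (f x) \<le> C" "\<And>x. norm x > R \<Longrightarrow> f x = 0"
  shows "f \<in> test_fun"
  using assms unfolding test_fun_def by blast

lemma test_funE:
  assumes "f \<in> test_fun"
  obtains C R where "C \<ge> 0" "\<And>x. cmod (f x) \<le> C" "\<And>x. norm x > R \<Longrightarrow> f x = 0"
proof -
  obtain C R where "\<And>x. cmod (f x) \<le> C" "\<And>x. norm x > R \<Longrightarrow> f x = 0"
    using assms unfolding test_fun_def by blast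
  moreover from this(1)[of 0] have "C \<ge> 0" using norm_ge_zero order_trans by blast
  ultimately show ?thesis using that by blast
qed

lemma test_fun_integrable:
  fixes f :: "'a::euclidean_space \<Rightarrow> complex"
  assumes "f \<in> test_fun"
  shows "integrable lborel f"
proof -
  obtain C R where CR: "C \<ge> 0" "\<And>x. cmod (f x) \<le> C" "\<And>x. norm x > R \<Longrightarrow> f x = 0" by (rule test_funE[OF assms]) blast
  have [measurable]: "f \<in> borel_measurable borel" using assms by (rule test_fun_measurable)
  show ?thesis
  proof (rule Bochner_Integration.integrable_bound)
    show "integrable lborel (\<lambda>x. C * indicator (cball (0::'a) R) x)"
      using emeasure_bounded_finite[OF bounded_cball, of "0::'a" R]
      by (intro integrable_mult_right) (simp add: integrable_indicator_iff)
    show "AE x in lborel. norm (f x) \<le> norm (C * indicator (cball (0::'a) R) x)"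
    proof (rule AE_I2)
      fix x show "norm (f x) \<le> norm (C * indicator (cball (0::'a) R) x)"
        using CR(1,2) CR(3)[of x] by (cases "norm x \<le> R") auto
    qed
  qed measurable
qed

lemma test_fun_mult_cnj:
  assumes "f \<in> test_fun" "g \<in> test_fun"
  shows "(\<lambda>x. f x * cnj (g x)) \<in> test_fun"
proof -
  obtain C R where CR: "C \<ge> 0" "\<And>x. cmod (f x) \<le> C" "\<And>x. norm x > R \<Longrightarrow> f x = 0" by (rule test_funE[OF assms(1)]) blast
  obtain C' R' where CR': "C' \<ge> 0" "\<And>x. cmod (g x) \<le> C'" "\<And>x. norm x > R' \<Longrightarrow> g x = 0" by (rule test_funE[OF assms(2)]) blast
  note [measurable] = test_fun_measurable[OF assms(1)] test_fun_measurable[OF assms(2)]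
  show ?thesis
    by (rule test_funI[of _ "C * C'" R]) (use CR CR' in \<open>auto simp: norm_mult intro: mult_mono\<close>)
qed

lemma test_fun_L2:
  assumes "f \<in> test_fun"
  shows "f \<in> L2 lborel"
proof -
  have "integrable lborel (\<lambda>x. norm (f x * cnj (f x)))"
    by (intro integrable_norm test_fun_integrable test_fun_mult_cnj assms)
  then show ?thesis using test_fun_measurable[OF assms] by (simp add: L2_def norm_mult power2_eq_square)
qed

lemma test_fun_add:
  assumes "f \<in> test_fun" "g \<in> test_fun"
  shows "(\<lambda>x. f x + g x) \<in> test_fun"
proof -
  obtain C R where CR: "C \<ge> 0" "\<And>x. cmod (f x) \<le> C" "\<And>x. norm x > R \<Longrightarrow> f x = 0" by (rule test_funE[OF assms(1)]) blast
  obtain C' R' where CR': "C' \<ge> 0" "\<And>x. cmod (g x) \<le> C'" "\<And>x. norm x > R' \<Longrightarrow> g x = 0" by (rule test_funE[OF assms(2)]) blast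
  note [measurable] = test_fun_measurable[OF assms(1)] test_fun_measurable[OF assms(2)]
  show ?thesis
    by (rule test_funI[of _ "C + C'" "max R R'"])
       (use CR CR' in \<open>auto intro: norm_triangle_mono\<close>)
qed

lemma test_fun_bounded_mult:
  assumes "f \<in> test_fun" and [measurable]: "g \<in> borel_measurable borel" and g: "\<And>x. cmod (g x) \<le> K"
  shows "(\<lambda>x. g x * f x) \<in> test_fun"
proof -
  obtain C R where CR: "C \<ge> 0" "\<And>x. cmod (f x) \<le> C" "\<And>x. norm x > R \<Longrightarrow> f x = 0" by (rule test_funE[OF assms(1)]) blast
  note [measurable] = test_fun_measurable[OF assms(1)]
  have "0 \<le> K" using g[of 0] norm_ge_zero order_trans by blast
  then show ?thesis
    by (intro test_funI[of _ "K * C" R]) (use CR g in \<open>auto simp: norm_mult intro: mult_mono\<close>)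
qed

lemma test_fun_cmult: "f \<in> test_fun \<Longrightarrow> (\<lambda>x. c * f x) \<in> test_fun"
  by (rule test_fun_bounded_mult[of _ "\<lambda>_. c" "cmod c"]) auto

lemma test_fun_diff: "f \<in> test_fun \<Longrightarrow> g \<in> test_fun \<Longrightarrow> (\<lambda>x. f x - g x) \<in> test_fun"
  using test_fun_add[of f "\<lambda>x. -1 * g x"] test_fun_cmult[of g "-1"] by simp

lemma test_fun_indicator:
  assumes "bounded K" "K \<in> sets borel"
  shows "(indicator K :: 'a::euclidean_space \<Rightarrow> complex) \<in> test_fun"
proof -
  obtain R where R: "\<And>x. x \<in> K \<Longrightarrow> norm x \<le> R" using assms(1) by (auto simp: bounded_iff)
  show ?thesis
  proof (rule test_funI[of _ 1 R])
    fix x :: 'a assume "norm x > R"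
    then show "indicator K x = (0::complex)" using R[of x] by (auto simp: indicator_def)
  qed (use assms(2) in \<open>auto simp: indicator_def\<close>)
qed

lemma fourier_integrand_measurable [measurable]:
  fixes f :: "'a::euclidean_space \<Rightarrow> complex"
  assumes [measurable]: "f \<in> borel_measurable borel"
  shows "(\<lambda>y. f y * cis (\<omega> \<bullet> y)) \<in> borel_measurable borel"
  by measurable

lemma fourier_integrable:
  fixes f :: "'a::euclidean_space \<Rightarrow> complex"
  assumes "integrable lborel f"
  shows "integrable lborel (\<lambda>y. f y * cis (\<omega> \<bullet> y))"
proof (rule Bochner_Integration.integrable_bound[OF assms])
  have [measurable]: "f \<in> borel_measurable borel" using assms by (auto dest: borel_measurable_integrable)
  show "(\<lambda>y. f y * cis (\<omega> \<bullet> y)) \<in> borel_measurable lborel" by measurable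
qed (simp add: norm_mult)

lemma fourier_measurable [measurable]:
  fixes f :: "'a::euclidean_space \<Rightarrow> complex"
  assumes [measurable]: "f \<in> borel_measurable borel"
  shows "fourier f \<in> borel_measurable borel"
  unfolding fourier_def[abs_def] by measurable

lemma fourier_bound:
  fixes f :: "'a::euclidean_space \<Rightarrow> complex"
  shows "cmod (fourier f \<omega>) \<le> (LINT y|lborel. cmod (f y))"
  unfolding fourier_def by (rule order_trans[OF integral_norm_bound]) (simp add: norm_mult)

lemma fourier_add:
  fixes f :: "'a::euclidean_space \<Rightarrow> complex"
  assumes "integrable lborel f" "integrable lborel g"
  shows "fourier (\<lambda>x. f x + g x) \<omega> = fourier f \<omega> + fourier g \<omega>"
  unfolding fourier_def using fourier_integrable[OF assms(1), of \<omega>] fourier_integrable[OF assms(2), of \<omega>]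
  by (simp add: distrib_right)

lemma fourier_cmult:
  fixes f :: "'a::euclidean_space \<Rightarrow> complex"
  shows "fourier (\<lambda>x. c * f x) \<omega> = c * fourier f \<omega>"
  unfolding fourier_def mult.assoc by (rule integral_mult_right_zero)

lemma fourier_diff:
  fixes f :: "'a::euclidean_space \<Rightarrow> complex"
  assumes "integrable lborel f" "integrable lborel g"
  shows "fourier (\<lambda>x. f x - g x) \<omega> = fourier f \<omega> - fourier g \<omega>"
  unfolding fourier_def using fourier_integrable[OF assms(1), of \<omega>] fourier_integrable[OF assms(2), of \<omega>]
  by (simp add: left_diff_distrib)

lemma fourier_shift:
  fixes f :: "'a::euclidean_space \<Rightarrow> complex"
  assumes [measurable]: "f \<in> borel_measurable borel"
  shows "fourier (\<lambda>y. f (y + c)) \<omega> = cis (- (\<omega> \<bullet> c)) * fourier f \<omega>"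
proof -
  have "fourier f \<omega> = (LINT y|lborel. f (y + c) * cis (\<omega> \<bullet> (y + c)))"
    unfolding fourier_def by (rule integral_shift[symmetric]) measurable
  also have "\<dots> = (LINT y|lborel. cis (\<omega> \<bullet> c) * (f (y + c) * cis (\<omega> \<bullet> y)))"
    by (intro Bochner_Integration.integral_cong) (auto simp: inner_add_right cis_mult[symmetric] mult_ac)
  also have "\<dots> = cis (\<omega> \<bullet> c) * fourier (\<lambda>y. f (y + c)) \<omega>"
    unfolding fourier_def by (rule integral_mult_right_zero)
  finally show ?thesis by (simp add: mult.assoc[symmetric] cis_mult)
qed

lemma fourier_linear:
  fixes A :: "'n::{finite,wellorder} sqmat"
  assumes A: "invertible A" and [measurable]: "f \<in> borel_measurable borel"
  shows "fourier f \<omega> = of_real \<bar>det A\<bar> * fourier (\<lambda>y. f (A *v y)) (transpose A *v \<omega>)"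
proof -
  have "fourier f \<omega> = \<bar>det A\<bar> *\<^sub>R (LINT y|lborel. f (A *v y) * cis (\<omega> \<bullet> (A *v y)))"
    unfolding fourier_def by (rule integral_linear[OF A]) measurable
  moreover have "\<omega> \<bullet> (A *v y) = (transpose A *v \<omega>) \<bullet> y" for y
    by (simp add: transpose_matrix_vector dot_lmul_matrix)
  ultimately show ?thesis by (simp add: fourier_def scaleR_conv_of_real)
qed

subsection \<open>Gaussian functions\<close>

definition gauss :: "'a::euclidean_space \<Rightarrow> real" where
  "gauss w = (\<Prod>b\<in>Basis. std_normal_density (w \<bullet> b))"

lemma gauss_measurable [measurable]: "gauss \<in> borel_measurable borel"
  unfolding gauss_def[abs_def] by measurable

lemma gauss_nonneg [simp]: "0 \<le> gauss w"
  unfolding gauss_def by (intro prod_nonneg) simp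

lemma gauss_eq: "gauss (w::'a::euclidean_space) = (1 / sqrt (2 * pi)) ^ DIM('a) * exp (- (norm w)\<^sup>2 / 2)"
proof -
  have "(norm w)\<^sup>2 = (\<Sum>b\<in>Basis. (w \<bullet> b)\<^sup>2)"
    unfolding power2_norm_eq_inner by (subst euclidean_inner) (simp add: power2_eq_square)
  then have "exp (- (norm w)\<^sup>2 / 2) = (\<Prod>b\<in>Basis. exp (- (w \<bullet> b)\<^sup>2 / 2))"
    by (simp add: exp_sum[symmetric] sum_divide_distrib sum_negf)
  then show ?thesis by (simp add: gauss_def std_normal_density_def prod_dividef power_one_over)
qed

lemma gauss_fourier_real:
  "integrable lborel (\<lambda>x. of_real (std_normal_density x) * cis (t * x))"
  "(LINT x|lborel. of_real (std_normal_density x) * cis (t * x)) = of_real (exp (- t\<^sup>2 / 2))"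
proof -
  have "integrable lborel (\<lambda>x. complex_of_real (std_normal_density x))"
    using integrable_normal_density[of 1 0] by simp
  then show "integrable lborel (\<lambda>x. of_real (std_normal_density x) * cis (t * x))"
    by (rule Bochner_Integration.integrable_bound) (auto simp: norm_mult)
  have "of_real (exp (- t\<^sup>2 / 2)) = char std_normal_distribution t"
    by (simp add: char_std_normal_distribution)
  also have "\<dots> = (LINT x|lborel. of_real (std_normal_density x) * cis (t * x))"
    unfolding char_def by (subst integral_density) (auto simp: scaleR_conv_of_real cis_conv_exp mult_ac)
  finally show "(LINT x|lborel. of_real (std_normal_density x) * cis (t * x)) = of_real (exp (- t\<^sup>2 / 2))" by simp
qed

lemma lborel_integral_prod:
  fixes f :: "'a::euclidean_space \<Rightarrow> real \<Rightarrow> complex"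
  assumes int: "\<And>b. b \<in> Basis \<Longrightarrow> integrable lborel (f b)"
    and [measurable]: "\<And>b. f b \<in> borel_measurable borel"
  shows "(LINT x|lborel. (\<Prod>b\<in>Basis. f b (x \<bullet> b))) = (\<Prod>b\<in>Basis. LINT x|lborel. f b x)"
    "integrable lborel (\<lambda>x. \<Prod>b\<in>Basis. f b (x \<bullet> b))"
proof -
  interpret product_sigma_finite "\<lambda>_::'a. lborel :: real measure" by standard
  have e: "(\<Sum>b'\<in>Basis. x b' *\<^sub>R b') \<bullet> b = x b" if "b \<in> Basis" for x :: "'a \<Rightarrow> real" and b
    using that by (simp add: inner_sum_left inner_Basis if_distrib sum.delta cong: if_cong)
  have "(LINT x|lborel. (\<Prod>b\<in>Basis. f b (x \<bullet> b)))
     = (LINT x|(\<Pi>\<^sub>M b\<in>Basis. lborel). (\<Prod>b\<in>Basis. f b ((\<Sum>b'\<in>Basis. x b' *\<^sub>R b') \<bullet> b)))"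
    by (subst lborel_eq, subst integral_distr) auto
  also have "\<dots> = (LINT x|(\<Pi>\<^sub>M b\<in>Basis. lborel). (\<Prod>b\<in>Basis. f b (x b)))" by (simp add: e)
  also have "\<dots> = (\<Prod>b\<in>Basis. LINT x|lborel. f b x)"
    by (rule product_integral_prod) (auto intro: int)
  finally show "(LINT x|lborel. (\<Prod>b\<in>Basis. f b (x \<bullet> b))) = (\<Prod>b\<in>Basis. LINT x|lborel. f b x)" .
  have "integrable (\<Pi>\<^sub>M b\<in>Basis. lborel) (\<lambda>x. \<Prod>b\<in>Basis. f b ((\<Sum>b'\<in>Basis. x b' *\<^sub>R b') \<bullet> b))"
    using product_integrable_prod[of Basis f] int by (simp add: e)
  then show "integrable lborel (\<lambda>x. \<Prod>b\<in>Basis. f b (x \<bullet> b))"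
    by (subst lborel_eq, subst integrable_distr_eq) auto
qed

lemma
  fixes z :: "'a::euclidean_space"
  shows fourier_gauss: "fourier (\<lambda>w. of_real (gauss w)) z = of_real (exp (- (norm z)\<^sup>2 / 2))"
    and gauss_integrable_complex: "integrable lborel (\<lambda>w::'a. complex_of_real (gauss w))"
proof -
  have p: "of_real (gauss w) * cis (z \<bullet> w) = (\<Prod>b\<in>Basis. of_real (std_normal_density (w \<bullet> b)) * cis ((z \<bullet> b) * (w \<bullet> b)))"
    for w z :: 'a
  proof -
    have "cis (z \<bullet> w) = (\<Prod>b\<in>Basis. cis ((z \<bullet> b) * (w \<bullet> b)))"
      by (subst euclidean_inner) (simp add: cis_conv_exp exp_sum sum_distrib_left)
    then show ?thesis by (simp add: gauss_def prod.distrib)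
  qed
  have "fourier (\<lambda>w. of_real (gauss w)) z = (\<Prod>b\<in>Basis. of_real (exp (- (z \<bullet> b)\<^sup>2 / 2)))"
    unfolding fourier_def p by (subst lborel_integral_prod(1)) (auto simp: gauss_fourier_real)
  also have "\<dots> = of_real (exp (\<Sum>b\<in>Basis. - (z \<bullet> b)\<^sup>2 / 2))" by (simp add: exp_sum)
  also have "(\<Sum>b\<in>Basis. - (z \<bullet> b)\<^sup>2 / 2) = - (norm z)\<^sup>2 / 2"
    unfolding power2_norm_eq_inner by (subst euclidean_inner) (simp add: power2_eq_square sum_divide_distrib sum_negf)
  finally show "fourier (\<lambda>w. of_real (gauss w)) z = of_real (exp (- (norm z)\<^sup>2 / 2))" .
  have "integrable lborel (\<lambda>w::'a. of_real (gauss w) * cis (0 \<bullet> w))"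
    unfolding p by (rule lborel_integral_prod(2)) (auto intro: gauss_fourier_real)
  then show "integrable lborel (\<lambda>w::'a. complex_of_real (gauss w))" by simp
qed

lemma gauss_integrable: "integrable lborel (gauss :: 'a::euclidean_space \<Rightarrow> real)"
  using integrable_norm[OF gauss_integrable_complex] by simp

lemma gauss_integral: "(LINT w|lborel. gauss (w::'a::euclidean_space)) = 1"
proof -
  have "(LINT w|lborel. complex_of_real (gauss (w::'a))) = 1"
    using fourier_gauss[of "0::'a"] by (simp add: fourier_def)
  then show ?thesis by (simp only: integral_complex_of_real of_real_eq_1_iff)
qed

subsection \<open>Plancherel's formula and uniqueness\<close>

lemma integrable_pair_mult:
  fixes u :: "'a::euclidean_space \<Rightarrow> complex" and g :: "'b::euclidean_space \<Rightarrow> complex"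
  assumes u: "integrable lborel u" and g: "integrable lborel g"
    and k: "k \<in> borel_measurable (borel \<Otimes>\<^sub>M borel)" "\<And>x y. cmod (k (x, y)) \<le> 1"
  shows "integrable (lborel \<Otimes>\<^sub>M lborel) (\<lambda>(x, y). u x * g y * k (x, y))"
proof (rule Bochner_Integration.integrable_bound)
  have [measurable]: "u \<in> borel_measurable borel" "g \<in> borel_measurable borel"
    using u g by (auto dest: borel_measurable_integrable)
  show "integrable (lborel \<Otimes>\<^sub>M lborel) (\<lambda>(x, y). u x * g y)"
  proof (rule lborel_pair.Fubini_integrable)
    show "integrable lborel (\<lambda>x. LINT y|lborel. norm (case (x, y) of (x, y) \<Rightarrow> u x * g y))"
      using u by (simp add: norm_mult)
    show "AE x in lborel. integrable lborel (\<lambda>y. case (x, y) of (x, y) \<Rightarrow> u x * g y)"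
      using g by simp
  qed measurable
  have [measurable]: "k \<in> borel_measurable (borel \<Otimes>\<^sub>M borel)" by (rule k(1))
  show "(\<lambda>(x, y). u x * g y * k (x, y)) \<in> borel_measurable (lborel \<Otimes>\<^sub>M lborel)" by measurable
  show "AE z in lborel \<Otimes>\<^sub>M lborel. norm (case z of (x, y) \<Rightarrow> u x * g y * k (x, y)) \<le> norm (case z of (x, y) \<Rightarrow> u x * g y)"
    using k(2) by (intro AE_I2) (auto simp: norm_mult mult_left_le)
qed

lemma fourier_multiplication_formula:
  fixes u g :: "'a::euclidean_space \<Rightarrow> complex"
  assumes u: "integrable lborel u" and g: "integrable lborel g"
  shows "(LINT \<omega>|lborel. fourier u \<omega> * g \<omega>) = (LINT t|lborel. u t * fourier g t)"
proof -
  have [measurable]: "u \<in> borel_measurable borel" "g \<in> borel_measurable borel"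
    using u g by (auto dest: borel_measurable_integrable)
  have i: "integrable (lborel \<Otimes>\<^sub>M lborel) (\<lambda>(t, \<omega>). u t * g \<omega> * cis (\<omega> \<bullet> t))"
    using integrable_pair_mult[OF u g, of "\<lambda>(t, \<omega>). cis (\<omega> \<bullet> t)"] by simp
  have "(LINT \<omega>|lborel. fourier u \<omega> * g \<omega>) = (LINT \<omega>|lborel. LINT t|lborel. u t * g \<omega> * cis (\<omega> \<bullet> t))"
  proof (rule Bochner_Integration.integral_cong)
    fix \<omega>
    have "fourier u \<omega> * g \<omega> = (LINT t|lborel. (u t * cis (\<omega> \<bullet> t)) * g \<omega>)"
      unfolding fourier_def by (rule integral_mult_left_zero[symmetric])
    then show "fourier u \<omega> * g \<omega> = (LINT t|lborel. u t * g \<omega> * cis (\<omega> \<bullet> t))" by (simp add: mult_ac)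
  qed simp
  also have "\<dots> = (LINT t|lborel. LINT \<omega>|lborel. u t * g \<omega> * cis (\<omega> \<bullet> t))"
    by (rule lborel_pair.Fubini_integral[OF i])
  also have "\<dots> = (LINT t|lborel. u t * fourier g t)"
  proof (rule Bochner_Integration.integral_cong)
    fix t
    have "u t * fourier g t = (LINT \<omega>|lborel. u t * (g \<omega> * cis (t \<bullet> \<omega>)))"
      unfolding fourier_def by (rule integral_mult_right_zero[symmetric])
    then show "(LINT \<omega>|lborel. u t * g \<omega> * cis (\<omega> \<bullet> t)) = u t * fourier g t"
      by (simp add: mult_ac inner_commute)
  qed simp
  finally show ?thesis .
qed

lemma gauss_scaled:
  fixes w :: "real^'n::{finite,wellorder}"
  shows "exp (- (norm (e *\<^sub>R w))\<^sup>2 / 2) = sqrt (2 * pi) ^ CARD('n) * gauss (e *\<^sub>R w)"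
  by (simp add: gauss_eq power_mult_distrib[symmetric] mult.assoc[symmetric])

lemma integrable_scale:
  fixes f :: "real^'n::{finite,wellorder} \<Rightarrow> 'b::{banach, second_countable_topology}"
  assumes e: "e > 0" and f: "integrable lborel f"
  shows "integrable lborel (\<lambda>x. f (e *\<^sub>R x))"
proof -
  let ?A = "matrix ((*\<^sub>R) e) :: 'n sqmat"
  have "invertible ?A" using e by (simp add: invertible_det_nz)
  moreover have "?A *v x = e *\<^sub>R x" for x
    by (simp add: matrix_scaleR vec_eq_iff matrix_vector_mult_def mat_def mult_delta_left)
  ultimately show ?thesis using integrable_linear_iff[of ?A f] f by (auto dest: borel_measurable_integrable)
qed

text \<open>The Gaussian summability kernel: damping the Fourier transform by a Gaussian amounts to averaging
  the function with Gaussian weights.\<close>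

lemma fourier_gauss_summation:
  fixes u :: "real^'n::{finite,wellorder} \<Rightarrow> complex"
  assumes u: "integrable lborel u" and e: "e > 0"
  shows "(LINT \<omega>|lborel. fourier u \<omega> * of_real (exp (- (norm (e *\<^sub>R \<omega>))\<^sup>2 / 2)))
     = of_real ((2 * pi) ^ CARD('n)) * (LINT w|lborel. of_real (gauss w) * u (e *\<^sub>R w))"
proof -
  let ?N = "CARD('n)" and ?s = "sqrt (2 * pi) ^ CARD('n)"
  have ss: "?s * ?s = (2 * pi) ^ ?N" 
    unfolding power_mult_distrib[symmetric] by simp
  have [measurable]: "u \<in> borel_measurable borel" using u by (auto dest: borel_measurable_integrable)
  define g where "g \<omega> = complex_of_real (gauss (e *\<^sub>R \<omega>))" for \<omega> :: "(real, 'n) vec"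
  have gi: "integrable lborel g" unfolding g_def
    by (rule integrable_scale[OF e gauss_integrable_complex])
  have Fg: "of_real (e ^ ?N) * fourier g t = of_real (?s * gauss ((1/e) *\<^sub>R t))" for t
  proof -
    have "of_real (?s * gauss ((1/e) *\<^sub>R t)) = fourier (\<lambda>w. of_real (gauss w)) ((1/e) *\<^sub>R t)"
      by (subst gauss_scaled[symmetric]) (simp only: fourier_gauss)
    also have "\<dots> = e ^ ?N *\<^sub>R (LINT y|lborel. of_real (gauss (e *\<^sub>R y)) * cis (((1/e) *\<^sub>R t) \<bullet> (e *\<^sub>R y)))"
      unfolding fourier_def by (rule integral_scale[OF e]) measurable
    also have "\<dots> = of_real (e ^ ?N) * fourier g t"
    proof -
      have "((1/e) *\<^sub>R t) \<bullet> (e *\<^sub>R y) = t \<bullet> y" for y using e by simp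
      then show ?thesis by (simp only: fourier_def g_def scaleR_conv_of_real[where 'a = complex])
    qed
    finally show ?thesis by (rule sym)
  qed
  have "(LINT \<omega>|lborel. fourier u \<omega> * of_real (exp (- (norm (e *\<^sub>R \<omega>))\<^sup>2 / 2)))
      = (LINT \<omega>|lborel. of_real ?s * (fourier u \<omega> * g \<omega>))"
    by (simp only: gauss_scaled g_def of_real_mult mult_ac)
  also have "\<dots> = of_real ?s * (LINT t|lborel. u t * fourier g t)"
    by (simp only: integral_mult_right_zero fourier_multiplication_formula[OF u gi])
  also have "(LINT t|lborel. u t * fourier g t)
      = e ^ ?N *\<^sub>R (LINT w|lborel. u (e *\<^sub>R w) * fourier g (e *\<^sub>R w))"
    by (rule integral_scale[OF e]) (use gi in \<open>auto dest: borel_measurable_integrable\<close>)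
  also have "\<dots> = (LINT w|lborel. u (e *\<^sub>R w) * (of_real (e ^ ?N) * fourier g (e *\<^sub>R w)))"
    unfolding scaleR_conv_of_real by (subst integral_mult_right_zero[symmetric]) (simp only: mult_ac)
  also have "\<dots> = (LINT w|lborel. of_real ?s * (of_real (gauss w) * u (e *\<^sub>R w)))"
    unfolding Fg using e by (simp add: mult_ac)
  also have "\<dots> = of_real ?s * (LINT w|lborel. of_real (gauss w) * u (e *\<^sub>R w))"
    by (rule integral_mult_right_zero)
  also have "of_real ?s * (of_real ?s * (LINT w|lborel. of_real (gauss w) * u (e *\<^sub>R w)))
    = of_real ((2 * pi) ^ ?N) * (LINT w|lborel. of_real (gauss w) * u (e *\<^sub>R w))"
    unfolding ss[symmetric] by simp
  finally show ?thesis .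
qed

lemma gauss_average_tendsto:
  fixes \<Phi> :: "'a::euclidean_space \<Rightarrow> 'b::{banach, second_countable_topology}"
  assumes [measurable]: "\<Phi> \<in> borel_measurable borel" and b: "\<And>t. norm (\<Phi> t) \<le> C"
    and lim: "\<And>t. t \<longlonglongrightarrow> 0 \<Longrightarrow> (\<lambda>n. \<Phi> (t n)) \<longlonglongrightarrow> L"
  shows "(\<lambda>n. LINT w|lborel. gauss w *\<^sub>R \<Phi> ((1 / Suc n) *\<^sub>R w)) \<longlonglongrightarrow> L"
proof -
  have "(\<lambda>n. LINT w|lborel. gauss w *\<^sub>R \<Phi> ((1 / Suc n) *\<^sub>R w)) \<longlonglongrightarrow> (LINT w::'a|lborel. gauss w *\<^sub>R L)"
  proof (rule integral_dominated_convergence[where w = "\<lambda>w. C * gauss w"])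
    show "integrable lborel (\<lambda>w::'a. C * gauss w)" using gauss_integrable by (rule integrable_mult_right)
    show "AE w in lborel. (\<lambda>n. gauss w *\<^sub>R \<Phi> ((1 / Suc n) *\<^sub>R w)) \<longlonglongrightarrow> gauss w *\<^sub>R L"
    proof (intro AE_I2 tendsto_intros lim)
      fix w :: 'a
      have "(\<lambda>n. (1 / Suc n) *\<^sub>R w) \<longlonglongrightarrow> 0 *\<^sub>R w"
        by (intro tendsto_intros LIMSEQ_inverse_real_of_nat[unfolded inverse_eq_divide])
      then show "(\<lambda>n. (1 / Suc n) *\<^sub>R w) \<longlonglongrightarrow> 0" by simp
    qed
    show "AE w in lborel. norm (gauss w *\<^sub>R \<Phi> ((1 / Suc n) *\<^sub>R w)) \<le> C * gauss w" for n
      using b by (intro AE_I2) (auto simp: mult.commute[of C] intro!: mult_left_mono)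
  qed measurable
  also have "(LINT w::'a|lborel. gauss w *\<^sub>R L) = L"
    using gauss_integrable by (subst integral_scaleR_left) (auto simp: gauss_integral)
  finally show ?thesis .
qed

text \<open>By Gaussian summation for all translates of \<open>u\<close>, every Gaussian average \<open>\<integral> gauss(w) u(z + e w) dw\<close> vanishes; as
  \<open>e \<rightarrow> 0\<close> these averages tend to \<open>u\<close> in the mean by the continuity of translations.\<close>

theorem fourier_inj:
  fixes u :: "real^'n::{finite,wellorder} \<Rightarrow> complex"
  assumes u: "integrable lborel u" and zero: "\<And>\<omega>. fourier u \<omega> = 0"
  shows "AE x in lborel. u x = 0"
proof -
  have [measurable]: "u \<in> borel_measurable borel" using u by (auto dest: borel_measurable_integrable)
  define \<Phi> where "\<Phi> t = (LINT z|lborel. cmod (u z - u (z + t)))" for t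
  have [measurable]: "\<Phi> \<in> borel_measurable borel" unfolding \<Phi>_def by measurable
  have \<Phi>i: "integrable lborel (\<lambda>z. u z - u (z + t))" for t
    by (intro Bochner_Integration.integrable_diff integrable_shift u)
  have \<Phi>0: "0 \<le> \<Phi> t" for t by (simp add: \<Phi>_def)
  have \<Phi>b: "norm (\<Phi> t) \<le> 2 * (LINT z|lborel. cmod (u z))" for t
  proof -
    have "\<Phi> t \<le> (LINT z|lborel. cmod (u z) + cmod (u (z + t)))"
      unfolding \<Phi>_def by (intro integral_mono Bochner_Integration.integrable_add integrable_norm \<Phi>i u integrable_shift norm_triangle_ineq4)
    also have "\<dots> = (LINT z|lborel. cmod (u z)) + (LINT z|lborel. cmod (u (z + t)))"
      by (intro Bochner_Integration.integral_add integrable_norm u integrable_shift)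
    also have "(LINT z|lborel. cmod (u (z + t))) = (LINT z|lborel. cmod (u z))" by (rule integral_shift) measurable
    finally show ?thesis using \<Phi>0[of t] by simp
  qed
  have lim: "(\<lambda>n. LINT w|lborel. gauss w *\<^sub>R \<Phi> ((1 / Suc n) *\<^sub>R w)) \<longlonglongrightarrow> 0"
    by (rule gauss_average_tendsto[OF _ \<Phi>b])
       (use translation_continuous_integrable[OF u] in \<open>auto simp: translation_continuous_def \<Phi>_def\<close>)
  \<comment> \<open>Integrate \<open>\<bar>u z\<bar> \<le> \<integral> gauss w \<bar>u z - u (z + e w)\<bar> dw\<close> over \<open>z\<close> and exchange the integrals.\<close>
  have bound: "ennreal (LINT z|lborel. cmod (u z)) \<le> ennreal (LINT w|lborel. gauss w *\<^sub>R \<Phi> ((1 / Suc n) *\<^sub>R w))" for n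
  proof -
    define e where "e = 1 / real (Suc n)"
    have e: "e > 0" by (simp add: e_def)
    have gb: "gauss w \<le> 1" for w :: "(real, 'n) vec"
    proof -
      have "1 / sqrt (2 * pi) \<le> 1" using pi_ge_two by (simp add: real_le_rsqrt)
      then have "(1 / sqrt (2 * pi)) ^ CARD('n) \<le> 1" by (intro power_le_one) auto
      then show ?thesis unfolding gauss_eq using mult_mono[of "(1 / sqrt (2 * pi)) ^ CARD('n)" 1 "exp (- (norm w)\<^sup>2 / 2)" 1] by simp
    qed
    have pt: "cmod (u z) \<le> (LINT w|lborel. gauss w * cmod (u z - u (z + e *\<^sub>R w)))"
      and pti: "integrable lborel (\<lambda>w. gauss w * cmod (u z - u (z + e *\<^sub>R w)))" for z
    proof -
      have "fourier (\<lambda>y. u (y + z)) \<omega> = 0" for \<omega> by (subst fourier_shift) (simp_all add: zero)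
      then have z: "(LINT w|lborel. complex_of_real (gauss w) * u (e *\<^sub>R w + z)) = 0"
        using fourier_gauss_summation[OF integrable_shift[OF u, of z] e] by simp
      have i1: "integrable lborel (\<lambda>w. complex_of_real (gauss w) * u (e *\<^sub>R w + z))"
      proof (rule Bochner_Integration.integrable_bound[OF integrable_scale[OF e integrable_shift[OF u, of z]]])
        show "AE w in lborel. cmod (complex_of_real (gauss w) * u (e *\<^sub>R w + z)) \<le> cmod (u (e *\<^sub>R w + z))"
          using gb by (auto simp: norm_mult intro!: AE_I2 mult_left_le_one_le)
      qed measurable
      have i2: "integrable lborel (\<lambda>w::(real, 'n) vec. complex_of_real (gauss w) * u z)"
        using gauss_integrable_complex by (rule integrable_mult_left)
      have d: "complex_of_real (gauss w) * u z - complex_of_real (gauss w) * u (e *\<^sub>R w + z)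
         = complex_of_real (gauss w) * (u z - u (z + e *\<^sub>R w))" for w
        by (simp add: algebra_simps)
      have "u z = (LINT w::(real, 'n) vec|lborel. complex_of_real (gauss w) * u z)"
        using gauss_integral[where 'a = "(real, 'n) vec"] by simp
      also have "\<dots> = (LINT w|lborel. complex_of_real (gauss w) * (u z - u (z + e *\<^sub>R w)))"
        unfolding d[symmetric] using z by (subst Bochner_Integration.integral_diff[OF i2 i1]) simp
      finally have "cmod (u z) = cmod (LINT w|lborel. complex_of_real (gauss w) * (u z - u (z + e *\<^sub>R w)))" by simp
      also have "\<dots> \<le> (LINT w|lborel. cmod (complex_of_real (gauss w) * (u z - u (z + e *\<^sub>R w))))"
        by (rule integral_norm_bound)
      finally show "cmod (u z) \<le> (LINT w|lborel. gauss w * cmod (u z - u (z + e *\<^sub>R w)))"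
        by (simp add: norm_mult)
      show "integrable lborel (\<lambda>w. gauss w * cmod (u z - u (z + e *\<^sub>R w)))"
        using integrable_norm[OF Bochner_Integration.integrable_diff[OF i2 i1]] unfolding d norm_mult by simp
    qed
    have "ennreal (LINT z|lborel. cmod (u z)) = (\<integral>\<^sup>+z. ennreal (cmod (u z)) \<partial>lborel)"
      by (rule nn_integral_eq_integral[symmetric]) (use u in auto)
    also have "\<dots> \<le> (\<integral>\<^sup>+z. (\<integral>\<^sup>+w. ennreal (gauss w * cmod (u z - u (z + e *\<^sub>R w))) \<partial>lborel) \<partial>lborel)"
    proof (rule nn_integral_mono)
      fix z
      show "ennreal (cmod (u z)) \<le> (\<integral>\<^sup>+w. ennreal (gauss w * cmod (u z - u (z + e *\<^sub>R w))) \<partial>lborel)"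
        by (subst nn_integral_eq_integral[OF pti]) (use pt in \<open>auto intro: ennreal_leI\<close>)
    qed
    also have "\<dots> = (\<integral>\<^sup>+w. (\<integral>\<^sup>+z. ennreal (gauss w * cmod (u z - u (z + e *\<^sub>R w))) \<partial>lborel) \<partial>lborel)"
      by (rule lborel_pair.Fubini'[symmetric]) measurable
    also have "\<dots> = (\<integral>\<^sup>+w. ennreal (gauss w *\<^sub>R \<Phi> (e *\<^sub>R w)) \<partial>lborel)"
    proof (rule nn_integral_cong)
      fix w
      have "(\<integral>\<^sup>+z. ennreal (gauss w * cmod (u z - u (z + e *\<^sub>R w))) \<partial>lborel)
          = ennreal (LINT z|lborel. gauss w * cmod (u z - u (z + e *\<^sub>R w)))"
        by (rule nn_integral_eq_integral) (use \<Phi>i in auto)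
      then show "(\<integral>\<^sup>+z. ennreal (gauss w * cmod (u z - u (z + e *\<^sub>R w))) \<partial>lborel) = ennreal (gauss w *\<^sub>R \<Phi> (e *\<^sub>R w))"
        by (simp add: \<Phi>_def)
    qed
    also have "\<dots> = ennreal (LINT w|lborel. gauss w *\<^sub>R \<Phi> (e *\<^sub>R w))"
    proof (rule nn_integral_eq_integral)
      show "integrable lborel (\<lambda>w. gauss w *\<^sub>R \<Phi> (e *\<^sub>R w))"
      proof (rule Bochner_Integration.integrable_bound)
        show "integrable lborel (\<lambda>w::(real, 'n) vec. gauss w * (2 * (LINT z|lborel. cmod (u z))))"
          using gauss_integrable by (rule integrable_mult_left)
        show "AE w in lborel. norm (gauss w *\<^sub>R \<Phi> (e *\<^sub>R w)) \<le> norm (gauss w * (2 * (LINT z|lborel. cmod (u z))))"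
        proof (rule AE_I2)
          fix w :: "(real, 'n) vec"
          have "gauss w * norm (\<Phi> (e *\<^sub>R w)) \<le> gauss w * (2 * (LINT z|lborel. cmod (u z)))"
            by (intro mult_left_mono \<Phi>b) simp
          then show "norm (gauss w *\<^sub>R \<Phi> (e *\<^sub>R w)) \<le> norm (gauss w * (2 * (LINT z|lborel. cmod (u z))))"
            by (simp add: abs_mult)
        qed
      qed measurable
    qed (use \<Phi>0 in simp)
    finally show ?thesis by (simp add: e_def)
  qed
  have "(LINT z|lborel. cmod (u z)) \<le> 0"
  proof (rule LIMSEQ_le_const[OF lim], intro exI allI impI)
    fix n
    have "0 \<le> (LINT w|lborel. gauss w *\<^sub>R \<Phi> ((1 / Suc n) *\<^sub>R w))"
      by (rule Bochner_Integration.integral_nonneg) (simp add: \<Phi>0)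
    then show "(LINT z|lborel. cmod (u z)) \<le> (LINT w|lborel. gauss w *\<^sub>R \<Phi> ((1 / Suc n) *\<^sub>R w))"
      using bound[of n] by simp
  qed
  then have "(LINT z|lborel. cmod (u z)) = 0" by (simp add: antisym)
  then show ?thesis using integral_nonneg_eq_0_iff_AE[OF integrable_norm[OF u]] by simp
qed

text \<open>The squared modulus of the transform is the transform of the autocorrelation \<open>A\<close> of \<open>f\<close>. Gaussian summation of \<open>A\<close>
  recovers \<open>A(0) = \<parallel>f\<parallel>\<^sup>2\<close>, and on the Fourier side the Gaussian factors increase to \<open>1\<close>, so that monotone convergence applies.\<close>

theorem Plancherel_test_fun:
  fixes f :: "real^'n::{finite,wellorder} \<Rightarrow> complex"
  assumes f: "f \<in> test_fun"
  shows fourier_test_fun_L2: "fourier f \<in> L2 lborel"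
    and sq_norm_fourier: "sq_norm lborel (fourier f) = (2 * pi) ^ CARD('n) * sq_norm lborel f"
proof -
  obtain C R where CR: "C \<ge> 0" "\<And>x. cmod (f x) \<le> C" "\<And>x. norm x > R \<Longrightarrow> f x = 0"
    by (rule test_funE[OF f]) blast
  have [measurable]: "f \<in> borel_measurable borel" using f by (rule test_fun_measurable)
  have fi: "integrable lborel f" using f by (rule test_fun_integrable)
  define A where "A t = (LINT y|lborel. f (y + t) * cnj (f y))" for t
  have [measurable]: "A \<in> borel_measurable borel" unfolding A_def by measurable
  have test2: "(\<lambda>(t, y). f (y + t) * cnj (f y) * cis (\<omega> \<bullet> t)) \<in> test_fun" for \<omega>
  proof (rule test_funI)
    show "(\<lambda>(t, y). f (y + t) * cnj (f y) * cis (\<omega> \<bullet> t)) \<in> borel_measurable borel"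
      unfolding borel_prod[symmetric] by measurable
    show "cmod (case p of (t, y) \<Rightarrow> f (y + t) * cnj (f y) * cis (\<omega> \<bullet> t)) \<le> C * C" for p
      using CR by (auto simp: norm_mult split: prod.split intro!: mult_mono)
    fix p :: "((real, 'n) vec) \<times> ((real, 'n) vec)" assume p: "norm p > 3 * \<bar>R\<bar>"
    obtain t y where ty: "p = (t, y)" by (cases p)
    have "f (y + t) = 0 \<or> f y = 0"
    proof (rule ccontr)
      assume "\<not> ?thesis"
      then have "norm (y + t) \<le> R" "norm y \<le> R" using CR(3) not_le by blast+
      moreover have "norm t \<le> norm (y + t) + norm y" by (metis add_diff_cancel_left' norm_triangle_ineq4)
      moreover have "norm p \<le> norm t + norm y" unfolding ty by (rule norm_Pair_le)
      ultimately show False using p by linarith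
    qed
    then show "(case p of (t, y) \<Rightarrow> f (y + t) * cnj (f y) * cis (\<omega> \<bullet> t)) = 0" by (auto simp: ty)
  qed
  have int2: "integrable (lborel \<Otimes>\<^sub>M lborel) (\<lambda>(t, y). f (y + t) * cnj (f y) * cis (\<omega> \<bullet> t))" for \<omega>
    unfolding lborel_prod by (rule test_fun_integrable[OF test2])
  have Ai: "integrable lborel A"
    using lborel_pair.integrable_fst'[OF int2[of 0]] by (simp add: A_def[abs_def])
  have FA: "fourier A \<omega> = of_real ((cmod (fourier f \<omega>))\<^sup>2)" for \<omega>
  proof -
    have "fourier A \<omega> = (LINT t|lborel. LINT y|lborel. f (y + t) * cnj (f y) * cis (\<omega> \<bullet> t))"
      unfolding fourier_def A_def by (subst integral_mult_left_zero[symmetric]) simp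
    also have "\<dots> = (LINT y|lborel. LINT t|lborel. f (y + t) * cnj (f y) * cis (\<omega> \<bullet> t))"
      by (rule lborel_pair.Fubini_integral[OF int2, symmetric])
    also have "\<dots> = (LINT y|lborel. cnj (f y * cis (\<omega> \<bullet> y)) * fourier f \<omega>)"
    proof (rule Bochner_Integration.integral_cong)
      fix y
      have "(LINT t|lborel. f (y + t) * cnj (f y) * cis (\<omega> \<bullet> t)) = (LINT t|lborel. cnj (f y) * (f (t + y) * cis (\<omega> \<bullet> t)))"
        by (simp add: mult_ac add.commute)
      also have "\<dots> = cnj (f y) * fourier (\<lambda>t. f (t + y)) \<omega>"
        unfolding fourier_def by (rule integral_mult_right_zero)
      finally show "(LINT t|lborel. f (y + t) * cnj (f y) * cis (\<omega> \<bullet> t)) = cnj (f y * cis (\<omega> \<bullet> y)) * fourier f \<omega>"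
        by (simp add: fourier_shift cis_cnj)
    qed simp
    also have "\<dots> = cnj (fourier f \<omega>) * fourier f \<omega>"
      unfolding fourier_def[of f] integral_mult_left_zero Bochner_Integration.integral_cnj ..
    also have "\<dots> = of_real ((cmod (fourier f \<omega>))\<^sup>2)" by (simp only: complex_norm_square mult.commute)
    finally show ?thesis .
  qed
  have A0: "A 0 = of_real (sq_norm lborel f)"
    using L2_inner_self[of lborel f] by (simp add: A_def L2_inner_def)
  have Ab: "norm (A t) \<le> C * (LINT y|lborel. cmod (f y))" for t
  proof -
    have "norm (A t) \<le> (LINT y|lborel. cmod (f (y + t) * cnj (f y)))" unfolding A_def by (rule integral_norm_bound)
    also have "\<dots> \<le> (LINT y|lborel. C * cmod (f y))"
    proof (rule integral_mono')
      show "integrable lborel (\<lambda>y. C * cmod (f y))" using fi by simp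
      show "cmod (f (y + t) * cnj (f y)) \<le> C * cmod (f y)" for y
        using CR(2)[of "y + t"] by (simp add: norm_mult mult_right_mono)
    qed (use CR in simp)
    finally show ?thesis by simp
  qed
  have Alim: "(\<lambda>n. A (t n)) \<longlonglongrightarrow> A 0" if t: "t \<longlonglongrightarrow> 0" for t
  proof -
    have bd: "norm (A s - A 0) \<le> C * (LINT y|lborel. cmod (f y - f (y + s)))" for s
    proof -
      have i: "integrable lborel (\<lambda>y. f (y + s) * cnj (f y))" for s
      proof (rule Bochner_Integration.integrable_bound)
        show "integrable lborel (\<lambda>y. C * cmod (f y))" using fi by simp
        show "AE y in lborel. cmod (f (y + s) * cnj (f y)) \<le> norm (C * cmod (f y))"
          using CR by (auto simp: norm_mult abs_mult intro!: AE_I2 mult_right_mono)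
      qed measurable
      have "A s - A 0 = (LINT y|lborel. f (y + s) * cnj (f y) - f (y + 0) * cnj (f y))"
        unfolding A_def by (rule Bochner_Integration.integral_diff[symmetric, OF i i])
      also have "norm \<dots> \<le> (LINT y|lborel. cmod (f (y + s) * cnj (f y) - f (y + 0) * cnj (f y)))" by (rule integral_norm_bound)
      also have "\<dots> \<le> (LINT y|lborel. C * cmod (f y - f (y + s)))"
      proof (rule integral_mono')
        show "integrable lborel (\<lambda>y. C * cmod (f y - f (y + s)))"
          by (intro integrable_mult_right integrable_norm Bochner_Integration.integrable_diff fi integrable_shift)
        show "cmod (f (y + s) * cnj (f y) - f (y + 0) * cnj (f y)) \<le> C * cmod (f y - f (y + s))" for y
        proof -
          have "f (y + s) * cnj (f y) - f (y + 0) * cnj (f y) = - (cnj (f y) * (f y - f (y + s)))"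
            by (simp add: algebra_simps)
          then show ?thesis
            using mult_right_mono[OF CR(2)[of y], of "cmod (f y - f (y + s))"] by (simp add: norm_mult)
        qed
      qed (use CR in simp)
      finally show ?thesis by simp
    qed
    have "(\<lambda>n. C * (LINT y|lborel. cmod (f y - f (y + t n)))) \<longlonglongrightarrow> C * 0"
      using translation_continuous_integrable[OF fi] t unfolding translation_continuous_def
      by (intro tendsto_intros) auto
    then have lim0: "(\<lambda>n. C * (LINT y|lborel. cmod (f y - f (y + t n)))) \<longlonglongrightarrow> 0" by simp
    have "(\<lambda>n. A (t n) - A 0) \<longlonglongrightarrow> 0"
      by (rule Lim_null_comparison[OF always_eventually lim0]) (use bd in blast)
    then show ?thesis by (simp add: LIM_zero_iff)
  qed
  let ?I = "\<lambda>n \<omega>. (cmod (fourier f \<omega>))\<^sup>2 * exp (- (norm ((1 / Suc n) *\<^sub>R \<omega>))\<^sup>2 / 2)"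
  have eq: "(LINT \<omega>|lborel. ?I n \<omega>)
     = Re (of_real ((2 * pi) ^ CARD('n)) * (LINT w|lborel. gauss w *\<^sub>R A ((1 / Suc n) *\<^sub>R w)))" for n
  proof -
    have "complex_of_real (LINT \<omega>|lborel. ?I n \<omega>) = (LINT \<omega>|lborel. fourier A \<omega> * of_real (exp (- (norm ((1 / Suc n) *\<^sub>R \<omega>))\<^sup>2 / 2)))"
      unfolding FA of_real_mult[symmetric] by (rule integral_complex_of_real[symmetric])
    also have "\<dots> = of_real ((2 * pi) ^ CARD('n)) * (LINT w|lborel. gauss w *\<^sub>R A ((1 / Suc n) *\<^sub>R w))"
      by (subst fourier_gauss_summation[OF Ai]) (simp_all add: scaleR_conv_of_real)
    finally have "Re (complex_of_real (LINT \<omega>|lborel. ?I n \<omega>))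
      = Re (of_real ((2 * pi) ^ CARD('n)) * (LINT w|lborel. gauss w *\<^sub>R A ((1 / Suc n) *\<^sub>R w)))" by (rule arg_cong)
    then show ?thesis by (simp only: Re_complex_of_real)
  qed
  have lim: "(\<lambda>n. LINT \<omega>|lborel. ?I n \<omega>) \<longlonglongrightarrow> (2 * pi) ^ CARD('n) * sq_norm lborel f"
  proof -
    have "(\<lambda>n. Re (of_real ((2 * pi) ^ CARD('n)) * (LINT w|lborel. gauss w *\<^sub>R A ((1 / Suc n) *\<^sub>R w))))
      \<longlonglongrightarrow> Re (of_real ((2 * pi) ^ CARD('n)) * A 0)"
      by (intro tendsto_intros gauss_average_tendsto[OF _ Ab] Alim) measurable
    then show ?thesis by (simp only: eq A0 of_real_mult[symmetric] Re_complex_of_real)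
  qed
  have Fb: "(cmod (fourier f \<omega>))\<^sup>2 \<le> (LINT y|lborel. cmod (f y))\<^sup>2" for \<omega>
    by (intro power_mono fourier_bound) simp
  have I1: "integrable lborel (?I n)" for n
  proof (rule Bochner_Integration.integrable_bound)
    have gi: "integrable lborel (\<lambda>\<omega>::(real, 'n) vec. exp (- (norm ((1 / Suc n) *\<^sub>R \<omega>))\<^sup>2 / 2))"
      unfolding gauss_scaled by (intro integrable_mult_right integrable_scale gauss_integrable) simp
    show "integrable lborel (\<lambda>\<omega>::(real, 'n) vec. (LINT y|lborel. cmod (f y))\<^sup>2 * exp (- (norm ((1 / Suc n) *\<^sub>R \<omega>))\<^sup>2 / 2))"
      using gi by (rule integrable_mult_right)
    show "AE \<omega> in lborel. norm (?I n \<omega>) \<le> norm ((LINT y|lborel. cmod (f y))\<^sup>2 * exp (- (norm ((1 / Suc n) *\<^sub>R \<omega>))\<^sup>2 / 2))"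
    proof (rule AE_I2)
      fix \<omega> :: "(real, 'n) vec"
      show "norm (?I n \<omega>) \<le> norm ((LINT y|lborel. cmod (f y))\<^sup>2 * exp (- (norm ((1 / Suc n) *\<^sub>R \<omega>))\<^sup>2 / 2))"
        using mult_right_mono[OF Fb[of \<omega>], of "exp (- (norm ((1 / Suc n) *\<^sub>R \<omega>))\<^sup>2 / 2)"]
        unfolding real_norm_def abs_mult by simp
    qed
  qed measurable
  have I2: "AE \<omega> in lborel. mono (\<lambda>n. ?I n \<omega>)"
  proof (rule AE_I2, rule monoI, rule mult_left_mono)
    fix \<omega> :: "(real, 'n) vec" and m n :: nat assume "m \<le> n"
    then have "norm ((1 / Suc n) *\<^sub>R \<omega>) \<le> norm ((1 / Suc m) *\<^sub>R \<omega>)"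
      unfolding norm_scaleR by (intro mult_right_mono) (auto simp: divide_left_mono)
    then have "(norm ((1 / Suc n) *\<^sub>R \<omega>))\<^sup>2 \<le> (norm ((1 / Suc m) *\<^sub>R \<omega>))\<^sup>2" by (rule power_mono) simp
    then show "exp (- (norm ((1 / Suc m) *\<^sub>R \<omega>))\<^sup>2 / 2) \<le> exp (- (norm ((1 / Suc n) *\<^sub>R \<omega>))\<^sup>2 / 2)"
      unfolding exp_le_cancel_iff by linarith
  qed simp
  have I3: "AE \<omega> in lborel. 0 \<le> ?I n \<omega>" for n by (rule AE_I2) simp
  have I4: "AE \<omega> in lborel. (\<lambda>n. ?I n \<omega>) \<longlonglongrightarrow> (cmod (fourier f \<omega>))\<^sup>2"
  proof (rule AE_I2)
    fix \<omega> :: "(real, 'n) vec"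
    have "(\<lambda>n. ?I n \<omega>) \<longlonglongrightarrow> (cmod (fourier f \<omega>))\<^sup>2 * exp (- (norm (0 *\<^sub>R \<omega>))\<^sup>2 / 2)"
      by (intro tendsto_intros LIMSEQ_inverse_real_of_nat[unfolded inverse_eq_divide]) simp
    then show "(\<lambda>n. ?I n \<omega>) \<longlonglongrightarrow> (cmod (fourier f \<omega>))\<^sup>2" by simp
  qed
  have I5: "(\<lambda>\<omega>. (cmod (fourier f \<omega>))\<^sup>2) \<in> borel_measurable lborel" by measurable
  have conv: "integrable lborel (\<lambda>\<omega>. (cmod (fourier f \<omega>))\<^sup>2)"
      "(LINT \<omega>|lborel. (cmod (fourier f \<omega>))\<^sup>2) = (2 * pi) ^ CARD('n) * sq_norm lborel f"
    using integral_monotone_convergence_nonneg[OF I1 I2 I3 I4 lim I5] by blast+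
  then show "fourier f \<in> L2 lborel" by (simp add: L2_def)
  show "sq_norm lborel (fourier f) = (2 * pi) ^ CARD('n) * sq_norm lborel f"
    using conv by (simp add: sq_norm_def)
qed

corollary Plancherel_inner:
  fixes f g :: "real^'n::{finite,wellorder} \<Rightarrow> complex"
  assumes f: "f \<in> test_fun" and g: "g \<in> test_fun"
  shows "L2_inner lborel (fourier f) (fourier g) = of_real ((2 * pi) ^ CARD('n)) * L2_inner lborel f g"
proof -
  have h: "(\<lambda>x. f x + c * g x) \<in> test_fun" for c by (intro test_fun_add f test_fun_cmult g)
  have F: "sq_norm lborel (\<lambda>x. fourier f x + c * fourier g x)
      = (2 * pi) ^ CARD('n) * sq_norm lborel (\<lambda>x. f x + c * g x)" for c
  proof -
    have "fourier f x + c * fourier g x = fourier (\<lambda>x. f x + c * g x) x" for x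
      by (subst fourier_add) (simp_all add: fourier_cmult test_fun_integrable f test_fun_cmult g)
    then show ?thesis by (simp add: sq_norm_fourier[OF h])
  qed
  show ?thesis
    unfolding polarization_identity[OF fourier_test_fun_L2[OF f] fourier_test_fun_L2[OF g]]
      polarization_identity[OF test_fun_L2[OF f] test_fun_L2[OF g]]
    using F[of 1] F[of \<i>] sq_norm_fourier[OF f] sq_norm_fourier[OF g]
    by (simp add: complex_eq_iff algebra_simps diff_divide_distrib)
qed

lemma fourier_indicator_cball:
  fixes a :: "real^'n::{finite,wellorder}"
  assumes r: "r > 0"
  shows "(indicator (cball a r) :: _ \<Rightarrow> complex) \<in> test_fun"
    and "fourier (indicator (cball a r)) \<in> L2 lborel - L2_null lborel"
proof -
  show t: "(indicator (cball a r) :: _ \<Rightarrow> complex) \<in> test_fun" by (rule test_fun_indicator) auto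
  have "(cmod (indicator (cball a r) x))\<^sup>2 = indicator (cball a r) x" for x by (simp add: indicator_def)
  then have "sq_norm lborel (indicator (cball a r)) = measure lborel (cball a r)" by (simp add: sq_norm_def)
  then show "fourier (indicator (cball a r)) \<in> L2 lborel - L2_null lborel"
    using fourier_test_fun_L2[OF t] sq_norm_fourier[OF t] content_cball_pos[OF r, of a] by (auto simp: L2_null_iff)
qed

text \<open>The graph of the Fourier transform on \<open>L\<^sup>2\<close>: the closure of its restriction to test functions.\<close>

definition fourier_pair :: "((real, 'n::{finite,wellorder}) vec \<Rightarrow> complex) \<Rightarrow> ((real, 'n) vec \<Rightarrow> complex) \<Rightarrow> bool" where
  "fourier_pair f G \<longleftrightarrow> f \<in> L2 lborel \<and> G \<in> L2 lborel \<and>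
     (\<exists>u. (\<forall>n. u n \<in> test_fun) \<and> (\<lambda>n. L2_dist lborel (u n) f) \<longlonglongrightarrow> 0
        \<and> (\<lambda>n. L2_dist lborel (fourier (u n)) G) \<longlonglongrightarrow> 0)"

lemma test_fun_dense:
  fixes f :: "'a::euclidean_space \<Rightarrow> complex"
  assumes f: "f \<in> L2 lborel"
  obtains u where "\<And>n. u n \<in> test_fun" "(\<lambda>n. L2_dist lborel (u n) f) \<longlonglongrightarrow> 0"
proof
  have [measurable]: "f \<in> borel_measurable borel" using L2_measurable[OF f] by simp
  define u where "u n x = (if cmod (f x) \<le> real n \<and> norm x \<le> real n then f x else 0)" for n x
  have [measurable]: "u n \<in> borel_measurable borel" for n unfolding u_def by measurable
  show "u n \<in> test_fun" for n by (rule test_funI[of _ "real n" "real n"]) (auto simp: u_def)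
  have "(\<lambda>n. LINT x|lborel. (cmod (u n x - f x))\<^sup>2) \<longlonglongrightarrow> (LINT x::'a|lborel. 0::real)"
  proof (rule integral_dominated_convergence[where w = "\<lambda>x. (cmod (f x))\<^sup>2"])
    show "integrable lborel (\<lambda>x. (cmod (f x))\<^sup>2)" using f by (rule L2_integrable_sq)
    show "AE x in lborel. (\<lambda>n. (cmod (u n x - f x))\<^sup>2) \<longlonglongrightarrow> 0"
    proof (rule AE_I2)
      fix x :: 'a
      obtain N where N: "cmod (f x) \<le> real N" "norm x \<le> real N"
        using real_arch_simple[of "max (cmod (f x)) (norm x)"] by auto
      have "eventually (\<lambda>n. (cmod (u n x - f x))\<^sup>2 = 0) sequentially"
        using N by (intro eventually_sequentiallyI[of N]) (auto simp: u_def)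
      then show "(\<lambda>n. (cmod (u n x - f x))\<^sup>2) \<longlonglongrightarrow> 0" by (rule tendsto_eventually)
    qed
    show "AE x in lborel. norm ((cmod (u n x - f x))\<^sup>2) \<le> (cmod (f x))\<^sup>2" for n
      by (rule AE_I2) (auto simp: u_def)
  qed measurable
  then have "(\<lambda>n. sqrt (LINT x|lborel. (cmod (u n x - f x))\<^sup>2)) \<longlonglongrightarrow> sqrt 0"
    by (intro tendsto_real_sqrt) simp
  then show "(\<lambda>n. L2_dist lborel (u n) f) \<longlonglongrightarrow> 0" by (simp add: L2_dist_def)
qed

lemma fourier_pair_exists:
  fixes f :: "real^'n::{finite,wellorder} \<Rightarrow> complex"
  assumes f: "f \<in> L2 lborel"
  obtains G where "fourier_pair f G"
proof -
  obtain u where u: "\<And>n. u n \<in> test_fun" "(\<lambda>n. L2_dist lborel (u n) f) \<longlonglongrightarrow> 0"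
    using test_fun_dense[OF f] by blast
  define c where "c = sqrt ((2 * pi) ^ CARD('n))"
  have c: "c > 0" by (simp add: c_def)
  have iso: "L2_dist lborel (fourier (u m)) (fourier (u n)) = c * L2_dist lborel (u m) (u n)" for m n
  proof -
    have "fourier (u m) x - fourier (u n) x = fourier (\<lambda>x. u m x - u n x) x" for x
      by (rule fourier_diff[symmetric]) (intro test_fun_integrable u)+
    then show ?thesis
      unfolding L2_dist_eq_sqrt c_def by (simp add: sq_norm_fourier[OF test_fun_diff[OF u(1) u(1)]] real_sqrt_mult)
  qed
  obtain G where G: "G \<in> L2 lborel" "(\<lambda>n. L2_dist lborel (fourier (u n)) G) \<longlonglongrightarrow> 0"
  proof (rule L2_complete[of "\<lambda>n. fourier (u n)" lborel])
    show "fourier (u n) \<in> L2 lborel" for n using u(1) by (rule fourier_test_fun_L2)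
    fix e :: real assume e: "e > 0"
    have "e / (2 * c) > 0" using e c by simp
    then obtain N where N: "\<And>n. n \<ge> N \<Longrightarrow> L2_dist lborel (u n) f < e / (2 * c)"
      using LIMSEQ_D[OF u(2), of "e / (2 * c)"] by fastforce
    have "L2_dist lborel (fourier (u m)) (fourier (u n)) < e" if "m \<ge> N" "n \<ge> N" for m n
    proof -
      have "L2_dist lborel (u m) (u n) \<le> L2_dist lborel (u m) f + L2_dist lborel f (u n)"
        by (rule L2_dist_triangle) (intro test_fun_L2 u f)+
      also have "\<dots> < e / c" using N[OF that(1)] N[OF that(2)] by (simp add: L2_dist_commute[of _ f] field_simps)
      finally show ?thesis unfolding iso using c by (simp add: field_simps)
    qed
    then show "\<exists>N. \<forall>m\<ge>N. \<forall>n\<ge>N. L2_dist lborel (fourier (u m)) (fourier (u n)) < e" by blast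
  qed blast
  then have "fourier_pair f G" unfolding fourier_pair_def using f u by blast
  then show ?thesis by (rule that)
qed

theorem fourier_pair_inner:
  fixes f g :: "real^'n::{finite,wellorder} \<Rightarrow> complex"
  assumes "fourier_pair f F" "fourier_pair g G"
  shows "L2_inner lborel F G = of_real ((2 * pi) ^ CARD('n)) * L2_inner lborel f g"
proof -
  obtain u where u: "\<And>n. u n \<in> test_fun" "(\<lambda>n. L2_dist lborel (u n) f) \<longlonglongrightarrow> 0"
      "(\<lambda>n. L2_dist lborel (fourier (u n)) F) \<longlonglongrightarrow> 0"
    using assms(1) unfolding fourier_pair_def by blast
  obtain v where v: "\<And>n. v n \<in> test_fun" "(\<lambda>n. L2_dist lborel (v n) g) \<longlonglongrightarrow> 0"
      "(\<lambda>n. L2_dist lborel (fourier (v n)) G) \<longlonglongrightarrow> 0"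
    using assms(2) unfolding fourier_pair_def by blast
  have L: "f \<in> L2 lborel" "g \<in> L2 lborel" "F \<in> L2 lborel" "G \<in> L2 lborel"
    using assms by (auto simp: fourier_pair_def)
  have "(\<lambda>n. L2_inner lborel (fourier (u n)) (fourier (v n))) \<longlonglongrightarrow> L2_inner lborel F G"
    by (intro tendsto_L2_inner L fourier_test_fun_L2 u v)
  moreover have "(\<lambda>n. of_real ((2 * pi) ^ CARD('n)) * L2_inner lborel (u n) (v n))
      \<longlonglongrightarrow> of_real ((2 * pi) ^ CARD('n)) * L2_inner lborel f g"
    by (intro tendsto_mult tendsto_const tendsto_L2_inner L test_fun_L2 u v)
  ultimately show ?thesis
    unfolding Plancherel_inner[OF u(1) v(1)] by (rule LIMSEQ_unique)
qed

lemma fourier_pair_null: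
  fixes f :: "real^'n::{finite,wellorder} \<Rightarrow> complex"
  assumes "fourier_pair f F"
  shows "F \<in> L2_null lborel \<longleftrightarrow> f \<in> L2_null lborel"
proof -
  have "complex_of_real (sq_norm lborel F) = of_real ((2 * pi) ^ CARD('n) * sq_norm lborel f)"
    using fourier_pair_inner[OF assms assms] by (simp add: L2_inner_self)
  then have "sq_norm lborel F = (2 * pi) ^ CARD('n) * sq_norm lborel f" by (simp only: of_real_eq_iff)
  then show ?thesis using assms by (auto simp: L2_null_iff fourier_pair_def)
qed

section \<open>The quasi-regular representation on the Fourier side\<close>

lemma invertible_transpose: "invertible A \<Longrightarrow> invertible (transpose A)"
  for A :: "'n::finite sqmat"
  by (simp add: invertible_det_nz)

lemma det_matrix_inv:
  fixes A :: "'n::finite sqmat"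
  assumes "invertible A" shows "det (matrix_inv A) = 1 / det A"
  using matrix_inv_mult[OF assms] det_mul[of A "matrix_inv A"] assms
  by (simp add: invertible_det_nz field_simps)

lemma invertible_matrix_inv:
  fixes A :: "'n::finite sqmat"
  assumes "invertible A" shows "invertible (matrix_inv A)"
  using matrix_inv_mult[OF assms] unfolding invertible_def by blast

lemma test_fun_affine:
  fixes A :: "'n::{finite,wellorder} sqmat"
  assumes A: "invertible A" and f: "f \<in> test_fun"
  shows "(\<lambda>y. f (A *v (y + b))) \<in> test_fun"
proof -
  obtain C R where CR: "C \<ge> 0" "\<And>x. cmod (f x) \<le> C" "\<And>x. norm x > R \<Longrightarrow> f x = 0"
    by (rule test_funE[OF f]) blast
  have [measurable]: "f \<in> borel_measurable borel" using f by (rule test_fun_measurable)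
  obtain K where K: "K > 0" "\<And>x. norm (matrix_inv A *v x) \<le> norm x * K"
    using bounded_linear.pos_bounded[OF matrix_vector_mul_bounded_linear[of "matrix_inv A"]] by blast
  show ?thesis
  proof (rule test_funI)
    show "cmod (f (A *v (y + b))) \<le> C" for y :: "(real, 'n) vec" by (rule CR)
    fix y :: "(real, 'n) vec" assume y: "norm y > \<bar>R\<bar> * K + norm b"
    show "f (A *v (y + b)) = 0"
    proof (rule CR(3), rule ccontr)
      assume "\<not> R < norm (A *v (y + b))"
      then have "norm (matrix_inv A *v (A *v (y + b))) \<le> \<bar>R\<bar> * K"
        by (intro order_trans[OF K(2)] mult_right_mono) (use K in auto)
      then have "norm (y + b) \<le> \<bar>R\<bar> * K" by (simp add: matrix_vector_mul_assoc matrix_inv_mult[OF A])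
      then show False using y norm_triangle_ineq4[of "y + b" b] by simp
    qed
  qed measurable
qed

text \<open>The action of the quasi-regular representation on Fourier transforms.\<close>

definition dual_action ::
    "(real^'n) \<times> 'n::finite sqmat \<Rightarrow> (real^'n \<Rightarrow> complex) \<Rightarrow> real^'n \<Rightarrow> complex" where
  "dual_action = (\<lambda>(x, h) F \<omega>.
     of_real (\<bar>det h\<bar> powr (1/2)) * cis (\<omega> \<bullet> x) * F (transpose h *v \<omega>))"

lemma powr_half_mult:
  assumes "(a::real) > 0"
  shows "a * a powr (- 1 / 2) = a powr (1/2)" "(1 / a) * a powr (1/2) = a powr (-1/2)"
    "(a powr (- 1/2))\<^sup>2 * a = 1" "(a powr (1/2))\<^sup>2 * (1 / a) = 1"
proof -
  show "a * a powr (- 1 / 2) = a powr (1/2)" using assms powr_add[of a 1 "-1/2"] by simp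
  show "(1 / a) * a powr (1/2) = a powr (-1/2)"
    using assms powr_add[of a "-1" "1/2"] by (simp add: powr_minus_divide)
  show "(a powr (- 1/2))\<^sup>2 * a = 1"
    using assms powr_add[of a "-1/2" "-1/2"] by (simp add: power2_eq_square powr_minus_divide)
  show "(a powr (1/2))\<^sup>2 * (1 / a) = 1"
    using assms powr_add[of a "1/2" "1/2"] by (simp add: power2_eq_square)
qed

lemma quasi_regular_measurable:
  assumes [measurable]: "f \<in> borel_measurable borel"
  shows "quasi_regular (x, h) f \<in> borel_measurable borel"
proof -
  have [measurable]: "(\<lambda>y. matrix_inv h *v (y - x)) \<in> borel_measurable borel"
    by (rule measurable_compose[OF _ matrix_mult_measurable]) measurable
  show ?thesis unfolding quasi_regular_def prod.case by measurable
qed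

lemma fourier_quasi_regular:
  fixes h :: "'n::{finite,wellorder} sqmat"
  assumes h: "invertible h" and [measurable]: "f \<in> borel_measurable borel"
  shows "fourier (quasi_regular (x, h) f) \<omega> = dual_action (x, h) (fourier f) \<omega>"
proof -
  have d: "\<bar>det h\<bar> > 0" using h by (simp add: invertible_det_nz)
  let ?g = "\<lambda>y. f (matrix_inv h *v y)"
  have [measurable]: "?g \<in> borel_measurable borel"
    by (rule measurable_compose[OF matrix_mult_measurable]) measurable
  have g: "fourier ?g \<omega> = of_real \<bar>det h\<bar> * fourier f (transpose h *v \<omega>)" for \<omega>
    by (subst fourier_linear[OF h]) (simp_all add: matrix_vector_mul_assoc matrix_inv_mult[OF h])
  have "fourier (quasi_regular (x, h) f) \<omega> = of_real (\<bar>det h\<bar> powr (-1/2)) * fourier (\<lambda>y. ?g (y + - x)) \<omega>"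
    unfolding quasi_regular_def by (simp add: fourier_cmult)
  also have "\<dots> = of_real (\<bar>det h\<bar> powr (-1/2)) * (cis (\<omega> \<bullet> x) * (of_real \<bar>det h\<bar> * fourier f (transpose h *v \<omega>)))"
    by (subst fourier_shift) (simp_all add: g)
  also have "\<dots> = of_real (\<bar>det h\<bar> * \<bar>det h\<bar> powr (-1/2)) * cis (\<omega> \<bullet> x) * fourier f (transpose h *v \<omega>)"
    by simp
  finally show ?thesis by (simp only: dual_action_def prod.case powr_half_mult(1)[OF d])
qed

lemma quasi_regular_fourier:
  fixes h :: "'n::{finite,wellorder} sqmat"
  assumes h: "invertible h" and [measurable]: "\<psi> \<in> borel_measurable borel"
  shows "quasi_regular (x, h) (fourier \<psi>) = fourier (dual_action (- x, h) \<psi>)"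
proof
  fix y
  have d: "\<bar>det h\<bar> > 0" using h by (simp add: invertible_det_nz)
  have [measurable]: "(\<lambda>\<omega>. \<psi> (transpose h *v \<omega>)) \<in> borel_measurable borel"
    by (rule measurable_compose[OF matrix_mult_measurable]) measurable
  define B where "B = matrix_inv h"
  have B: "invertible (transpose B)" using h by (simp add: B_def invertible_matrix_inv invertible_transpose)
  have hB: "transpose h ** transpose B = mat 1"
    using matrix_inv_mult[OF h] by (simp add: B_def matrix_transpose_mul[symmetric] transpose_mat)
  have Bd: "\<bar>det B\<bar> = 1 / \<bar>det h\<bar>" using det_matrix_inv[OF h] by (simp add: B_def)
  have "fourier (\<lambda>\<omega>. \<psi> (transpose h *v \<omega>)) (y - x)
    = of_real \<bar>det (transpose B)\<bar> * fourier (\<lambda>\<omega>. \<psi> (transpose h *v (transpose B *v \<omega>))) (transpose (transpose B) *v (y - x))"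
    by (rule fourier_linear[OF B]) measurable
  also have "\<dots> = of_real (1 / \<bar>det h\<bar>) * fourier \<psi> (B *v (y - x))"
  proof -
    have "transpose h *v (transpose B *v \<omega>) = \<omega>" for \<omega>
      by (simp only: matrix_vector_mul_assoc hB matrix_vector_mul_lid)
    then show ?thesis by (simp only: transpose_transpose det_transpose Bd)
  qed
  finally have e: "fourier (\<lambda>\<omega>. \<psi> (transpose h *v \<omega>)) (y - x) = of_real (1 / \<bar>det h\<bar>) * fourier \<psi> (B *v (y - x))" .
  have "fourier (dual_action (- x, h) \<psi>) y = of_real (\<bar>det h\<bar> powr (1/2)) * fourier (\<lambda>\<omega>. cis (\<omega> \<bullet> (- x)) * \<psi> (transpose h *v \<omega>)) y"
    unfolding dual_action_def by (simp add: mult.assoc fourier_cmult)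
  also have "fourier (\<lambda>\<omega>. cis (\<omega> \<bullet> (- x)) * \<psi> (transpose h *v \<omega>)) y = fourier (\<lambda>\<omega>. \<psi> (transpose h *v \<omega>)) (y - x)"
  proof -
    have "cis ((y - x) \<bullet> \<omega>) = cis (\<omega> \<bullet> (- x)) * cis (y \<bullet> \<omega>)" for \<omega>
      by (simp add: cis_mult inner_diff_left inner_diff_right inner_commute)
    then show ?thesis unfolding fourier_def by (simp add: mult_ac)
  qed
  finally have "fourier (dual_action (- x, h) \<psi>) y = of_real (\<bar>det h\<bar> powr (1/2)) * (of_real (1 / \<bar>det h\<bar>) * fourier \<psi> (B *v (y - x)))"
    unfolding e .
  also have "\<dots> = of_real ((1 / \<bar>det h\<bar>) * \<bar>det h\<bar> powr (1/2)) * fourier \<psi> (B *v (y - x))" by simp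
  finally show "quasi_regular (x, h) (fourier \<psi>) y = fourier (dual_action (- x, h) \<psi>) y"
    unfolding powr_half_mult(2)[OF d] by (simp add: quasi_regular_def B_def)
qed

lemma dual_action_measurable [measurable]:
  assumes [measurable]: "F \<in> borel_measurable borel"
  shows "dual_action (x, h) F \<in> borel_measurable borel"
proof -
  have [measurable]: "(\<lambda>\<omega>. F (transpose h *v \<omega>)) \<in> borel_measurable borel"
    by (rule measurable_compose[OF matrix_mult_measurable]) measurable
  show ?thesis unfolding dual_action_def prod.case by measurable
qed

lemma dual_action_test_fun:
  fixes h :: "'n::{finite,wellorder} sqmat"
  assumes h: "invertible h" and f: "f \<in> test_fun"
  shows "dual_action (x, h) f \<in> test_fun"
  unfolding dual_action_def prod.case
  by (rule test_fun_bounded_mult[of _ _ "\<bar>det h\<bar> powr (1/2)"])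
     (use test_fun_affine[OF invertible_transpose[OF h] f, of 0] in \<open>auto simp: norm_mult\<close>)

lemma quasi_regular_test_fun:
  fixes h :: "'n::{finite,wellorder} sqmat"
  assumes h: "invertible h" and f: "f \<in> test_fun"
  shows "quasi_regular (x, h) f \<in> test_fun"
  unfolding quasi_regular_def prod.case
  by (rule test_fun_cmult)
     (use test_fun_affine[OF invertible_matrix_inv[OF h] f, of "- x"] in simp)

lemma
  fixes h :: "'n::{finite,wellorder} sqmat"
  assumes h: "invertible h" and f: "f \<in> L2 lborel"
  shows quasi_regular_L2: "quasi_regular (x, h) f \<in> L2 lborel"
    and sq_norm_quasi_regular: "sq_norm lborel (quasi_regular (x, h) f) = sq_norm lborel f"
    and dual_action_L2: "dual_action (x, h) f \<in> L2 lborel"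
    and sq_norm_dual_action: "sq_norm lborel (dual_action (x, h) f) = sq_norm lborel f"
proof -
  have [measurable]: "f \<in> borel_measurable borel" using L2_measurable[OF f] by simp
  define D where "D = \<bar>det h\<bar>"
  have d: "D > 0" using h by (simp add: D_def invertible_det_nz)
  note hi = invertible_matrix_inv[OF h] and ht = invertible_transpose[OF h]
  have m: "(\<lambda>y. (cmod (f y))\<^sup>2) \<in> borel_measurable borel" by measurable
  have m2: "(\<lambda>y. (cmod (f (matrix_inv h *v y)))\<^sup>2) \<in> borel_measurable borel"
    by (rule measurable_compose[OF matrix_mult_measurable m])
  have i1: "integrable lborel (\<lambda>y. (cmod (f (matrix_inv h *v y)))\<^sup>2)"
    unfolding integrable_linear_iff[OF hi m] using f by (rule L2_integrable_sq)
  have e1: "(cmod (quasi_regular (x, h) f y))\<^sup>2 = (D powr (- 1/2))\<^sup>2 * (cmod (f (matrix_inv h *v (y + - x))))\<^sup>2" for y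
    by (simp add: quasi_regular_def norm_mult power_mult_distrib D_def)
  have "integrable lborel (\<lambda>y. (cmod (quasi_regular (x, h) f y))\<^sup>2)"
    unfolding e1 by (rule integrable_mult_right) (rule integrable_shift[OF i1])
  then show "quasi_regular (x, h) f \<in> L2 lborel"
    using quasi_regular_measurable[of f x h] by (simp add: L2_def)
  have "sq_norm lborel (quasi_regular (x, h) f) = (D powr (- 1/2))\<^sup>2 * (LINT y|lborel. (cmod (f (matrix_inv h *v y)))\<^sup>2)"
    unfolding sq_norm_def e1 integral_mult_right_zero
    by (subst integral_shift[of "\<lambda>y. (cmod (f (matrix_inv h *v y)))\<^sup>2", OF m2]) simp
  also have "\<dots> = ((D powr (- 1/2))\<^sup>2 * D) * (\<bar>det (matrix_inv h)\<bar> *\<^sub>R (LINT y|lborel. (cmod (f (matrix_inv h *v y)))\<^sup>2))"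
    using d det_matrix_inv[OF h] by (simp add: D_def[symmetric])
  also have "\<bar>det (matrix_inv h)\<bar> *\<^sub>R (LINT y|lborel. (cmod (f (matrix_inv h *v y)))\<^sup>2) = sq_norm lborel f"
    unfolding sq_norm_def by (rule integral_linear[OF hi m, symmetric])
  finally show "sq_norm lborel (quasi_regular (x, h) f) = sq_norm lborel f"
    using powr_half_mult(3)[OF d] by simp
  have e2: "(cmod (dual_action (x, h) f y))\<^sup>2 = (D powr (1/2))\<^sup>2 * (cmod (f (transpose h *v y)))\<^sup>2" for y
    by (simp add: dual_action_def norm_mult power_mult_distrib D_def)
  have i2: "integrable lborel (\<lambda>y. (cmod (f (transpose h *v y)))\<^sup>2)"
    unfolding integrable_linear_iff[OF ht m] using f by (rule L2_integrable_sq)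
  then have "integrable lborel (\<lambda>y. (cmod (dual_action (x, h) f y))\<^sup>2)"
    unfolding e2 by (rule integrable_mult_right)
  then show "dual_action (x, h) f \<in> L2 lborel" by (simp add: L2_def)
  have "sq_norm lborel (dual_action (x, h) f) = (D powr (1/2))\<^sup>2 * (LINT y|lborel. (cmod (f (transpose h *v y)))\<^sup>2)"
    unfolding sq_norm_def e2 by (rule integral_mult_right_zero)
  also have "\<dots> = ((D powr (1/2))\<^sup>2 * (1 / D)) * (\<bar>det (transpose h)\<bar> *\<^sub>R (LINT y|lborel. (cmod (f (transpose h *v y)))\<^sup>2))"
    using d by (simp add: D_def[symmetric] det_transpose)
  also have "\<bar>det (transpose h)\<bar> *\<^sub>R (LINT y|lborel. (cmod (f (transpose h *v y)))\<^sup>2) = sq_norm lborel f"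
    unfolding sq_norm_def by (rule integral_linear[OF ht m, symmetric])
  finally show "sq_norm lborel (dual_action (x, h) f) = sq_norm lborel f"
    using powr_half_mult(4)[OF d] by simp
qed

lemma quasi_regular_diff:
  "quasi_regular p (\<lambda>y. f y - g y) = (\<lambda>y. quasi_regular p f y - quasi_regular p g y)"
  by (cases p) (auto simp: quasi_regular_def right_diff_distrib)

lemma dual_action_diff:
  "dual_action p (\<lambda>y. f y - g y) = (\<lambda>y. dual_action p f y - dual_action p g y)"
  by (cases p) (auto simp: dual_action_def right_diff_distrib)

text \<open>Both actions are isometric and intertwined on test functions, so the intertwining relation passes to the closure.\<close>

theorem fourier_pair_quasi_regular:
  fixes h :: "'n::{finite,wellorder} sqmat"
  assumes h: "invertible h" and p: "fourier_pair f F"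
  shows "fourier_pair (quasi_regular (x, h) f) (dual_action (x, h) F)"
proof -
  obtain u where u: "\<And>n. u n \<in> test_fun" "(\<lambda>n. L2_dist lborel (u n) f) \<longlonglongrightarrow> 0"
      "(\<lambda>n. L2_dist lborel (fourier (u n)) F) \<longlonglongrightarrow> 0"
    using p unfolding fourier_pair_def by blast
  have L: "f \<in> L2 lborel" "F \<in> L2 lborel" using p by (auto simp: fourier_pair_def)
  have "L2_dist lborel (quasi_regular (x, h) (u n)) (quasi_regular (x, h) f) = L2_dist lborel (u n) f" for n
    unfolding L2_dist_eq_sqrt
    by (subst quasi_regular_diff[symmetric], subst sq_norm_quasi_regular[OF h L2_diff[OF test_fun_L2[OF u(1)] L(1)]]) simp
  moreover have "fourier (quasi_regular (x, h) (u n)) = dual_action (x, h) (fourier (u n))" for n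
    using fourier_quasi_regular[OF h test_fun_measurable[OF u(1)]] by blast
  moreover have "L2_dist lborel (dual_action (x, h) (fourier (u n))) (dual_action (x, h) F) = L2_dist lborel (fourier (u n)) F" for n
    unfolding L2_dist_eq_sqrt
    by (subst dual_action_diff[symmetric], subst sq_norm_dual_action[OF h L2_diff[OF fourier_test_fun_L2[OF u(1)] L(2)]]) simp
  ultimately show ?thesis
    unfolding fourier_pair_def using L u h
    by (intro conjI quasi_regular_L2 dual_action_L2 exI[of _ "\<lambda>n. quasi_regular (x, h) (u n)"])
       (auto intro: quasi_regular_test_fun)
qed

section \<open>The algebra generated by a shearing subgroup\<close>

lemma first_ix_le [simp]: "first_ix \<le> (i::'n::{finite,wellorder})"
  by (simp add: first_ix_def)

lemma first_ix_less_iff: "first_ix < (i::'n::{finite,wellorder}) \<longleftrightarrow> i \<noteq> first_ix"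
  using first_ix_le[of i] by (auto simp: order.strict_iff_order)

lemma matrix_add_rdistrib: "(A + B) ** C = A ** C + B ** C" for A B C :: "'n::finite sqmat"
  by (simp add: vec_eq_iff matrix_matrix_mult_def sum.distrib distrib_right)

lemma matrix_sub_rdistrib: "(A - B) ** C = A ** C - B ** C" for A B C :: "'n::finite sqmat"
  by (simp add: vec_eq_iff matrix_matrix_mult_def sum_subtractf left_diff_distrib)

lemma matrix_sub_ldistrib: "C ** (A - B) = C ** A - C ** B" for A B C :: "'n::finite sqmat"
  by (simp add: vec_eq_iff matrix_matrix_mult_def sum_subtractf right_diff_distrib)

lemma row_mult: "(A ** B) $ i = A $ i v* B"
  by (simp add: vec_eq_iff matrix_matrix_mult_def vector_matrix_mult_def mult.commute)

text \<open>A matrix of level \<open>p\<close> vanishes strictly below the \<open>p\<close>-th superdiagonal. Positions are counted by a rank, since the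
  index type is merely well-ordered.\<close>

definition ix_rank :: "'n::{finite,wellorder} \<Rightarrow> nat" where
  "ix_rank i = card {..<i}"

definition level :: "nat \<Rightarrow> 'n::{finite,wellorder} sqmat \<Rightarrow> bool" where
  "level p A \<longleftrightarrow> (\<forall>i j. A $ i $ j \<noteq> 0 \<longrightarrow> ix_rank i + p \<le> ix_rank j)"

lemma ix_rank_mono: "i < j \<Longrightarrow> ix_rank i < ix_rank j"
  unfolding ix_rank_def by (rule psubset_card_mono) auto

lemma ix_rank_less_iff: "ix_rank i < ix_rank j \<longleftrightarrow> i < j"
  by (metis ix_rank_mono less_asym' less_irrefl_nat linorder_neqE)

lemma ix_rank_le_iff: "ix_rank i \<le> ix_rank j \<longleftrightarrow> i \<le> j"
  using ix_rank_less_iff[of j i] by (auto simp: not_less[symmetric])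

lemma ix_rank_bound: "ix_rank (i::'n::{finite,wellorder}) < CARD('n)"
  unfolding ix_rank_def by (rule psubset_card_mono) auto

lemma level_0_iff: "level 0 A \<longleftrightarrow> (\<forall>i j. j < i \<longrightarrow> A $ i $ j = 0)"
  unfolding level_def add_0_right ix_rank_le_iff by (metis not_less)

lemma level_1_iff: "level (Suc 0) A \<longleftrightarrow> (\<forall>i j. j \<le> i \<longrightarrow> A $ i $ j = 0)"
  unfolding level_def add_Suc_right add_0_right Suc_le_eq ix_rank_less_iff by (metis not_le)

lemma level_mono: "level p A \<Longrightarrow> q \<le> p \<Longrightarrow> level q A"
  unfolding level_def by (meson add_left_mono order_trans)

lemma level_1_diagonal: "level (Suc 0) A \<Longrightarrow> A $ i $ i = 0"
  by (simp add: level_1_iff)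

lemma level_top: "level CARD('n) A \<Longrightarrow> A = 0" for A :: "'n::{finite,wellorder} sqmat"
proof -
  assume l: "level CARD('n) A"
  have "A $ i $ j = 0" for i j
    using l ix_rank_bound[of j] unfolding level_def by (meson add_leD2 not_le)
  then show "A = 0" by (simp add: vec_eq_iff)
qed

lemma level_mult:
  assumes "level p A" "level q B" shows "level (p + q) (A ** B)"
  unfolding level_def
proof (intro allI impI)
  fix i j assume "(A ** B) $ i $ j \<noteq> 0"
  then obtain k where "A $ i $ k * B $ k $ j \<noteq> 0"
    unfolding matrix_matrix_mult_def by (auto elim: sum.not_neutral_contains_not_neutral)
  then have "ix_rank i + p \<le> ix_rank k" "ix_rank k + q \<le> ix_rank j" using assms by (auto simp: level_def)
  then show "ix_rank i + (p + q) \<le> ix_rank j" by simp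
qed

lemma level_add: "level p A \<Longrightarrow> level p B \<Longrightarrow> level p (A + B)"
  unfolding level_def by (auto) (metis add.right_neutral)

lemma level_scaleR: "level p A \<Longrightarrow> level p (c *\<^sub>R A)"
  unfolding level_def by auto

lemma level_uminus: "level p A \<Longrightarrow> level p (- A)"
  unfolding level_def by auto

lemma level_one: "level 0 (mat 1)"
  by (auto simp: level_0_iff mat_def)

lemma level_power: "level p A \<Longrightarrow> level (p * k) (mat_power A k)"
  by (induction k) (auto simp: level_one intro: level_mult)

text \<open>The powers \<open>A\<^sup>k\<close> with \<open>k \<ge> 2\<close> in the exponential series have level at least \<open>2 p\<close>.\<close>

lemma level_exp_remainder:
  assumes "level p A"
  shows "level (2 * p) (mat_exp A - mat 1 - A)"
  unfolding level_def
proof (intro allI impI, rule ccontr)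
  fix i j assume ne: "(mat_exp A - mat 1 - A) $ i $ j \<noteq> 0" and lt: "\<not> ix_rank i + 2 * p \<le> ix_rank j"
  have z: "mat_power A k $ i $ j = 0" if "k \<ge> 2" for k
  proof (rule ccontr)
    assume "mat_power A k $ i $ j \<noteq> 0"
    then have "ix_rank i + p * k \<le> ix_rank j" using level_power[OF assms, of k] by (simp add: level_def)
    moreover have "p * 2 \<le> p * k" using that by (intro mult_left_mono) auto
    ultimately show False using lt by simp
  qed
  have "mat_exp A $ i $ j = (\<Sum>k<2. mat_power A k $ i $ j / fact k)"
    unfolding mat_exp_entry by (rule suminf_finite) (auto simp: z not_less)
  also have "\<dots> = mat 1 $ i $ j + A $ i $ j" by (simp add: numeral_2_eq_2)
  finally show False using ne by simp
qed

lemma upper_triangular_invertible_iff: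
  assumes "level 0 A" shows "invertible A \<longleftrightarrow> (\<forall>i. A $ i $ i \<noteq> 0)"
  using assms by (simp add: invertible_det_nz det_upperdiagonal level_0_iff)

text \<open>The properties of a shearing subgroup that do not mention the ambient dilation group.\<close>

locale shearing =
  fixes S :: "'n::{finite,wellorder} sqmat set" and X :: "'n \<Rightarrow> 'n sqmat"
  assumes S_closed: "closed_subgroup S"
    and S_unitriangular: "S \<subseteq> unitriangular"
    and S_abelian: "a \<in> S \<Longrightarrow> b \<in> S \<Longrightarrow> a ** b = b ** a"
    and S_connected: "connected S"
    and canonical: "canonical_basis (lie_algebra S) X"
begin

lemma S_subgroup: "subgroup S GL"
  using S_closed by (simp add: closed_subgroup_def)

lemma lie_algebra_strict:
  assumes A: "A \<in> lie_algebra S" shows "level (Suc 0) A"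
  unfolding level_1_iff
proof (intro allI impI)
  fix i j :: 'n assume "j \<le> i"
  have "mat_exp (t *\<^sub>R A) $ i $ j = (if i = j then 1 else 0)" for t
  proof -
    have "mat_exp (t *\<^sub>R A) \<in> unitriangular" using A S_unitriangular by (auto simp: lie_algebra_def)
    then show ?thesis using \<open>j \<le> i\<close> unfolding unitriangular_def by (cases "i = j") auto
  qed
  then have "((\<lambda>t. if i = j then 1 else 0) has_real_derivative A $ i $ j) (at 0)"
    using DERIV_mat_exp_entry_0[of A i j] by simp
  then show "A $ i $ j = 0" using DERIV_unique DERIV_const by blast
qed

lemma lie_algebra_commute_group:
  assumes "A \<in> lie_algebra S" "b \<in> S" shows "A ** b = b ** A"
  by (rule commute_of_mat_exp_commute) (use assms S_abelian in \<open>auto simp: lie_algebra_def\<close>)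

lemma lie_algebra_commute:
  assumes "A \<in> lie_algebra S" "B \<in> lie_algebra S" shows "A ** B = B ** A"
proof (rule commute_of_mat_exp_commute)
  fix t show "mat_exp (t *\<^sub>R A) ** B = B ** mat_exp (t *\<^sub>R A)"
    using lie_algebra_commute_group[OF assms(2), of "mat_exp (t *\<^sub>R A)"] assms(1) by (simp add: lie_algebra_def)
qed

lemma span_X: "span (X ` {first_ix<..}) = lie_algebra S"
  using canonical by (simp add: canonical_basis_def)

lemma X_lie: "i \<noteq> first_ix \<Longrightarrow> X i \<in> lie_algebra S"
  unfolding span_X[symmetric] by (rule span_base) (simp add: first_ix_less_iff)

lemma X_row: "i \<noteq> first_ix \<Longrightarrow> X i $ first_ix = axis i 1"
proof -
  assume "i \<noteq> first_ix"
  then have "transpose (X i) *v axis first_ix 1 = axis i 1"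
    using canonical by (simp add: canonical_basis_def first_ix_less_iff)
  then show ?thesis
    by (simp add: matrix_vector_mult_basis column_def transpose_def vec_lambda_eta)
qed

text \<open>The element of \<open>\<real> 1 + \<ss>\<close> with first row \<open>x\<close>.\<close>

definition L :: "(real, 'n) vec \<Rightarrow> 'n sqmat" where
  "L x = x $ first_ix *\<^sub>R mat 1 + (\<Sum>i\<in>{first_ix<..}. x $ i *\<^sub>R X i)"

lemma L_row [simp]: "L x $ first_ix = x"
proof -
  have "L x $ first_ix $ j = x $ j" for j
  proof -
    have "L x $ first_ix $ j = x $ first_ix * (if first_ix = j then 1 else 0) + (\<Sum>i\<in>{first_ix<..}. x $ i * (X i $ first_ix $ j))"
      by (simp add: L_def mat_def)
    also have "(\<Sum>i\<in>{first_ix<..}. x $ i * (X i $ first_ix $ j)) = (\<Sum>i\<in>{first_ix<..}. x $ i * (if i = j then 1 else 0))"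
      by (rule sum.cong) (auto simp: X_row first_ix_less_iff axis_def)
    also have "\<dots> = (if first_ix < j then x $ j else 0)" by (simp add: mult_delta_right)
    finally show ?thesis by (auto simp: first_ix_less_iff)
  qed
  then show ?thesis by (simp add: vec_eq_iff)
qed

lemma linear_L: "linear L"
  unfolding L_def
  by (rule linearI) (simp_all add: scaleR_add_left sum.distrib scaleR_add_right scaleR_sum_right algebra_simps)

lemma L_lie_iff: "L x \<in> lie_algebra S \<longleftrightarrow> x $ first_ix = 0"
proof
  assume "L x \<in> lie_algebra S"
  then have "L x $ first_ix $ first_ix = 0" by (intro level_1_diagonal lie_algebra_strict)
  then show "x $ first_ix = 0" by simp
next
  assume "x $ first_ix = 0"
  then have "L x = (\<Sum>i\<in>{first_ix<..}. x $ i *\<^sub>R X i)" by (simp add: L_def)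
  also have "\<dots> \<in> span (X ` {first_ix<..})" by (intro span_sum span_scale span_base) auto
  finally show "L x \<in> lie_algebra S" by (simp add: span_X)
qed

lemma L_commute_X: "i \<noteq> first_ix \<Longrightarrow> L x ** X i = X i ** L x"
proof -
  assume i: "i \<noteq> first_ix"
  have "(L x ** X i) $ a $ b = (X i ** L x) $ a $ b" for a b
  proof -
    have c: "(X k ** X i) $ a $ b = (X i ** X k) $ a $ b" if "k \<in> {first_ix<..}" for k
      using lie_algebra_commute[OF X_lie X_lie[OF i], of k] that by (auto simp: first_ix_less_iff)
    have l: "L x ** X i = x $ first_ix *\<^sub>R X i + (\<Sum>k\<in>{first_ix<..}. x $ k *\<^sub>R (X k ** X i))"
      unfolding L_def
      by (simp add: matrix_add_rdistrib scalar_matrix_assoc[symmetric] linear_sum[of "\<lambda>A. A ** X i"] linearI)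
    have r: "X i ** L x = x $ first_ix *\<^sub>R X i + (\<Sum>k\<in>{first_ix<..}. x $ k *\<^sub>R (X i ** X k))"
      unfolding L_def
      by (simp add: matrix_add_ldistrib matrix_scalar_ac linear_sum[of "\<lambda>A. X i ** A"] linearI scalar_matrix_assoc[symmetric])
    show ?thesis unfolding l r by (simp add: c)
  qed
  then show ?thesis by (simp add: vec_eq_iff)
qed

text \<open>The row vector of the first coordinate is cyclic for the commutative algebra generated by \<open>\<ss>\<close>, so this
  algebra, spanned by the identity and \<open>\<ss>\<close>, is its own commutant.\<close>

lemma commutant_eq_L:
  assumes Z: "\<And>i. i \<noteq> first_ix \<Longrightarrow> Z ** X i = X i ** Z"
  shows "Z = L (Z $ first_ix)"
proof -
  define W where "W = Z - L (Z $ first_ix)"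
  have W0: "W $ first_ix = 0" by (simp add: W_def)
  have comm: "W ** X k = X k ** W" if "k \<noteq> first_ix" for k
    unfolding W_def using Z[OF that] L_commute_X[OF that, of "Z $ first_ix"]
    by (simp add: matrix_sub_ldistrib matrix_sub_rdistrib)
  have "W $ k = 0" for k
  proof (cases "k = first_ix")
    case False
    have "W $ k = (X k ** W) $ first_ix"
      unfolding row_mult X_row[OF False] by (simp add: vec_eq_iff vector_matrix_mult_def axis_def mult_delta_left)
    also have "\<dots> = (W ** X k) $ first_ix" by (simp add: comm[OF False])
    also have "\<dots> = 0" by (simp add: row_mult W0 vec_eq_iff vector_matrix_mult_def)
    finally show ?thesis .
  qed (use W0 in simp)
  then have "W = 0" by (simp add: vec_eq_iff)
  then show ?thesis by (simp add: W_def)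
qed

lemma L_mult: "L x ** L y = L (x v* L y)"
proof -
  have "L x ** L y ** X i = X i ** (L x ** L y)" if "i \<noteq> first_ix" for i
    using L_commute_X[OF that] by (metis matrix_mul_assoc)
  from commutant_eq_L[OF this] show ?thesis by (simp add: row_mult)
qed

lemma level_L_iff: "level (Suc 0) (L x) \<longleftrightarrow> x $ first_ix = 0"
proof
  assume "level (Suc 0) (L x)"
  then have "L x $ first_ix $ first_ix = 0" by (rule level_1_diagonal)
  then show "x $ first_ix = 0" by simp
next
  assume "x $ first_ix = 0"
  then show "level (Suc 0) (L x)" using L_lie_iff lie_algebra_strict by blast
qed

lemma L_decomp: "L x = x $ first_ix *\<^sub>R mat 1 + L (x - x $ first_ix *\<^sub>R axis first_ix 1)"
proof -
  have "(\<Sum>i\<in>{first_ix<..}. (x - x $ first_ix *\<^sub>R axis first_ix 1) $ i *\<^sub>R X i) = (\<Sum>i\<in>{first_ix<..}. x $ i *\<^sub>R X i)"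
    by (rule sum.cong) (auto simp: axis_def)
  then show ?thesis by (simp add: L_def)
qed

lemma L_one: "L (axis first_ix 1) = mat 1"
  by (simp add: commutant_eq_L[of "mat 1", symmetric] L_def) (rule sum.neutral, auto simp: axis_def)

lemma L_level_0: "level 0 (L x)"
  by (subst L_decomp, intro level_add level_scaleR level_one)
     (rule level_mono[of "Suc 0"], simp_all only: level_L_iff, simp_all)

lemma L_diagonal: "L x $ i $ i = x $ first_ix"
proof -
  have "level (Suc 0) (L (x - x $ first_ix *\<^sub>R axis first_ix 1))" by (simp add: level_L_iff)
  then show ?thesis by (subst L_decomp) (simp add: level_1_iff mat_def)
qed

text \<open>Descending induction along the filtration by levels: modulo higher levels, \<open>1 + N\<close> agrees with
  the group element \<open>exp N\<close>.\<close>

lemma unipotent_L_in_S: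
  assumes "level p (L x)" "p \<ge> 1"
  shows "mat 1 + L x \<in> S"
  using assms
proof (induction "CARD('n) - p" arbitrary: p x rule: less_induct)
  case less
  show ?case
  proof (cases "p \<ge> CARD('n)")
    case True
    then have "L x = 0" using less.prems(1) level_mono level_top by blast
    then show ?thesis using S_subgroup by (simp add: subgroup_GL_iff)
  next
    case False
    define N where "N = L x"
    have N1: "level (Suc 0) N" using less.prems level_mono by (auto simp: N_def)
    then have Nlie: "N \<in> lie_algebra S" by (simp add: N_def level_L_iff L_lie_iff)
    have eS: "mat_exp N \<in> S" using Nlie by (auto simp: lie_algebra_def dest: spec[of _ 1])
    define g where "g = matrix_inv (mat_exp N)"
    have inv: "invertible (mat_exp N)" and gS: "g \<in> S"
      using eS S_subgroup by (auto simp: subgroup_GL_iff g_def)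
    \<comment> \<open>The quotient \<open>M\<close> of \<open>1 + N\<close> by \<open>exp N\<close> is \<open>1 - g R\<close>, and \<open>R\<close> has at least twice the level of \<open>N\<close>.\<close>
    define R where "R = mat_exp N - mat 1 - N"
    have R: "level (2 * p) R" unfolding R_def by (rule level_exp_remainder) (use less.prems in \<open>simp add: N_def\<close>)
    define M where "M = g ** (mat 1 + N)"
    have "mat 1 + N = mat_exp N - R" by (simp add: R_def)
    then have M1: "M - mat 1 = - (g ** R)"
      unfolding M_def by (simp add: matrix_sub_ldistrib g_def matrix_inv_mult[OF inv])
    have "level 0 g" using gS S_unitriangular by (auto simp: level_0_iff unitriangular_def)
    then have "level (0 + 2 * p) (g ** R)" using R by (rule level_mult)
    then have Ml: "level (p + 1) (M - mat 1)"
      unfolding M1 by (intro level_uminus) (rule level_mono, use less.prems in auto)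
    have "(M - mat 1) ** X i = X i ** (M - mat 1)" if "i \<noteq> first_ix" for i
    proof -
      have "g ** X i = X i ** g" using lie_algebra_commute_group[OF X_lie[OF that] gS] by simp
      moreover have "(mat 1 + N) ** X i = X i ** (mat 1 + N)"
        using L_commute_X[OF that, of x] by (simp add: N_def matrix_add_ldistrib matrix_add_rdistrib)
      ultimately have "M ** X i = X i ** M" unfolding M_def by (metis matrix_mul_assoc)
      then show ?thesis by (simp add: matrix_sub_ldistrib matrix_sub_rdistrib)
    qed
    from commutant_eq_L[OF this] obtain y where y: "M - mat 1 = L y" by blast
    have "mat 1 + L y \<in> S"
      by (rule less.hyps[of "p + 1"]) (use False Ml y in auto)
    then have "M \<in> S" by (simp add: y[symmetric])
    then have "mat_exp N ** M \<in> S" using eS S_subgroup by (simp add: subgroup_GL_iff)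
    moreover have "mat_exp N ** M = mat 1 + N"
      by (simp add: M_def matrix_mul_assoc g_def matrix_inv_mult[OF inv])
    ultimately show ?thesis by (simp add: N_def)
  qed
qed

text \<open>One inclusion is the preceding lemma. For the other, elements of the abelian group \<open>S\<close> commute with \<open>\<ss>\<close>, so they lie in its
  commutant \<open>\<real> 1 + \<ss>\<close>.\<close>

theorem S_eq: "S = {L x | x. x $ first_ix = 1}"
proof (rule equalityI; rule subsetI)
  fix s assume s: "s \<in> S"
  have "s = L (s $ first_ix)"
    by (rule commutant_eq_L) (use lie_algebra_commute_group[OF X_lie s] in simp)
  moreover have "s $ first_ix $ first_ix = 1" using s S_unitriangular by (auto simp: unitriangular_def)
  ultimately show "s \<in> {L x | x. x $ first_ix = 1}" by blast
next
  fix s assume "s \<in> {L x | x. x $ first_ix = 1}"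
  then obtain x where x: "s = L x" "x $ first_ix = 1" by blast
  have "mat 1 + L (x - x $ first_ix *\<^sub>R axis first_ix 1) \<in> S"
    by (rule unipotent_L_in_S[of "Suc 0"]) (simp_all add: level_L_iff)
  then show "s \<in> S" using L_decomp[of x] x by simp
qed

lemma lie_algebra_eq: "lie_algebra S = {L x | x. x $ first_ix = 0}"
proof (rule equalityI; rule subsetI)
  fix A assume A: "A \<in> lie_algebra S"
  have "A = L (A $ first_ix)" by (rule commutant_eq_L) (use lie_algebra_commute[OF X_lie A] in simp)
  moreover have "A $ first_ix $ first_ix = 0" using lie_algebra_strict[OF A] by (rule level_1_diagonal)
  ultimately show "A \<in> {L x | x. x $ first_ix = 0}" by blast
qed (auto simp: L_lie_iff)

lemma lie_algebra_eqI_row: "A \<in> lie_algebra S \<Longrightarrow> B \<in> lie_algebra S \<Longrightarrow> A $ first_ix = B $ first_ix \<Longrightarrow> A = B"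
  by (auto simp: lie_algebra_eq)

lemma X_eq_L: "i \<noteq> first_ix \<Longrightarrow> X i = L (axis i 1)"
  by (rule lie_algebra_eqI_row[OF X_lie]) (auto simp: L_lie_iff X_row axis_def)

subsection \<open>The linear system for the scaling exponents\<close>

lemma X_expansion:
  assumes i: "i \<noteq> first_ix"
  shows "X i = unit_mat first_ix i + (\<Sum>j\<in>{first_ix<..}. \<Sum>k\<in>{j<..}. X i $ j $ k *\<^sub>R unit_mat j k)"
proof -
  have "(unit_mat first_ix i + (\<Sum>j\<in>{first_ix<..}. \<Sum>k\<in>{j<..}. X i $ j $ k *\<^sub>R unit_mat j k)) $ a $ b = X i $ a $ b" for a b
  proof -
    have e: "(\<Sum>k\<in>{j<..}. X i $ j $ k * (if a = j \<and> b = k then 1 else 0)) = (if a = j then (if j < b then X i $ j $ b else 0) else 0)" for j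
      by (auto simp: mult_delta_right)
    have "(\<Sum>j\<in>{first_ix<..}. \<Sum>k\<in>{j<..}. X i $ j $ k *\<^sub>R unit_mat j k) $ a $ b
       = (if first_ix < a then (if a < b then X i $ a $ b else 0) else 0)"
      by (simp add: unit_mat_def e)
    moreover have "a < b \<or> X i $ a $ b = 0" using lie_algebra_strict[OF X_lie[OF i]] unfolding level_1_iff by (meson not_le)
    ultimately show ?thesis
      using X_row[OF i] by (auto simp: unit_mat_def first_ix_less_iff axis_def)
  qed
  then show ?thesis by (simp add: vec_eq_iff)
qed

text \<open>Entrywise form of the eigenvector equations \<open>[Y, X\<^sub>i] = (1 - v\<^sub>i) X\<^sub>i\<close> for the diagonal matrix \<open>Y\<close> with entries \<open>v\<close>.\<close>

definition adapted :: "('n \<Rightarrow> real) \<Rightarrow> bool" where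
  "adapted v \<longleftrightarrow> v first_ix = 1 \<and> (\<forall>i j k. i \<noteq> first_ix \<longrightarrow> X i $ j $ k \<noteq> 0 \<longrightarrow> v j - v k = 1 - v i)"

text \<open>The entries with \<open>j = 1\<close> contribute only the trivial equation for \<open>k = i\<close>.\<close>

lemma adapted_iff_solution:
  assumes c: "\<And>i j k. c i j k = X i $ j $ k"
  shows "adapted (\<lambda>i. if i = first_ix then 1 else l i) \<longleftrightarrow> (\<exists>\<mu>\<in>solutions c. \<forall>i>first_ix. l i = 1 + \<mu> i)"
proof
  assume ad: "adapted (\<lambda>i. if i = first_ix then 1 else l i)"
  show "\<exists>\<mu>\<in>solutions c. \<forall>i>first_ix. l i = 1 + \<mu> i"
  proof (rule bexI[of _ "restrict (\<lambda>i. l i - 1) {first_ix<..}"])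
    show "restrict (\<lambda>i. l i - 1) {first_ix<..} \<in> solutions c"
      unfolding solutions_def
    proof (intro CollectI conjI allI impI)
      fix i j k assume h: "first_ix < i" "first_ix < j" "first_ix < k" "c i j k \<noteq> 0"
      then have "X i $ j $ k \<noteq> 0" "i \<noteq> first_ix" "j \<noteq> first_ix" "k \<noteq> first_ix" using c by auto
      then have "(if j = first_ix then 1 else l j) - (if k = first_ix then 1 else l k) = 1 - (if i = first_ix then 1 else l i)"
        using ad unfolding adapted_def by blast
      then have "l j - l k = 1 - l i" using h by (simp add: first_ix_less_iff)
      then show "restrict (\<lambda>i. l i - 1) {first_ix<..} i + restrict (\<lambda>i. l i - 1) {first_ix<..} j = restrict (\<lambda>i. l i - 1) {first_ix<..} k"
        using h by simp
    qed auto
  qed auto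
next
  assume "\<exists>\<mu>\<in>solutions c. \<forall>i>first_ix. l i = 1 + \<mu> i"
  then obtain \<mu> where \<mu>: "\<mu> \<in> solutions c" "\<And>i. i \<noteq> first_ix \<Longrightarrow> l i = 1 + \<mu> i" by (auto simp: first_ix_less_iff)
  show "adapted (\<lambda>i. if i = first_ix then 1 else l i)"
    unfolding adapted_def
  proof (intro conjI allI impI)
    fix i j k assume i: "i \<noteq> first_ix" and nz: "X i $ j $ k \<noteq> 0"
    have jk: "j < k" using lie_algebra_strict[OF X_lie[OF i]] nz unfolding level_1_iff by (meson not_le)
    then have k: "k \<noteq> first_ix" using first_ix_le[of j] by (metis not_le)
    show "(if j = first_ix then 1 else l j) - (if k = first_ix then 1 else l k) = 1 - (if i = first_ix then 1 else l i)"
    proof (cases "j = first_ix")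
      case True
      then have "k = i" using nz X_row[OF i] by (auto simp: axis_def split: if_splits)
      then show ?thesis using True k by simp
    next
      case False
      have "\<mu> i + \<mu> j = \<mu> k" using \<mu>(1) i k False nz c by (auto simp: solutions_def first_ix_less_iff)
      then show ?thesis using False i k by (simp add: \<mu>(2))
    qed
  qed simp
qed

lemma commutator_diag_entry: "commutator (diag_mat v) A $ j $ k = (v j - v k) * A $ j $ k"
  by (simp add: commutator_def diag_mat_mult_left diag_mat_mult_right algebra_simps)

text \<open>The first row of \<open>[Y, X\<^sub>i]\<close> is \<open>(1 - v\<^sub>i) e\<^sub>i\<close>, and first rows separate the elements of \<open>\<ss>\<close>.\<close>

lemma commutator_invariant_iff:
  assumes v1: "v first_ix = 1"
  shows "(\<forall>A\<in>lie_algebra S. commutator (diag_mat v) A \<in> lie_algebra S) \<longleftrightarrow> adapted v"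
proof
  assume inv: "\<forall>A\<in>lie_algebra S. commutator (diag_mat v) A \<in> lie_algebra S"
  show "adapted v"
    unfolding adapted_def
  proof (intro conjI allI impI v1)
    fix i j k assume i: "i \<noteq> first_ix" and nz: "X i $ j $ k \<noteq> 0"
    have "(1 - v i) *\<^sub>R X i \<in> lie_algebra S"
      unfolding span_X[symmetric] by (intro span_scale) (simp add: span_X X_lie[OF i])
    then have "commutator (diag_mat v) (X i) = (1 - v i) *\<^sub>R X i"
    proof (rule lie_algebra_eqI_row[OF inv[rule_format, OF X_lie[OF i]]])
      show "commutator (diag_mat v) (X i) $ first_ix = ((1 - v i) *\<^sub>R X i) $ first_ix"
        using v1 by (simp add: vec_eq_iff commutator_diag_entry X_row[OF i] axis_def)
    qed
    then have "commutator (diag_mat v) (X i) $ j $ k = ((1 - v i) *\<^sub>R X i) $ j $ k" by simp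
    then show "v j - v k = 1 - v i" using nz by (simp add: commutator_diag_entry)
  qed
next
  assume ad: "adapted v"
  show "\<forall>A\<in>lie_algebra S. commutator (diag_mat v) A \<in> lie_algebra S"
  proof
    fix A assume "A \<in> lie_algebra S"
    then obtain x where x: "A = L x" "x $ first_ix = 0" by (auto simp: lie_algebra_eq)
    have "commutator (diag_mat v) A = (\<Sum>i\<in>{first_ix<..}. ((1 - v i) * x $ i) *\<^sub>R X i)"
    proof -
      have "commutator (diag_mat v) A $ j $ k = (\<Sum>i\<in>{first_ix<..}. ((1 - v i) * x $ i) *\<^sub>R X i) $ j $ k" for j k
      proof -
        have "(v j - v k) * (\<Sum>i\<in>{first_ix<..}. x $ i * X i $ j $ k) = (\<Sum>i\<in>{first_ix<..}. (1 - v i) * x $ i * X i $ j $ k)"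
          unfolding sum_distrib_left
        proof (rule sum.cong)
          fix i :: 'n assume "i \<in> {first_ix<..}"
          then show "(v j - v k) * (x $ i * X i $ j $ k) = (1 - v i) * x $ i * X i $ j $ k"
            using ad by (cases "X i $ j $ k = 0") (auto simp: adapted_def first_ix_less_iff)
        qed simp
        then show ?thesis using x(2) by (simp add: commutator_diag_entry x(1) L_def)
      qed
      then show ?thesis by (simp add: vec_eq_iff)
    qed
    also have "\<dots> \<in> span (X ` {first_ix<..})" by (intro span_sum span_scale span_base) auto
    finally show "commutator (diag_mat v) A \<in> lie_algebra S" by (simp add: span_X)
  qed
qed

end

lemma shearing_subgroup_shearing:
  assumes "shearing_subgroup S" "canonical_basis (lie_algebra S) X"
  shows "shearing S X"
  using assms unfolding shearing_subgroup_def shearlet_decomposition_def shearing_def by blast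

section \<open>Topology of matrices\<close>

lemma continuous_on_matrix_mult [continuous_intros]:
  fixes f g :: "'a::topological_space \<Rightarrow> 'n::finite sqmat"
  assumes "continuous_on U f" "continuous_on U g"
  shows "continuous_on U (\<lambda>x. f x ** g x)"
  unfolding matrix_matrix_mult_def using assms by (intro continuous_intros)

lemma continuous_on_vector_matrix_mult [continuous_intros]:
  fixes f :: "'a::topological_space \<Rightarrow> real^'n" and g :: "'a \<Rightarrow> 'n::finite sqmat"
  assumes "continuous_on U f" "continuous_on U g"
  shows "continuous_on U (\<lambda>x. f x v* g x)"
  unfolding vector_matrix_mult_def using assms by (intro continuous_intros)

lemma continuous_on_matrix_vector_mult [continuous_intros]:
  fixes f :: "'a::topological_space \<Rightarrow> real^'n" and g :: "'a \<Rightarrow> 'n::finite sqmat"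
  assumes "continuous_on U f" "continuous_on U g"
  shows "continuous_on U (\<lambda>x. g x *v f x)"
  unfolding matrix_vector_mult_def using assms by (intro continuous_intros)

lemma entry_norm_triangle: "entry_norm (A + B) \<le> entry_norm A + entry_norm B"
  unfolding entry_norm_def sum.distrib[symmetric] by (intro sum_mono) simp

text \<open>With \<open>B = A\<^sup>-\<^sup>1\<close> and \<open>B\<^sub>n = A\<^sub>n\<^sup>-\<^sup>1\<close>, the identity \<open>B\<^sub>n - B = B\<^sub>n (A - A\<^sub>n) B\<close> first bounds \<open>B\<^sub>n\<close> by \<open>2 \<parallel>B\<parallel>\<close> for
  large \<open>n\<close> and then gives convergence.\<close>

lemma continuous_on_matrix_inv:
  "continuous_on {A :: 'n::finite sqmat. invertible A} matrix_inv"
  unfolding continuous_on_sequentially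
proof (intro ballI allI impI, elim conjE)
  fix u :: "nat \<Rightarrow> 'n sqmat" and A
  assume A: "A \<in> {A. invertible A}" and u: "\<forall>n. u n \<in> {A. invertible A}" and lim: "u \<longlonglongrightarrow> A"
  define B where "B = matrix_inv A"
  define b where "b = entry_norm B"
  define d where "d n = entry_norm (A - u n)" for n
  have d: "d \<longlonglongrightarrow> 0"
  proof -
    have "(\<lambda>n. entry_norm (A - u n)) \<longlonglongrightarrow> entry_norm (A - A)"
      unfolding entry_norm_def by (intro tendsto_intros lim)
    then show ?thesis by (simp add: d_def[abs_def] entry_norm_def)
  qed
  have e: "matrix_inv (u n) - B = matrix_inv (u n) ** (A - u n) ** B" for n
    using u[rule_format, of n] A
    by (simp add: matrix_sub_ldistrib matrix_sub_rdistrib matrix_inv_mult B_def matrix_mul_assoc[symmetric])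
  have bd: "entry_norm (matrix_inv (u n) - B) \<le> entry_norm (matrix_inv (u n)) * (d n * b)" for n
    unfolding e d_def b_def
    by (rule order_trans[OF entry_norm_mult], subst mult.assoc[symmetric], rule mult_right_mono[OF entry_norm_mult]) simp
  have bd2: "entry_norm (matrix_inv (u n) - B) \<le> 2 * b * (d n * b)" if small: "d n * b \<le> 1/2" for n
  proof -
    have "entry_norm (matrix_inv (u n)) \<le> b + entry_norm (matrix_inv (u n) - B)"
      using entry_norm_triangle[of B "matrix_inv (u n) - B"] by (simp add: b_def)
    also have "\<dots> \<le> b + entry_norm (matrix_inv (u n)) * (1/2)"
      using order_trans[OF bd mult_left_mono[OF small]] by simp
    finally have "entry_norm (matrix_inv (u n)) \<le> 2 * b" by simp
    then have "entry_norm (matrix_inv (u n)) * (d n * b) \<le> 2 * b * (d n * b)"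
      by (rule mult_right_mono) (simp add: d_def b_def)
    then show ?thesis using bd[of n] by simp
  qed
  have lim0: "(\<lambda>n. 2 * b * (d n * b)) \<longlonglongrightarrow> 0"
  proof -
    have "(\<lambda>n. 2 * b * (d n * b)) \<longlonglongrightarrow> 2 * b * (0 * b)" by (intro tendsto_intros d)
    then show ?thesis by simp
  qed
  have "(\<lambda>n. d n * b) \<longlonglongrightarrow> 0 * b" by (intro tendsto_intros d)
  then have ev: "eventually (\<lambda>n. d n * b \<le> 1/2) sequentially"
    using order_tendstoD(2)[of "\<lambda>n. d n * b" 0 sequentially "1/2"] by (auto elim: eventually_mono)
  have "(\<lambda>n. matrix_inv (u n)) \<longlonglongrightarrow> B"
  proof (intro vec_tendstoI)
    fix i j
    have "(\<lambda>n. matrix_inv (u n) $ i $ j - B $ i $ j) \<longlonglongrightarrow> 0"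
    proof (rule Lim_null_comparison[OF _ lim0], use ev in \<open>rule eventually_mono\<close>)
      fix n assume "d n * b \<le> 1/2"
      then show "norm (matrix_inv (u n) $ i $ j - B $ i $ j) \<le> 2 * b * (d n * b)"
        using order_trans[OF entry_le_entry_norm[of "matrix_inv (u n) - B" i j] bd2] by simp
    qed
    then show "(\<lambda>n. matrix_inv (u n) $ i $ j) \<longlonglongrightarrow> B $ i $ j" by (simp add: LIM_zero_iff)
  qed
  then show "(matrix_inv \<circ> u) \<longlonglongrightarrow> matrix_inv A" by (simp add: B_def comp_def)
qed

section \<open>The dilation group of a shearing subgroup and an adapted scaling subgroup\<close>

definition scaling :: "('n::finite \<Rightarrow> real) \<Rightarrow> real \<Rightarrow> 'n sqmat" where
  "scaling v a = diag_mat (\<lambda>i. a powr v i)"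

lemma one_param_scaling: "one_param (diag_mat v) = {scaling v a | a. a > 0}"
proof -
  have "diag_mat (\<lambda>i. exp (r * v i)) = scaling v (exp r)" for r
    by (simp add: scaling_def powr_def mult.commute)
  then have "one_param (diag_mat v) = {scaling v (exp r) | r. True}" by (simp add: one_param_diag)
  also have "\<dots> = {scaling v a | a. a > 0}"
  proof (rule equalityI; rule subsetI)
    fix A assume "A \<in> {scaling v a | a. a > 0}"
    then obtain a where "A = scaling v a" "a > 0" by blast
    then have "A = scaling v (exp (ln a))" by simp
    then show "A \<in> {scaling v (exp r) | r. True}" by blast
  qed auto
  finally show ?thesis .
qed

lemma scaling_mult: "a > 0 \<Longrightarrow> b > 0 \<Longrightarrow> scaling v a ** scaling v b = scaling v (a * b)"
  by (simp add: scaling_def diag_mat_mult powr_mult)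

lemma scaling_one: "scaling v 1 = mat 1"
  by (simp add: scaling_def diag_mat_one)

lemma scaling_entry: "scaling v a $ i $ j = (if i = j then a powr v i else 0)"
  by (simp add: scaling_def diag_mat_def)

lemma scaling_inv:
  assumes "a > 0"
  shows "invertible (scaling v a)" "matrix_inv (scaling v a) = scaling v (1 / a)"
proof -
  have "scaling v (1 / a) ** scaling v a = mat 1" using assms by (simp add: scaling_mult scaling_one)
  then show "invertible (scaling v a)" "matrix_inv (scaling v a) = scaling v (1 / a)"
    by (auto simp: matrix_inv_unique)
qed

lemma continuous_on_scaling [continuous_intros]:
  fixes f :: "'a::topological_space \<Rightarrow> real"
  assumes "continuous_on U f" "\<And>x. x \<in> U \<Longrightarrow> f x \<noteq> 0"
  shows "continuous_on U (\<lambda>x. scaling v (f x))"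
proof -
  have "continuous_on U (\<lambda>x. scaling v (f x) $ i $ j)" for i j
    unfolding scaling_entry using assms by (cases "i = j") (auto intro!: continuous_intros)
  then have "continuous_on U (\<lambda>x. \<chi> i. \<chi> j. scaling v (f x) $ i $ j)"
    by (intro continuous_on_vec_lambda)
  then show ?thesis by (simp only: vec_lambda_eta)
qed

lemma first_mult_upper:
  fixes x :: "(real, 'n::{finite,wellorder}) vec" and A :: "'n sqmat"
  assumes "level 0 A" shows "(x v* A) $ first_ix = x $ first_ix * A $ first_ix $ first_ix"
proof -
  have e: "x $ k * A $ k $ first_ix = (if k = first_ix then x $ first_ix * A $ first_ix $ first_ix else 0)" for k :: 'n
    using assms by (auto simp: level_0_iff first_ix_less_iff)
  have "(x v* A) $ first_ix = (\<Sum>k\<in>UNIV. x $ k * A $ k $ first_ix)"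
    by (simp add: vector_matrix_mult_def mult.commute)
  also have "\<dots> = (\<Sum>k\<in>(UNIV::'n set). if k = first_ix then x $ first_ix * A $ first_ix $ first_ix else 0)"
    by (rule sum.cong[OF refl e])
  also have "\<dots> = x $ first_ix * A $ first_ix $ first_ix" by simp
  finally have "(x v* A) $ first_ix = x $ first_ix * A $ first_ix $ first_ix" .
  then show ?thesis by simp
qed

definition dilation_group :: "'n::finite sqmat set \<Rightarrow> 'n sqmat set \<Rightarrow> 'n sqmat set" where
  "dilation_group S D = {d ** s | d s. d \<in> D \<and> s \<in> S} \<union> {- (d ** s) | d s. d \<in> D \<and> s \<in> S}"

locale shearlet = shearing S X for S :: "'n::{finite,wellorder} sqmat set" and X +
  fixes v :: "'n \<Rightarrow> real"
  assumes adapted: "adapted v"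
begin

lemma v_first: "v first_ix = 1"
  using adapted by (simp add: adapted_def)

definition twist :: "real \<Rightarrow> (real, 'n) vec \<Rightarrow> (real, 'n) vec" where
  "twist a x = (\<chi> i. a powr (1 - v i) * x $ i)"

lemma twist_first: "a > 0 \<Longrightarrow> twist a x $ first_ix = x $ first_ix"
  by (simp add: twist_def v_first)

lemma twist_twist: "a > 0 \<Longrightarrow> twist a (twist (1 / a) x) = x"
  by (simp add: twist_def vec_eq_iff powr_divide)

text \<open>By adaptedness, conjugation by the scaling with parameter \<open>a\<close> multiplies \<open>X\<^sub>i\<close> by \<open>a powr (1 - v\<^sub>i)\<close>.\<close>

lemma scaling_L:
  assumes a: "a > 0"
  shows "scaling v a ** L x = L (twist a x) ** scaling v a"
proof -
  have "(scaling v a ** L x) $ j $ k = (L (twist a x) ** scaling v a) $ j $ k" for j k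
  proof -
    have t: "a powr v j * (x $ i * X i $ j $ k) = (twist a x $ i * X i $ j $ k) * a powr v k" if "i \<in> {first_ix<..}" for i
    proof (cases "X i $ j $ k = 0")
      case False
      then have "v j = (1 - v i) + v k" using adapted that by (auto simp: adapted_def first_ix_less_iff algebra_simps)
      then have "a powr v j = a powr (1 - v i) * a powr v k" by (simp only: powr_add)
      then show ?thesis by (simp add: twist_def)
    qed simp
    have "(scaling v a ** L x) $ j $ k = a powr v j * (x $ first_ix * mat 1 $ j $ k) + (\<Sum>i\<in>{first_ix<..}. a powr v j * (x $ i * X i $ j $ k))"
      by (simp add: scaling_def diag_mat_mult_left L_def sum_distrib_left distrib_left)
    also have "(\<Sum>i\<in>{first_ix<..}. a powr v j * (x $ i * X i $ j $ k)) = (\<Sum>i\<in>{first_ix<..}. (twist a x $ i * X i $ j $ k) * a powr v k)"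
      by (rule sum.cong) (use t in auto)
    also have "a powr v j * (x $ first_ix * mat 1 $ j $ k) = (twist a x $ first_ix * mat 1 $ j $ k) * a powr v k"
      by (simp add: twist_first[OF a] mat_def)
    finally show ?thesis
      by (simp add: scaling_def diag_mat_mult_right L_def sum_distrib_right distrib_right)
  qed
  then show ?thesis by (simp add: vec_eq_iff)
qed

text \<open>The group element with prescribed first row \<open>\<xi>\<close>: the inverse of the map \<open>h \<mapsto> h\<^sup>T e\<^sub>1\<close> onto the orbit of \<open>e\<^sub>1\<close>
  under the dual action.\<close>

definition q :: "(real, 'n) vec \<Rightarrow> 'n sqmat" where
  "q \<xi> = (1 / \<bar>\<xi> $ first_ix\<bar>) *\<^sub>R (scaling v \<bar>\<xi> $ first_ix\<bar> ** L \<xi>)"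

definition Orb :: "(real, 'n) vec set" where
  "Orb = {\<xi>. \<xi> $ first_ix \<noteq> 0}"

lemma q_entry: "\<xi> \<in> Orb \<Longrightarrow> q \<xi> $ i $ j = \<bar>\<xi> $ first_ix\<bar> powr (v i - 1) * L \<xi> $ i $ j"
  by (simp add: q_def scaling_def diag_mat_mult_left Orb_def powr_diff)

lemma q_row: "\<xi> \<in> Orb \<Longrightarrow> q \<xi> $ first_ix = \<xi>"
  by (simp add: vec_eq_iff q_entry v_first Orb_def)

lemma q_level_0: "\<xi> \<in> Orb \<Longrightarrow> level 0 (q \<xi>)"
  using L_level_0[of \<xi>] by (auto simp: level_def q_entry)

lemma q_invertible: "\<xi> \<in> Orb \<Longrightarrow> invertible (q \<xi>)"
  by (subst upper_triangular_invertible_iff[OF q_level_0]) (auto simp: q_entry L_diagonal Orb_def)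

text \<open>Moving the second scaling past \<open>L \<xi>\<close> shows that the product has the form \<open>q \<zeta>\<close>, and \<open>\<zeta>\<close> must then be
  its first row.\<close>

lemma q_mult:
  assumes \<xi>: "\<xi> \<in> Orb" and \<eta>: "\<eta> \<in> Orb"
  shows "\<xi> v* q \<eta> \<in> Orb" "q \<xi> ** q \<eta> = q (\<xi> v* q \<eta>)"
proof -
  define a b where "a = \<bar>\<xi> $ first_ix\<bar>" and "b = \<bar>\<eta> $ first_ix\<bar>"
  have ab: "a > 0" "b > 0" using \<xi> \<eta> by (auto simp: a_def b_def Orb_def)
  define z where "z = twist (1 / b) \<xi>"
  define \<zeta> where "\<zeta> = z v* L \<eta>"
  have z1: "z $ first_ix = \<xi> $ first_ix" unfolding z_def using ab by (simp add: twist_first)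
  have \<zeta>1: "\<zeta> $ first_ix = \<xi> $ first_ix * \<eta> $ first_ix"
    unfolding \<zeta>_def by (simp add: first_mult_upper[OF L_level_0] z1)
  have \<zeta>a: "\<bar>\<zeta> $ first_ix\<bar> = a * b" by (simp add: \<zeta>1 abs_mult a_def b_def)
  have \<zeta>: "\<zeta> \<in> Orb" using \<xi> \<eta> \<zeta>1 by (simp add: Orb_def)
  have m: "L \<xi> ** scaling v b = scaling v b ** L z"
    using scaling_L[of b z] ab by (simp add: z_def twist_twist)
  have "(scaling v a ** L \<xi>) ** (scaling v b ** L \<eta>) = scaling v a ** (L \<xi> ** scaling v b) ** L \<eta>"
    by (simp add: matrix_mul_assoc)
  also have "\<dots> = (scaling v a ** scaling v b) ** (L z ** L \<eta>)"
    unfolding m by (simp add: matrix_mul_assoc)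
  also have "\<dots> = scaling v (a * b) ** L \<zeta>" by (simp add: scaling_mult ab L_mult \<zeta>_def)
  finally have p: "(scaling v a ** L \<xi>) ** (scaling v b ** L \<eta>) = scaling v (a * b) ** L \<zeta>" .
  have "q \<xi> ** q \<eta> = (1 / a * (1 / b)) *\<^sub>R ((scaling v a ** L \<xi>) ** (scaling v b ** L \<eta>))"
    unfolding q_def a_def[symmetric] b_def[symmetric]
    by (simp only: matrix_scalar_ac scalar_matrix_assoc[symmetric] scaleR_scaleR mult.commute)
  also have "\<dots> = q \<zeta>" unfolding p q_def \<zeta>a by simp
  finally have e: "q \<xi> ** q \<eta> = q \<zeta>" .
  then have "(q \<xi> ** q \<eta>) $ first_ix = q \<zeta> $ first_ix" by simp
  then have "\<xi> v* q \<eta> = \<zeta>" by (simp add: row_mult q_row \<xi> \<zeta>)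
  with e \<zeta> show "\<xi> v* q \<eta> \<in> Orb" "q \<xi> ** q \<eta> = q (\<xi> v* q \<eta>)" by auto
qed

lemma e1_Orb: "axis first_ix 1 \<in> Orb"
  by (simp add: Orb_def)

lemma q_one: "q (axis first_ix 1) = mat 1"
  by (simp add: q_def scaling_one L_one)

definition q_inv_row :: "(real, 'n) vec \<Rightarrow> (real, 'n) vec" where
  "q_inv_row \<xi> = axis first_ix 1 v* matrix_inv (q \<xi>)"

lemma q_inv:
  assumes \<xi>: "\<xi> \<in> Orb"
  shows "q_inv_row \<xi> \<in> Orb" "matrix_inv (q \<xi>) = q (q_inv_row \<xi>)"
proof -
  note inv = matrix_inv_mult[OF q_invertible[OF \<xi>]]
  have e: "q_inv_row \<xi> v* q \<xi> = axis first_ix 1"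
    unfolding q_inv_row_def by (simp add: vector_matrix_mul_assoc inv)
  then have "q_inv_row \<xi> $ first_ix * q \<xi> $ first_ix $ first_ix = 1"
    using first_mult_upper[OF q_level_0[OF \<xi>], of "q_inv_row \<xi>"] by simp
  then show o: "q_inv_row \<xi> \<in> Orb" by (auto simp: Orb_def)
  have "q (q_inv_row \<xi>) ** q \<xi> = mat 1" using q_mult(2)[OF o \<xi>] by (simp add: e q_one)
  then show "matrix_inv (q \<xi>) = q (q_inv_row \<xi>)" by (rule matrix_inv_unique)
qed

lemma q_inv_row_inv: "\<xi> \<in> Orb \<Longrightarrow> q_inv_row (q_inv_row \<xi>) = \<xi>"
proof -
  assume \<xi>: "\<xi> \<in> Orb"
  have "q \<xi> ** q (q_inv_row \<xi>) = mat 1"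
    using matrix_inv_mult[OF q_invertible[OF \<xi>]] by (simp add: q_inv[OF \<xi>])
  then have "matrix_inv (q (q_inv_row \<xi>)) = q \<xi>" by (rule matrix_inv_unique)
  then have "q (q_inv_row (q_inv_row \<xi>)) = q \<xi>" by (simp add: q_inv[OF q_inv(1)[OF \<xi>]])
  then show ?thesis by (metis q_row q_inv(1) \<xi>)
qed

definition H :: "'n sqmat set" where
  "H = q ` Orb"

lemma H_row: "h \<in> H \<Longrightarrow> h $ first_ix \<in> Orb" "h \<in> H \<Longrightarrow> q (h $ first_ix) = h"
  by (auto simp: H_def q_row)

lemma L_scaleR: "L (c *\<^sub>R x) = c *\<^sub>R L x"
  using linear_L by (simp add: linear_scale)

lemma q_scale:
  assumes "c \<noteq> 0" "x $ first_ix = 1"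
  shows "c *\<^sub>R x \<in> Orb" "q (c *\<^sub>R x) = (if c > 0 then 1 else -1) *\<^sub>R (scaling v \<bar>c\<bar> ** L x)"
  using assms by (auto simp: Orb_def q_def L_scaleR matrix_scalar_ac scalar_matrix_assoc[symmetric] abs_if)

lemma H_eq: "dilation_group S (one_param (diag_mat v)) = H"
proof (rule equalityI; rule subsetI)
  fix h assume "h \<in> dilation_group S (one_param (diag_mat v))"
  then obtain a x \<epsilon> where h: "a > 0" "x $ first_ix = 1" "\<epsilon> = 1 \<or> \<epsilon> = (-1::real)" "h = \<epsilon> *\<^sub>R (scaling v a ** L x)"
    unfolding dilation_group_def one_param_scaling S_eq by force
  then have "h = q ((\<epsilon> * a) *\<^sub>R x)" "(\<epsilon> * a) *\<^sub>R x \<in> Orb"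
    using q_scale[of "\<epsilon> * a" x] by auto
  then show "h \<in> H" by (auto simp: H_def)
next
  fix h assume "h \<in> H"
  then obtain \<xi> where \<xi>: "\<xi> \<in> Orb" "h = q \<xi>" by (auto simp: H_def)
  define c where "c = \<xi> $ first_ix"
  have c: "c \<noteq> 0" using \<xi> by (simp add: c_def Orb_def)
  define x where "x = (1 / c) *\<^sub>R \<xi>"
  have x: "x $ first_ix = 1" "\<xi> = c *\<^sub>R x" using c by (auto simp: x_def c_def)
  have "h = (if c > 0 then 1 else -1) *\<^sub>R (scaling v \<bar>c\<bar> ** L x)"
    using q_scale(2)[OF c x(1)] \<xi> x by simp
  moreover have "scaling v \<bar>c\<bar> \<in> one_param (diag_mat v)" "L x \<in> S"
    using c x by (auto simp: one_param_scaling S_eq)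
  ultimately show "h \<in> dilation_group S (one_param (diag_mat v))"
    unfolding dilation_group_def by (auto split: if_splits)
qed

lemma H_subgroup: "subgroup H GL"
  unfolding subgroup_GL_iff
proof (intro conjI ballI)
  show "mat 1 \<in> H" using q_one e1_Orb unfolding H_def by (metis imageI)
qed (auto simp: H_def q_invertible q_mult q_inv)

lemma continuous_on_q: "continuous_on Orb q"
proof -
  have "continuous_on Orb L" using linear_L by (intro linear_continuous_on linear_conv_bounded_linear[THEN iffD1])
  then show ?thesis unfolding q_def[abs_def] by (intro continuous_intros) (auto simp: Orb_def)
qed

lemma continuous_on_q_inv_row: "continuous_on Orb q_inv_row"
  unfolding q_inv_row_def[abs_def]
  by (intro continuous_intros continuous_on_compose2[OF continuous_on_matrix_inv continuous_on_q])
     (auto simp: q_invertible)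

lemma closed_level_0: "closed {A :: 'n sqmat. level 0 A}"
proof -
  have "{A :: 'n sqmat. level 0 A} = (\<Inter>i. \<Inter>j\<in>{..<i}. {A. A $ i $ j = 0})" by (auto simp: level_0_iff)
  moreover have "closed {A :: 'n sqmat. A $ i $ j = 0}" for i j by (intro closed_Collect_eq continuous_intros)
  ultimately show ?thesis by (simp only:) (intro closed_INT ballI)
qed

text \<open>Within the invertible upper triangular matrices, which are closed in the general linear group, \<open>H\<close> is the zero set of the continuous map
  \<open>A \<mapsto> A - q(A\<^sub>1)\<close>, where \<open>A\<^sub>1\<close> is the first row of \<open>A\<close>.\<close>

lemma H_closed: "closed_subgroup H"
  unfolding closed_subgroup_def
proof (intro conjI H_subgroup)
  define C where "C = carrier GL \<inter> {A :: 'n sqmat. level 0 A}"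
  have CO: "A $ first_ix \<in> Orb" if "A \<in> C" for A
    using that upper_triangular_invertible_iff[of A] by (auto simp: C_def Orb_def)
  have cont: "continuous_on C (\<lambda>A. A - q (A $ first_ix))"
    by (intro continuous_intros continuous_on_compose2[OF continuous_on_q]) (auto simp: CO)
  have "H = C \<inter> (\<lambda>A. A - q (A $ first_ix)) -` {0}"
  proof (rule equalityI; rule subsetI)
    fix h assume "h \<in> H"
    then show "h \<in> C \<inter> (\<lambda>A. A - q (A $ first_ix)) -` {0}"
      by (auto simp: C_def H_def q_row q_invertible q_level_0)
  next
    fix h assume "h \<in> C \<inter> (\<lambda>A. A - q (A $ first_ix)) -` {0}"
    then have "h = q (h $ first_ix)" "h $ first_ix \<in> Orb" using CO by auto
    then show "h \<in> H" by (auto simp: H_def)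
  qed
  then have "closedin (top_of_set C) H"
    using continuous_closedin_preimage[OF cont, of "{0}"] by simp
  moreover have "closedin (top_of_set (carrier GL)) C"
    unfolding C_def by (rule closedin_closed_Int[OF closed_level_0])
  ultimately show "closedin (top_of_set (carrier GL)) H" by (rule closedin_trans)
qed

lemma D_closed: "closed_subgroup (one_param (diag_mat v))"
  unfolding closed_subgroup_def
proof
  show "subgroup (one_param (diag_mat v)) GL"
    unfolding subgroup_GL_iff one_param_scaling
  proof (intro conjI ballI)
    show "mat 1 \<in> {scaling v a | a. a > 0}" using scaling_one[of v] by (auto intro: exI[of _ 1])
  next
    fix A B assume "A \<in> {scaling v a | a. a > 0}" "B \<in> {scaling v a | a. a > 0}"
    then obtain a b where "A = scaling v a" "B = scaling v b" "a > 0" "b > 0" by blast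
    then show "A ** B \<in> {scaling v a | a. a > 0}" by (auto simp: scaling_mult intro!: exI[of _ "a * b"])
  next
    fix A assume "A \<in> {scaling v a | a. a > 0}"
    then obtain a where "A = scaling v a" "a > 0" by blast
    then show "matrix_inv A \<in> {scaling v a | a. a > 0}"
      by (auto simp: scaling_inv intro!: exI[of _ "1 / a"])
  qed (auto simp: scaling_inv)
  define K where "K = {A :: 'n sqmat. (\<forall>i j. i \<noteq> j \<longrightarrow> A $ i $ j = 0) \<and> 0 \<le> A $ first_ix $ first_ix}"
  have "K = (\<Inter>i. \<Inter>j\<in>-{i}. {A. A $ i $ j = 0}) \<inter> {A. 0 \<le> A $ first_ix $ first_ix}" by (auto simp: K_def)
  moreover have "closed {A :: 'n sqmat. A $ i $ j = 0}" for i j by (intro closed_Collect_eq continuous_intros)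
  moreover have "closed {A :: 'n sqmat. 0 \<le> A $ first_ix $ first_ix}" by (intro closed_Collect_le continuous_intros)
  ultimately have "closed K" by (simp only:) (intro closed_Int closed_INT ballI)
  define C where "C = carrier GL \<inter> K"
  have pos: "A $ first_ix $ first_ix > 0" if "A \<in> C" for A
  proof -
    have "level 0 A" "invertible A" "0 \<le> A $ first_ix $ first_ix" using that by (auto simp: C_def K_def level_0_iff)
    then show ?thesis using upper_triangular_invertible_iff[of A] by (simp add: order.strict_iff_order)
  qed
  have cont: "continuous_on C (\<lambda>A. A - scaling v (A $ first_ix $ first_ix))"
    by (intro continuous_intros) (use pos in force)
  have "one_param (diag_mat v) = C \<inter> (\<lambda>A. A - scaling v (A $ first_ix $ first_ix)) -` {0}"
  proof (rule equalityI; rule subsetI)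
    fix h assume "h \<in> one_param (diag_mat v)"
    then obtain a where "h = scaling v a" "a > 0" by (auto simp: one_param_scaling)
    then show "h \<in> C \<inter> (\<lambda>A. A - scaling v (A $ first_ix $ first_ix)) -` {0}"
      by (auto simp: C_def K_def scaling_entry v_first scaling_inv)
  next
    fix h assume "h \<in> C \<inter> (\<lambda>A. A - scaling v (A $ first_ix $ first_ix)) -` {0}"
    then have "h = scaling v (h $ first_ix $ first_ix)" "h $ first_ix $ first_ix > 0" using pos by auto
    then show "h \<in> one_param (diag_mat v)" by (auto simp: one_param_scaling)
  qed
  then have "closedin (top_of_set C) (one_param (diag_mat v))"
    using continuous_closedin_preimage[OF cont, of "{0}"] by simp
  moreover have "closedin (top_of_set (carrier GL)) C"
    unfolding C_def by (rule closedin_closed_Int[OF \<open>closed K\<close>])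
  ultimately show "closedin (top_of_set (carrier GL)) (one_param (diag_mat v))" by (rule closedin_trans)
qed

lemma H_decomposition: "shearlet_decomposition H S (one_param (diag_mat v))"
  unfolding shearlet_decomposition_def
proof (intro conjI S_closed D_closed S_unitriangular S_connected ballI)
  let ?D = "one_param (diag_mat v)"
  have one: "mat 1 \<in> S" "mat 1 \<in> ?D"
    using S_subgroup D_closed by (auto simp: closed_subgroup_def subgroup_GL_iff)
  show "S \<subseteq> H"
  proof
    fix s assume "s \<in> S"
    then have "mat 1 ** s \<in> dilation_group S ?D" using one unfolding dilation_group_def by blast
    then show "s \<in> H" by (simp add: H_eq)
  qed
  show "?D \<subseteq> H"
  proof
    fix d assume "d \<in> ?D"
    then have "d ** mat 1 \<in> dilation_group S ?D" using one unfolding dilation_group_def by blast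
    then show "d \<in> H" by (simp add: H_eq)
  qed
  show "a ** b = b ** a" if "a \<in> S" "b \<in> S" for a b using that by (rule S_abelian)
  show "\<exists>Y. diagonal_mat Y \<and> ?D = one_param Y" using diagonal_diag_mat by blast
  fix h assume "h \<in> H"
  then have "h \<in> dilation_group S ?D" by (simp add: H_eq)
  then obtain \<epsilon> d s where ex: "\<epsilon> \<in> {1, -1 :: real}" "d \<in> ?D" "s \<in> S" "h = \<epsilon> *\<^sub>R (d ** s)"
    unfolding dilation_group_def by fastforce
  show "\<exists>!(\<epsilon>, d, s). \<epsilon> \<in> {1, -1 :: real} \<and> d \<in> ?D \<and> s \<in> S \<and> h = \<epsilon> *\<^sub>R (d ** s)"
  proof (rule ex1I[of _ "(\<epsilon>, d, s)"])
    fix p :: "real \<times> 'n sqmat \<times> 'n sqmat"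
    assume "case p of (\<epsilon>, d, s) \<Rightarrow> \<epsilon> \<in> {1, -1} \<and> d \<in> ?D \<and> s \<in> S \<and> h = \<epsilon> *\<^sub>R (d ** s)"
    then obtain \<epsilon>' d' s' where p: "p = (\<epsilon>', d', s')" "\<epsilon>' \<in> {1, -1}" "d' \<in> ?D" "s' \<in> S" "h = \<epsilon>' *\<^sub>R (d' ** s')"
      by (cases p) auto
    obtain a a' where a: "d = scaling v a" "a > 0" "d' = scaling v a'" "a' > 0"
      using ex(2) p(3) by (auto simp: one_param_scaling)
    have ff: "s0 $ first_ix $ first_ix = 1" if "s0 \<in> S" for s0 using that S_unitriangular by (auto simp: unitriangular_def)
    have "\<epsilon> * a = h $ first_ix $ first_ix"
      unfolding ex(4) using ff[OF ex(3)] a by (simp add: scaling_def diag_mat_mult_left v_first)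
    moreover have "\<epsilon>' * a' = h $ first_ix $ first_ix"
      unfolding p(5) using ff[OF p(4)] a by (simp add: scaling_def diag_mat_mult_left v_first)
    ultimately have eq: "\<epsilon> * a = \<epsilon>' * a'" by simp
    then have e: "\<epsilon> = \<epsilon>'" using ex(1) p(2) a(2,4) by auto
    then have "a = a'" using eq ex(1) by auto
    then have d: "d = d'" using a by simp
    have "d ** s = d ** s'" using ex(1,4) p(5) e d by auto
    then have "matrix_inv d ** (d ** s) = matrix_inv d ** (d ** s')" by simp
    then have "s = s'" using a(1,2) by (simp add: matrix_mul_assoc matrix_inv_mult scaling_inv(1))
    then show "p = (\<epsilon>, d, s)" using p e d by simp
  qed (use ex in simp)
qed

end

section \<open>Irreducibility\<close>

text \<open>On the Fourier side, orthogonality to all translates means that an integrable product of two \<open>L\<^sup>2\<close> functions has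
  vanishing Fourier transform, and so is zero.\<close>

lemma orthogonal_translates_product_null:
  fixes h :: "'n::{finite,wellorder} sqmat"
  assumes h: "invertible h" and f: "fourier_pair f F" and g: "fourier_pair g G"
    and orth: "\<And>x. L2_inner lborel g (quasi_regular (x, h) f) = 0"
  shows "AE \<omega> in lborel. G \<omega> * cnj (F (transpose h *v \<omega>)) = 0"
proof -
  have FL: "F \<in> L2 lborel" and GL2: "G \<in> L2 lborel" using f g by (auto simp: fourier_pair_def)
  define u where "u \<omega> = G \<omega> * cnj (dual_action (0, h) F \<omega>)" for \<omega>
  have ui: "integrable lborel u"
    unfolding u_def by (intro L2_integrable_mult GL2 dual_action_L2 h FL)
  have "fourier u y = 0" for y
  proof -
    have "L2_inner lborel G (dual_action (- y, h) F) = 0"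
      using fourier_pair_inner[OF g fourier_pair_quasi_regular[OF h f, of "- y"]] orth by simp
    moreover have "G \<omega> * cnj (dual_action (- y, h) F \<omega>) = u \<omega> * cis (y \<bullet> \<omega>)" for \<omega>
      by (simp add: u_def dual_action_def cis_cnj inner_commute mult_ac)
    ultimately show ?thesis by (simp add: fourier_def L2_inner_def)
  qed
  then have "AE \<omega> in lborel. u \<omega> = 0" by (rule fourier_inj[OF ui])
  then show ?thesis
    by (rule eventually_mono) (use h in \<open>auto simp: u_def dual_action_def invertible_det_nz\<close>)
qed

context shearlet
begin

lemma Orb_measurable [measurable]: "Orb \<in> sets borel"
proof -
  have "open Orb" unfolding Orb_def by (intro open_Collect_neq continuous_intros)
  then show ?thesis by simp
qed

lemma AE_Orb: "AE \<xi> in lborel. \<xi> \<in> Orb"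
proof -
  have "negligible {x::(real, 'n) vec. x \<bullet> axis first_ix 1 = 0}"
    by (rule negligible_standard_hyperplane) (simp add: axis_in_Basis_iff)
  also have "{x::(real, 'n) vec. x \<bullet> axis first_ix 1 = 0} = - Orb" by (auto simp: Orb_def inner_axis)
  finally have "- Orb \<in> null_sets lebesgue" by (simp add: negligible_iff_null_sets)
  then have "- Orb \<in> null_sets lborel" by (subst (asm) null_sets_completion_iff) auto
  then have "AE \<xi> in lborel. \<xi> \<notin> - Orb" by (rule AE_not_in)
  then show ?thesis by simp
qed

lemma q_measurable [measurable]: "q \<in> borel_measurable borel"
proof -
  have "(\<lambda>\<xi>. if \<xi> \<in> Orb then q \<xi> else 0) \<in> borel_measurable borel"
    by (rule borel_measurable_continuous_on_if[OF Orb_measurable continuous_on_q continuous_on_const])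
  also have "(\<lambda>\<xi>. if \<xi> \<in> Orb then q \<xi> else 0) = q"
    \<comment> \<open>Off the orbit, \<open>q\<close> is zero because \<open>1 / 0 = 0\<close>.\<close>
    by (auto simp: q_def Orb_def)
  finally show ?thesis .
qed

lemma row_action_measurable [measurable]:
  assumes [measurable]: "f \<in> borel_measurable M" "g \<in> borel_measurable M"
  shows "(\<lambda>x. f x v* (g x :: 'n sqmat)) \<in> borel_measurable M"
  by (rule borel_measurable_continuous_Pair[OF assms]) (intro continuous_intros)

lemma orbit_map_differentiable:
  fixes \<omega> :: "(real, 'n) vec"
  shows "(\<lambda>\<zeta>. \<omega> v* q \<zeta>) differentiable_on Orb"
proof -
  have "open Orb" unfolding Orb_def by (intro open_Collect_neq continuous_intros)
  have blL: "bounded_linear (\<lambda>\<zeta>. L \<zeta> $ i $ j)" for i j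
    using bounded_linear_compose[OF bounded_linear_vec_nth bounded_linear_compose[OF bounded_linear_vec_nth]] linear_L
    by (simp add: linear_conv_bounded_linear)
  \<comment> \<open>Powers of \<open>\<bar>\<zeta>\<^sub>1\<bar>\<close> are written as powers of its square, which is differentiable without a case distinction.\<close>
  have main: "(\<lambda>\<zeta>. \<Sum>i\<in>UNIV. \<omega> $ i * (((\<zeta> $ first_ix)\<^sup>2) powr ((v i - 1) / 2) * L \<zeta> $ i $ j)) differentiable at \<zeta>" if \<zeta>: "\<zeta> \<in> Orb" for j \<zeta>
  proof -
    have "\<exists>D. ((\<lambda>\<zeta>. ((\<zeta> $ first_ix)\<^sup>2) powr ((v i - 1) / 2)) has_derivative D) (at \<zeta>)" for i
      by (rule exI, rule has_derivative_powr, rule has_derivative_power, rule bounded_linear.has_derivative[OF bounded_linear_vec_nth],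
          rule has_derivative_ident, rule has_derivative_const) (use \<zeta> in \<open>auto simp: Orb_def\<close>)
    then have "(\<lambda>\<zeta>. ((\<zeta> $ first_ix)\<^sup>2) powr ((v i - 1) / 2)) differentiable at \<zeta>" for i
      by (simp add: differentiable_def)
    moreover have "(\<lambda>\<zeta>. L \<zeta> $ i $ j) differentiable at \<zeta>" for i
      using bounded_linear_imp_differentiable[OF blL] .
    ultimately show ?thesis by (intro differentiable_sum differentiable_mult differentiable_const) auto
  qed
  have "(\<lambda>\<zeta>. (\<omega> v* q \<zeta>) $ j) differentiable at \<zeta> within Orb" if \<zeta>: "\<zeta> \<in> Orb" for j \<zeta>
  proof (rule differentiable_transform_within[OF differentiable_at_withinI[OF main[OF \<zeta>, of j]], of 1])
    fix \<xi> assume "\<xi> \<in> Orb"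
    then have "(\<xi> $ first_ix)\<^sup>2 = \<bar>\<xi> $ first_ix\<bar> powr 2" by (simp add: Orb_def powr_numeral)
    then have "\<bar>\<xi> $ first_ix\<bar> powr p = ((\<xi> $ first_ix)\<^sup>2) powr (p / 2)" for p
      by (simp only: powr_powr) simp
    then show "(\<Sum>i\<in>UNIV. \<omega> $ i * (((\<xi> $ first_ix)\<^sup>2) powr ((v i - 1) / 2) * L \<xi> $ i $ j)) = (\<omega> v* q \<xi>) $ j"
      using \<open>\<xi> \<in> Orb\<close> by (simp add: vector_matrix_mult_def q_entry mult.commute)
  qed (use \<zeta> in auto)
  then show ?thesis
    unfolding differentiable_on_def
    by (subst differentiable_componentwise_within) (auto simp: Basis_vec_def inner_axis)
qed

text \<open>The orbit map of a point of the open orbit is a diffeomorphism of the orbit, so it maps null sets to null sets.\<close>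

lemma orbit_map_AE:
  fixes \<omega> :: "(real, 'n) vec"
  assumes \<omega>: "\<omega> \<in> Orb" and [measurable]: "F \<in> borel_measurable borel"
    and ae: "AE \<zeta> in lborel. \<zeta> \<in> Orb \<longrightarrow> F (\<omega> v* q \<zeta>) = (0::complex)"
  shows "AE \<eta> in lborel. F \<eta> = 0"
proof -
  define M where "M = {\<zeta> \<in> Orb. F (\<omega> v* q \<zeta>) \<noteq> 0}"
  have [measurable]: "M \<in> sets borel" unfolding M_def by measurable
  have "M \<in> null_sets lborel"
  proof -
    have "AE \<zeta> in lborel. \<zeta> \<notin> M" using ae by (rule eventually_mono) (auto simp: M_def)
    then show ?thesis by (subst (asm) AE_iff_null_sets[symmetric]) auto
  qed
  then have "negligible M" by (simp add: negligible_iff_null_sets null_sets_completionI)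
  then have neg: "negligible ((\<lambda>\<zeta>. \<omega> v* q \<zeta>) ` M)"
    by (rule negligible_differentiable_image_negligible[OF order_refl])
       (rule differentiable_on_subset[OF orbit_map_differentiable], auto simp: M_def)
  define N where "N = {\<eta> \<in> Orb. F \<eta> \<noteq> 0}"
  have [measurable]: "N \<in> sets borel" unfolding N_def by measurable
  have "N \<subseteq> (\<lambda>\<zeta>. \<omega> v* q \<zeta>) ` M"
  proof
    fix \<eta> assume \<eta>: "\<eta> \<in> N"
    then have \<eta>O: "\<eta> \<in> Orb" by (simp add: N_def)
    define \<zeta> where "\<zeta> = q_inv_row \<omega> v* q \<eta>"
    have \<zeta>: "\<zeta> \<in> Orb" "q \<zeta> = q (q_inv_row \<omega>) ** q \<eta>"
      unfolding \<zeta>_def using q_mult[OF q_inv(1)[OF \<omega>] \<eta>O] by auto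
    have "q \<omega> ** q \<zeta> = q \<eta>"
      unfolding \<zeta>(2) q_inv(2)[OF \<omega>, symmetric] matrix_mul_assoc
      by (simp add: matrix_inv_mult[OF q_invertible[OF \<omega>]])
    then have "(q \<omega> ** q \<zeta>) $ first_ix = q \<eta> $ first_ix" by simp
    then have "\<omega> v* q \<zeta> = \<eta>" by (simp add: row_mult q_row \<omega> \<eta>O)
    then show "\<eta> \<in> (\<lambda>\<zeta>. \<omega> v* q \<zeta>) ` M" using \<eta> \<zeta>(1) by (auto simp: M_def N_def intro!: image_eqI[of _ _ \<zeta>])
  qed
  then have "negligible N" using neg negligible_subset by blast
  then have "N \<in> null_sets lebesgue" by (simp add: negligible_iff_null_sets)
  then have "N \<in> null_sets lborel" by (subst (asm) null_sets_completion_iff) auto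
  then have "AE \<eta> in lborel. \<eta> \<notin> N" by (rule AE_not_in)
  with AE_Orb show ?thesis by eventually_elim (auto simp: N_def)
qed

text \<open>If an invariant closed subspace is proper, it has a nonzero orthogonal vector \<open>g\<close>. Then \<open>G(\<omega>) F(h\<^sup>T \<omega>) = 0\<close> for almost
  every \<open>\<omega>\<close>, for each \<open>h\<close>; by Fubini's theorem some \<open>\<omega>\<close> with \<open>G(\<omega>) \<noteq> 0\<close> has \<open>F(h\<^sup>T \<omega>) = 0\<close> for almost every \<open>h\<close>, and
  \<open>h\<^sup>T \<omega>\<close> runs through the whole orbit.\<close>

theorem H_irreducible: "irreducible_rep (semidirect H) lborel quasi_regular"
  unfolding irreducible_rep_def
proof (intro allI impI, elim conjE)
  fix V :: "((real, 'n) vec \<Rightarrow> complex) set"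
  assume V: "L2_closed_subspace lborel V"
    and inv: "\<forall>p\<in>carrier (semidirect H). \<forall>f\<in>V. quasi_regular p f \<in> V"
  have "V = L2_null lborel" if "V \<noteq> L2 lborel"
  proof (rule equalityI[OF subsetI L2_closed_subspace_null[OF V]])
    fix f assume f: "f \<in> V"
    obtain g where g: "g \<in> L2 lborel" "g \<notin> L2_null lborel" "\<And>f. f \<in> V \<Longrightarrow> L2_inner lborel g f = 0"
      by (rule L2_orthogonal_complement_nontrivial[OF V \<open>V \<noteq> L2 lborel\<close>]) blast
    have fL: "f \<in> L2 lborel" using f L2_closed_subspaceD(1)[OF V] by blast
    obtain F where F: "fourier_pair f F" using fourier_pair_exists[OF fL] .
    obtain G where G: "fourier_pair g G" using fourier_pair_exists[OF g(1)] .
    have FG: "F \<in> L2 lborel" "G \<in> L2 lborel" using F G by (simp_all add: fourier_pair_def)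
    have [measurable]: "F \<in> borel_measurable borel" "G \<in> borel_measurable borel"
      using L2_measurable[OF FG(1)] L2_measurable[OF FG(2)] by simp_all
    have Gnn: "G \<notin> L2_null lborel" using fourier_pair_null[OF G] g(2) by simp
    have ae1: "AE \<omega> in lborel. G \<omega> \<noteq> 0 \<longrightarrow> \<zeta> \<in> Orb \<longrightarrow> F (\<omega> v* q \<zeta>) = 0" for \<zeta>
    proof (cases "\<zeta> \<in> Orb")
      case True
      then have "q \<zeta> \<in> H" by (simp add: H_def)
      then have "L2_inner lborel g (quasi_regular (x, q \<zeta>) f) = 0" for x
        using inv f by (intro g(3)) (auto simp: semidirect_def)
      from orthogonal_translates_product_null[OF q_invertible[OF True] F G this]
      show ?thesis by (rule eventually_mono) (auto simp: transpose_matrix_vector)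
    qed simp
    have "AE \<zeta> in lborel. AE \<omega> in lborel. G \<omega> \<noteq> 0 \<longrightarrow> \<zeta> \<in> Orb \<longrightarrow> F (\<omega> v* q \<zeta>) = 0"
      by (rule AE_I2) (rule ae1)
    then have ae2: "AE \<omega> in lborel. AE \<zeta> in lborel. G \<omega> \<noteq> 0 \<longrightarrow> \<zeta> \<in> Orb \<longrightarrow> F (\<omega> v* q \<zeta>) = 0"
      by (subst (asm) lborel_pair.AE_commute) measurable
    have "\<exists>\<omega>\<in>Orb. G \<omega> \<noteq> 0 \<and> (AE \<zeta> in lborel. \<zeta> \<in> Orb \<longrightarrow> F (\<omega> v* q \<zeta>) = 0)"
    proof (rule ccontr)
      assume no: "\<not> ?thesis"
      have "AE \<omega> in lborel. G \<omega> = 0"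
        using ae2 AE_Orb
      proof eventually_elim
        case (elim \<omega>)
        show ?case
        proof (rule ccontr)
          assume "G \<omega> \<noteq> 0"
          then have "AE \<zeta> in lborel. \<zeta> \<in> Orb \<longrightarrow> F (\<omega> v* q \<zeta>) = 0" using elim(1) by simp
          then show False using no elim(2) \<open>G \<omega> \<noteq> 0\<close> by blast
        qed
      qed
      then show False using Gnn G by (auto simp: L2_null_def fourier_pair_def)
    qed
    then obtain \<omega> where "\<omega> \<in> Orb" "AE \<zeta> in lborel. \<zeta> \<in> Orb \<longrightarrow> F (\<omega> v* q \<zeta>) = 0" by blast
    then have "AE \<eta> in lborel. F \<eta> = 0" by (intro orbit_map_AE[of \<omega> F]) auto
    then have "F \<in> L2_null lborel" using F by (auto simp: L2_null_def fourier_pair_def)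
    then show "f \<in> L2_null lborel" using fourier_pair_null[OF F] by simp
  qed
  then show "V = L2_null lborel \<or> V = L2 lborel" by blast
qed

end

section \<open>Square-integrability\<close>

lemma nn_integral_shift:
  fixes f :: "'a::euclidean_space \<Rightarrow> ennreal"
  assumes [measurable]: "f \<in> borel_measurable borel"
  shows "(\<integral>\<^sup>+x. f (x + c) \<partial>lborel) = (\<integral>\<^sup>+x. f x \<partial>lborel)"
  by (subst (2) lborel_shift[of c, symmetric], subst nn_integral_distr) auto

context shearlet
begin

definition orbit_param :: "(real, 'n) vec \<times> (real, 'n) vec \<Rightarrow> (real, 'n) vec \<times> 'n sqmat" where
  "orbit_param = (\<lambda>(x, \<xi>). (x, matrix_inv (q \<xi>)))"

text \<open>In the coordinates \<open>(x, \<xi>) \<mapsto> (x, q(\<xi>)\<^sup>-\<^sup>1)\<close>, left translation by \<open>(y, g)\<close> is the affine map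
  \<open>(x, \<xi>) \<mapsto> (y + g x, g\<^sup>-\<^sup>T \<xi>)\<close>, whose Jacobian is \<open>1\<close>. Hence Lebesgue measure becomes a left Haar measure.\<close>

definition haar :: "((real, 'n) vec \<times> 'n sqmat) measure" where
  "haar = distr (restrict_space lborel (UNIV \<times> Orb)) (restrict_space borel (UNIV \<times> H)) orbit_param"

lemma orbit_param_mem: "\<xi> \<in> Orb \<Longrightarrow> orbit_param (x, \<xi>) \<in> UNIV \<times> H"
  by (auto simp: orbit_param_def q_inv H_def)

lemma continuous_on_orbit_param: "continuous_on (UNIV \<times> Orb) orbit_param"
  unfolding orbit_param_def case_prod_beta
  by (intro continuous_intros continuous_on_compose2[OF continuous_on_matrix_inv]
        continuous_on_compose2[OF continuous_on_q]) (auto simp: q_invertible)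

lemma orbit_param_measurable [measurable]:
  "orbit_param \<in> restrict_space lborel (UNIV \<times> Orb) \<rightarrow>\<^sub>M restrict_space borel (UNIV \<times> H)"
proof (rule measurable_restrict_space2)
  show "orbit_param \<in> space (restrict_space lborel (UNIV \<times> Orb)) \<rightarrow> UNIV \<times> H"
    using orbit_param_mem by (auto simp: space_restrict_space)
  have "orbit_param \<in> borel_measurable (restrict_space borel (UNIV \<times> Orb))"
    by (rule borel_measurable_continuous_on_restrict[OF continuous_on_orbit_param])
  then show "orbit_param \<in> borel_measurable (restrict_space lborel (UNIV \<times> Orb))"
    by (subst measurable_cong_sets[OF sets_restrict_space_cong[OF sets_lborel] refl])
qed

lemma UNIV_Orb_measurable [measurable]: "UNIV \<times> Orb \<in> sets (borel :: ((real, 'n) vec \<times> (real, 'n) vec) measure)"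
  unfolding borel_prod[symmetric] by measurable

lemma sets_haar [simp]: "sets haar = sets (restrict_space borel (UNIV \<times> H))"
  by (simp add: haar_def)

lemma emeasure_haar:
  assumes A: "A \<in> sets haar"
  shows "emeasure haar A = emeasure lborel (orbit_param -` A \<inter> (UNIV \<times> Orb))"
    and "orbit_param -` A \<inter> (UNIV \<times> Orb) \<in> sets borel"
proof -
  have A': "A \<in> sets (restrict_space borel (UNIV \<times> H))" using A by simp
  have s: "space (restrict_space lborel (UNIV \<times> Orb)) = UNIV \<times> Orb" by (simp add: space_restrict_space)
  have "orbit_param -` A \<inter> (UNIV \<times> Orb) \<in> sets (restrict_space lborel (UNIV \<times> Orb))"
    using measurable_sets[OF orbit_param_measurable A'] by (simp only: s)
  then show m: "orbit_param -` A \<inter> (UNIV \<times> Orb) \<in> sets borel"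
    by (subst (asm) sets_restrict_space_iff) auto
  show "emeasure haar A = emeasure lborel (orbit_param -` A \<inter> (UNIV \<times> Orb))"
    unfolding haar_def emeasure_distr[OF orbit_param_measurable A'] s
    by (rule emeasure_restrict_space) auto
qed

lemma emeasure_lborel_Times:
  "emeasure lborel (P :: ((real, 'n) vec \<times> (real, 'n) vec) set) = (\<integral>\<^sup>+\<xi>. \<integral>\<^sup>+x. indicator P (x, \<xi>) \<partial>lborel \<partial>lborel)"
  if [measurable]: "P \<in> sets borel"
proof -
  have [measurable]: "P \<in> sets (borel \<Otimes>\<^sub>M borel)" unfolding borel_prod by (rule that)
  have "emeasure lborel P = (\<integral>\<^sup>+p. indicator P p \<partial>(lborel \<Otimes>\<^sub>M lborel))"
    unfolding lborel_prod by simp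
  also have "\<dots> = (\<integral>\<^sup>+\<xi>. \<integral>\<^sup>+x. indicator P (x, \<xi>) \<partial>lborel \<partial>lborel)"
    by (rule lborel_pair.nn_integral_snd[symmetric]) simp
  finally show ?thesis .
qed

lemma semidirect_simps:
  "carrier (semidirect H) = UNIV \<times> H" "(y, g) \<otimes>\<^bsub>semidirect H\<^esub> (x, h) = (y + g *v x, g ** h)"
  by (simp_all add: semidirect_def)

theorem left_haar_haar: "left_haar (semidirect H) haar"
  unfolding left_haar_def semidirect_simps(1)
proof (intro conjI allI ballI impI, goal_cases)
  case 2
  have c: "UNIV \<times> H \<in> sets haar" using sets.top[of haar] by (simp add: haar_def space_restrict_space)
  have "orbit_param -` (UNIV \<times> H) \<inter> (UNIV \<times> Orb) = (UNIV :: (real, 'n) vec set) \<times> Orb"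
    using orbit_param_mem by auto
  then have "emeasure haar (UNIV \<times> H) = emeasure lborel ((UNIV :: (real, 'n) vec set) \<times> Orb)"
    using emeasure_haar(1)[OF c] by simp
  also have "\<dots> = emeasure lborel (UNIV :: (real, 'n) vec set) * emeasure lborel Orb"
    unfolding lborel_prod[symmetric] by (rule lborel.emeasure_pair_measure_Times) auto
  finally have e: "emeasure haar (UNIV \<times> H) = emeasure lborel (UNIV :: (real, 'n) vec set) * emeasure lborel Orb" .
  show ?case
  proof
    assume "emeasure haar (UNIV \<times> H) = 0"
    then have "Orb \<in> null_sets lborel" unfolding e by auto
    then have "AE \<xi> in lborel. \<xi> \<notin> Orb" by (rule AE_not_in)
    with AE_Orb have "AE \<xi>::(real, 'n) vec in lborel. False" by eventually_elim simp
    then show False by (simp add: eventually_False ae_filter_eq_bot_iff)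
  qed
next
  case (3 K)
  then have K: "compact K" "K \<subseteq> UNIV \<times> H" by auto
  have Ks: "K \<in> sets haar" using K by (auto simp: sets_restrict_space intro!: image_eqI[of _ _ K] borel_compact)
  define pull where "pull = (\<lambda>p :: (real, 'n) vec \<times> 'n sqmat. (fst p, q_inv_row (snd p $ first_ix)))"
  have "continuous_on K pull" unfolding pull_def
    by (intro continuous_intros continuous_on_compose2[OF continuous_on_q_inv_row]) (use K H_row in fastforce)
  then have cK: "compact (pull ` K)" by (rule compact_continuous_image[OF _ K(1)])
  have "orbit_param -` K \<inter> (UNIV \<times> Orb) \<subseteq> pull ` K"
  proof
    fix p assume p: "p \<in> orbit_param -` K \<inter> (UNIV \<times> Orb)"
    obtain x \<xi> where x: "p = (x, \<xi>)" by (cases p)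
    then have "\<xi> \<in> Orb" using p by auto
    then have "pull (orbit_param p) = p"
      by (simp add: pull_def orbit_param_def x q_inv(2) q_row[OF q_inv(1)] q_inv_row_inv)
    then show "p \<in> pull ` K" using p by (metis Int_iff imageI vimageE)
  qed
  then have "emeasure haar K \<le> emeasure lborel (pull ` K)"
    unfolding emeasure_haar(1)[OF Ks] by (rule emeasure_mono) (use cK in \<open>auto intro: borel_compact\<close>)
  also have "\<dots> < \<infinity>" by (rule emeasure_bounded_finite[OF compact_imp_bounded[OF cK]])
  finally show ?case .
next
  case (4 p A)
  obtain y g where p: "p = (y, g)" "g \<in> H" using 4(1) by auto
  obtain \<gamma> where \<gamma>: "\<gamma> \<in> Orb" "g = q \<gamma>" using p by (auto simp: H_def)
  have gi: "invertible g" using \<gamma> q_invertible by simp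
  define g' where "g' = matrix_inv g"
  have g': "g' = q (q_inv_row \<gamma>)" "q_inv_row \<gamma> \<in> Orb" using \<gamma> q_inv by (auto simp: g'_def)
  have gg: "g' ** g = mat 1" "g ** g' = mat 1" using matrix_inv_mult[OF gi] by (auto simp: g'_def)
  have g'H: "g' \<in> H" using g' by (simp add: H_def)
  have Hmult: "a ** b \<in> H" if "a \<in> H" "b \<in> H" for a b using that H_subgroup by (simp add: subgroup_GL_iff)
  define pull where "pull = (\<lambda>r :: (real, 'n) vec \<times> 'n sqmat. (g' *v (fst r - y), g' ** snd r))"
  define pA where "pA = (\<lambda>x. p \<otimes>\<^bsub>semidirect H\<^esub> x) ` A"
  have AH: "A \<subseteq> UNIV \<times> H" using sets.sets_into_space[OF 4(2)] by (simp add: haar_def space_restrict_space)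
  have pA: "pA = pull -` A \<inter> space (restrict_space borel (UNIV \<times> H))"
  proof (rule equalityI; rule subsetI)
    fix r assume "r \<in> pA"
    then obtain x h where xh: "(x, h) \<in> A" "r = (y + g *v x, g ** h)" by (auto simp: pA_def p semidirect_simps)
    moreover have "pull r = (x, h)"
      by (simp add: pull_def xh matrix_vector_mul_assoc matrix_mul_assoc gg)
    ultimately show "r \<in> pull -` A \<inter> space (restrict_space borel (UNIV \<times> H))"
      using AH p(2) by (auto simp: space_restrict_space intro: Hmult)
  next
    fix r assume "r \<in> pull -` A \<inter> space (restrict_space borel (UNIV \<times> H))"
    then have "pull r \<in> A" by simp
    moreover have "r = p \<otimes>\<^bsub>semidirect H\<^esub> pull r"
      by (simp add: pull_def p semidirect_simps matrix_vector_mul_assoc matrix_mul_assoc gg)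
    ultimately show "r \<in> pA" unfolding pA_def by blast
  qed
  have pull_m: "pull \<in> restrict_space borel (UNIV \<times> H) \<rightarrow>\<^sub>M restrict_space borel (UNIV \<times> H)"
  proof (rule measurable_restrict_space2)
    show "pull \<in> space (restrict_space borel (UNIV \<times> H)) \<rightarrow> UNIV \<times> H"
      using g'H by (auto simp: space_restrict_space pull_def intro: Hmult)
    have "continuous_on (UNIV \<times> H) pull" unfolding pull_def by (intro continuous_intros)
    then show "pull \<in> borel_measurable (restrict_space borel (UNIV \<times> H))"
      by (rule borel_measurable_continuous_on_restrict)
  qed
  have pAs: "pA \<in> sets haar"
    unfolding sets_haar pA by (rule measurable_sets[OF pull_m]) (use 4(2) in simp)
  define B where "B = orbit_param -` A \<inter> (UNIV \<times> Orb)"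
  have B [measurable]: "B \<in> sets borel" unfolding B_def by (rule emeasure_haar(2)[OF 4(2)])
  have Bp [measurable]: "B \<in> sets (borel \<Otimes>\<^sub>M borel)" unfolding borel_prod by (rule B)
  have eq: "(x, \<xi>) \<in> orbit_param -` pA \<inter> (UNIV \<times> Orb) \<longleftrightarrow> (g' *v (x - y), \<xi> v* g) \<in> B" for x \<xi>
  proof (cases "\<xi> \<in> Orb")
    case True
    have q\<xi>: "q (\<xi> v* g) = q \<xi> ** g" "\<xi> v* g \<in> Orb" using q_mult[OF True \<gamma>(1)] by (auto simp: \<gamma>(2))
    have "matrix_inv (q (\<xi> v* g)) = g' ** matrix_inv (q \<xi>)"
    proof (rule matrix_inv_unique(2))
      have "g' ** matrix_inv (q \<xi>) ** q (\<xi> v* g) = g' ** (matrix_inv (q \<xi>) ** q \<xi>) ** g"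
        by (simp only: q\<xi>(1) matrix_mul_assoc)
      then show "g' ** matrix_inv (q \<xi>) ** q (\<xi> v* g) = mat 1"
        by (simp add: matrix_inv_mult[OF q_invertible[OF True]] gg)
    qed
    then have "orbit_param (g' *v (x - y), \<xi> v* g) = pull (orbit_param (x, \<xi>))"
      by (simp add: orbit_param_def pull_def)
    then show ?thesis
      using True q\<xi>(2) orbit_param_mem[OF True, of x] by (auto simp: pA B_def space_restrict_space)
  next
    case False
    have "\<xi> v* g \<notin> Orb"
    proof
      assume "\<xi> v* g \<in> Orb"
      then have "(\<xi> v* g) v* g' \<in> Orb" using q_mult(1) g' by auto
      then show False using False by (simp add: vector_matrix_mul_assoc gg)
    qed
    then show ?thesis using False by (simp add: B_def)
  qed
  have ind: "indicator (orbit_param -` pA \<inter> (UNIV \<times> Orb)) (x, \<xi>) = (indicator B (g' *v (x + - y), \<xi> v* g) :: ennreal)" for x \<xi>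
    using eq[of x \<xi>] by (simp add: indicator_def)
  have inner: "(\<integral>\<^sup>+x. indicator B (g' *v (x + - y), \<eta>) \<partial>lborel) = ennreal \<bar>det g\<bar> * (\<integral>\<^sup>+x. indicator B (x, \<eta>) \<partial>lborel)" for \<eta>
  proof -
    have m [measurable]: "(\<lambda>x. indicator B (x, \<eta>) :: ennreal) \<in> borel_measurable borel" by measurable
    have m2: "(\<lambda>x. indicator B (g' *v x, \<eta>) :: ennreal) \<in> borel_measurable borel"
      by (rule measurable_compose[OF matrix_mult_measurable m])
    have "(\<integral>\<^sup>+x. indicator B (g' *v (x + - y), \<eta>) \<partial>lborel) = (\<integral>\<^sup>+x. indicator B (g' *v x, \<eta>) \<partial>lborel)"
      by (rule nn_integral_shift[OF m2])
    moreover have "(\<integral>\<^sup>+x. indicator B (x, \<eta>) \<partial>lborel) = ennreal \<bar>det g'\<bar> * (\<integral>\<^sup>+x. indicator B (g' *v x, \<eta>) \<partial>lborel)"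
      using invertible_matrix_inv[OF gi] by (intro nn_integral_linear m) (simp add: g'_def)
    moreover have "ennreal \<bar>det g\<bar> * ennreal \<bar>det g'\<bar> = 1"
      using det_matrix_inv[OF gi] gi by (simp add: g'_def invertible_det_nz ennreal_mult'[symmetric])
    ultimately show ?thesis by (simp add: mult.assoc[symmetric])
  qed
  have mo: "(\<lambda>\<eta>. \<integral>\<^sup>+x. indicator B (x, \<eta>) \<partial>lborel :: ennreal) \<in> borel_measurable borel" by measurable
  have "emeasure haar pA = (\<integral>\<^sup>+\<xi>. \<integral>\<^sup>+x. indicator B (g' *v (x + - y), \<xi> v* g) \<partial>lborel \<partial>lborel)"
    unfolding emeasure_haar(1)[OF pAs] emeasure_lborel_Times[OF emeasure_haar(2)[OF pAs]] ind ..
  also have "\<dots> = (\<integral>\<^sup>+\<xi>. ennreal \<bar>det g\<bar> * (\<integral>\<^sup>+x. indicator B (x, transpose g *v \<xi>) \<partial>lborel) \<partial>lborel)"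
    unfolding inner transpose_matrix_vector ..
  also have "\<dots> = ennreal \<bar>det g\<bar> * (\<integral>\<^sup>+\<xi>. (\<integral>\<^sup>+x. indicator B (x, transpose g *v \<xi>) \<partial>lborel) \<partial>lborel)"
    by (rule nn_integral_cmult) (use measurable_compose[OF matrix_mult_measurable mo] in simp)
  also have "\<dots> = (\<integral>\<^sup>+\<xi>. (\<integral>\<^sup>+x. indicator B (x, \<xi>) \<partial>lborel) \<partial>lborel)"
    using nn_integral_linear[OF invertible_transpose[OF gi] mo] by (simp add: det_transpose)
  also have "\<dots> = emeasure haar A"
    unfolding emeasure_haar(1)[OF 4(2)] B_def[symmetric] emeasure_lborel_Times[OF B] ..
  finally show ?case by (simp add: pA_def)
qed simp

text \<open>The window is the Fourier transform of the indicator of a compact ball \<open>K\<close> inside the orbit. Since the dual action is proper on the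
  orbit, its matrix coefficients vanish unless the orbit coordinate \<open>\<xi>\<close> lies in a fixed compact set, where Plancherel's formula bounds
  their norms in \<open>x\<close>.\<close>

theorem H_square_integrable: "square_integrable_rep (semidirect H) lborel quasi_regular"
proof -
  define e1 :: "(real, 'n) vec" where "e1 = axis first_ix 1"
  define K where "K = cball e1 (1/2)"
  have KO: "\<omega> \<in> Orb" if "\<omega> \<in> K" for \<omega>
  proof -
    have "\<bar>(e1 - \<omega>) $ first_ix\<bar> \<le> 1/2" using that component_le_norm_cart[of "e1 - \<omega>" first_ix] by (simp add: K_def dist_norm)
    then show ?thesis by (auto simp: e1_def Orb_def)
  qed
  have cK: "compact K" by (simp add: K_def)
  have Kb [measurable]: "K \<in> sets borel" by (simp add: K_def)
  define \<psi> :: "(real, 'n) vec \<Rightarrow> complex" where "\<psi> = indicator K"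
  have \<psi>: "\<psi> \<in> test_fun" unfolding \<psi>_def K_def by (rule fourier_indicator_cball(1)) simp
  have [measurable]: "\<psi> \<in> borel_measurable borel" using \<psi> by (rule test_fun_measurable)
  let ?c = "(2 * pi) ^ CARD('n)"
  have W: "fourier \<psi> \<in> L2 lborel - L2_null lborel"
    unfolding \<psi>_def K_def by (rule fourier_indicator_cball(2)) simp
  \<comment> \<open>The coefficient is, up to a constant, the Fourier transform of \<open>u h\<close> in \<open>x\<close>.\<close>
  define u where "u h \<omega> = \<psi> \<omega> * cnj (of_real (\<bar>det h\<bar> powr (1/2)) * \<psi> (\<omega> v* h))" for h \<omega>
  define C where "C = (\<lambda>p. L2_inner lborel (fourier \<psi>) (quasi_regular p (fourier \<psi>)))"
  have ut: "u h \<in> test_fun" if h: "invertible h" for h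
  proof -
    have "dual_action (0, h) \<psi> \<in> test_fun" by (rule dual_action_test_fun[OF h \<psi>])
    then show ?thesis
      using test_fun_mult_cnj[OF \<psi>, of "dual_action (0, h) \<psi>"] by (simp add: u_def[abs_def] dual_action_def transpose_matrix_vector)
  qed
  have CF: "C (x, h) = of_real ?c * fourier (u h) x" if h: "invertible h" for x h
  proof -
    have "C (x, h) = of_real ?c * L2_inner lborel \<psi> (dual_action (- x, h) \<psi>)"
      unfolding C_def quasi_regular_fourier[OF h \<open>\<psi> \<in> borel_measurable borel\<close>]
      by (rule Plancherel_inner[OF \<psi> dual_action_test_fun[OF h \<psi>]])
    also have "L2_inner lborel \<psi> (dual_action (- x, h) \<psi>) = fourier (u h) x"
      unfolding L2_inner_def fourier_def
      by (simp add: u_def dual_action_def transpose_matrix_vector cis_cnj inner_commute mult_ac)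
    finally show ?thesis .
  qed
  have Hinv: "invertible h" if "h \<in> H" for h using that by (auto simp: H_def q_invertible)
  have Cm [measurable]: "C \<in> borel_measurable haar"
  proof -
    define C' where "C' p = of_real ?c * (LINT \<omega>|lborel. u (snd p) \<omega> * cis (fst p \<bullet> \<omega>))" for p :: "(real, 'n) vec \<times> 'n sqmat"
    have detm [measurable]: "det \<in> borel_measurable (borel :: 'n sqmat measure)"
      by (intro borel_measurable_continuous_onI) (auto simp: det_def intro!: continuous_intros)
    have act: "(\<lambda>z :: ((real, 'n) vec \<times> 'n sqmat) \<times> (real, 'n) vec. snd z v* snd (fst z)) \<in> borel_measurable (borel \<Otimes>\<^sub>M lborel)"
      unfolding borel_prod[symmetric]
      by (rule row_action_measurable) measurable
    have "(\<lambda>(p, \<omega>). u (snd p) \<omega> * cis (fst p \<bullet> \<omega>)) \<in> borel_measurable (borel \<Otimes>\<^sub>M lborel)"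
    proof -
      have [measurable]: "(\<lambda>z :: ((real, 'n) vec \<times> 'n sqmat) \<times> (real, 'n) vec. \<psi> (snd z v* snd (fst z))) \<in> borel_measurable (borel \<Otimes>\<^sub>M lborel)"
        by (rule measurable_compose[OF act]) measurable
      have [measurable]: "(\<lambda>z :: ((real, 'n) vec \<times> 'n sqmat) \<times> (real, 'n) vec. det (snd (fst z))) \<in> borel_measurable (borel \<Otimes>\<^sub>M lborel)"
        unfolding borel_prod[symmetric] by measurable
      have [measurable]: "(\<lambda>z :: ((real, 'n) vec \<times> 'n sqmat) \<times> (real, 'n) vec. fst (fst z) \<bullet> snd z) \<in> borel_measurable (borel \<Otimes>\<^sub>M lborel)"
        unfolding borel_prod[symmetric] by measurable
      show ?thesis unfolding u_def case_prod_beta by measurable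
    qed
    then have "C' \<in> borel_measurable borel"
      unfolding C'_def by (intro borel_measurable_times borel_measurable_const lborel.borel_measurable_lebesgue_integral)
    then have "C' \<in> borel_measurable (restrict_space borel (UNIV \<times> H))" by (rule measurable_restrict_space1)
    moreover have "C p = C' p" if "p \<in> space (restrict_space borel (UNIV \<times> H))" for p
      using that CF[OF Hinv] by (auto simp: space_restrict_space C'_def fourier_def)
    ultimately have "C \<in> borel_measurable (restrict_space borel (UNIV \<times> H))"
      using measurable_cong[of "restrict_space borel (UNIV \<times> H)" C C'] by blast
    then show ?thesis by (subst measurable_cong_sets[OF sets_haar refl])
  qed
  \<comment> \<open>If \<open>\<omega>\<close> and \<open>\<eta> = q(\<xi>)\<^sup>-\<^sup>T \<omega>\<close> both lie in \<open>K\<close>, then \<open>q(\<xi>) = q(\<eta>)\<^sup>-\<^sup>1 q(\<omega>)\<close>, whose first row \<open>\<xi>\<close> lies in \<open>K'\<close>.\<close>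
  define K' where "K' = (\<lambda>p. q_inv_row (fst p) v* q (snd p)) ` (K \<times> K)"
  have cK': "compact K'" unfolding K'_def
    by (rule compact_continuous_image[OF _ compact_Times[OF cK cK]])
       (intro continuous_intros continuous_on_compose2[OF continuous_on_q_inv_row] continuous_on_compose2[OF continuous_on_q], auto simp: KO)
  have K'O: "K' \<subseteq> Orb" by (auto simp: K'_def intro!: q_mult(1)[OF q_inv(1)[OF KO] KO])
  have [measurable]: "K' \<in> sets borel" by (rule borel_compact[OF cK'])
  obtain B where B: "\<And>\<xi>. \<xi> \<in> K' \<Longrightarrow> 1 / \<bar>det (q \<xi>)\<bar> \<le> B" "B \<ge> 0"
  proof -
    have "continuous_on K' (\<lambda>\<xi>. det (q \<xi>))" unfolding det_def
      by (intro continuous_intros continuous_on_subset[OF continuous_on_q K'O])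
    then have "continuous_on K' (\<lambda>\<xi>. 1 / \<bar>det (q \<xi>)\<bar>)"
      using q_invertible K'O by (intro continuous_intros) (auto simp: invertible_det_nz[symmetric])
    then have "bounded ((\<lambda>\<xi>. 1 / \<bar>det (q \<xi>)\<bar>) ` K')" by (intro compact_imp_bounded compact_continuous_image cK')
    then obtain B where "\<And>\<xi>. \<xi> \<in> K' \<Longrightarrow> norm (1 / \<bar>det (q \<xi>)\<bar>) \<le> B" by (auto simp: bounded_iff)
    then show ?thesis using that[of "max B 0"] by force
  qed
  have inner: "(\<integral>\<^sup>+x. ennreal ((cmod (C (x, matrix_inv (q \<xi>))))\<^sup>2) \<partial>lborel)
      \<le> ennreal (?c\<^sup>2 * (?c * (B * measure lborel K))) * indicator K' \<xi>" if \<xi>: "\<xi> \<in> Orb" for \<xi>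
  proof -
    define h where "h = matrix_inv (q \<xi>)"
    have h: "invertible h" unfolding h_def by (rule invertible_matrix_inv[OF q_invertible[OF \<xi>]])
    have dh: "\<bar>det h\<bar> = 1 / \<bar>det (q \<xi>)\<bar>" unfolding h_def det_matrix_inv[OF q_invertible[OF \<xi>]] by simp
    have supp: "\<xi> \<in> K'" if "\<omega> \<in> K" "\<omega> v* h \<in> K" for \<omega>
    proof -
      define \<eta> where "\<eta> = \<omega> v* h"
      have \<eta>: "\<eta> \<in> Orb" using that KO by (simp add: \<eta>_def)
      have "\<eta> v* q \<xi> = \<omega>"
        by (simp add: \<eta>_def h_def vector_matrix_mul_assoc matrix_inv_mult[OF q_invertible[OF \<xi>]])
      then have "q \<omega> = q \<eta> ** q \<xi>" using q_mult[OF \<eta> \<xi>] by simp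
      then have "q (q_inv_row \<eta>) ** q \<omega> = q \<xi>"
        unfolding q_inv(2)[OF \<eta>, symmetric] by (simp add: matrix_mul_assoc matrix_inv_mult[OF q_invertible[OF \<eta>]])
      then have "(q (q_inv_row \<eta>) ** q \<omega>) $ first_ix = q \<xi> $ first_ix" by simp
      then have "q_inv_row \<eta> v* q \<omega> = \<xi>" by (simp add: row_mult q_row q_inv(1)[OF \<eta>] \<xi>)
      then show ?thesis using that by (auto simp: K'_def \<eta>_def intro!: image_eqI[of _ _ "(\<omega> v* h, \<omega>)"])
    qed
    have Fu: "fourier (u h) \<in> L2 lborel" "sq_norm lborel (fourier (u h)) = ?c * sq_norm lborel (u h)"
      using fourier_test_fun_L2[OF ut[OF h]] sq_norm_fourier[OF ut[OF h]] by auto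
    have eqC: "C (x, h) = of_real ?c * fourier (u h) x" for x by (rule CF[OF h])
    have "(\<integral>\<^sup>+x. ennreal ((cmod (C (x, h)))\<^sup>2) \<partial>lborel) = ennreal (sq_norm lborel (\<lambda>x. of_real ?c * fourier (u h) x))"
      unfolding eqC by (rule sq_norm_ennreal[OF L2_cmult[OF Fu(1)]])
    also have "\<dots> = ennreal (?c\<^sup>2 * (?c * sq_norm lborel (u h)))"
      unfolding sq_norm_cmult Fu(2) norm_of_real by simp
    also have "\<dots> \<le> ennreal (?c\<^sup>2 * (?c * (B * measure lborel K))) * indicator K' \<xi>"
    proof (cases "\<xi> \<in> K'")
      case True
      have "sq_norm lborel (u h) \<le> B * measure lborel K"
      proof -
        have dp: "(\<bar>det h\<bar> powr (1/2))\<^sup>2 = \<bar>det h\<bar>"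
          using h by (simp add: power2_eq_square powr_add[symmetric] invertible_det_nz)
        have "(cmod (u h \<omega>))\<^sup>2 \<le> B * indicator K \<omega>" for \<omega>
        proof -
          have "(cmod (u h \<omega>))\<^sup>2 = \<bar>det h\<bar> * (indicator K \<omega> * indicator K (\<omega> v* h))"
            unfolding u_def \<psi>_def norm_mult complex_mod_cnj power_mult_distrib
            by (simp add: norm_mult power_mult_distrib dp) (simp add: indicator_def)
          also have "\<dots> \<le> B * indicator K \<omega>"
            using B(1)[OF True] B(2) dh by (auto simp: indicator_def)
          finally show ?thesis .
        qed
        moreover have "integrable lborel (\<lambda>\<omega>. B * indicator K \<omega>)"
          using emeasure_bounded_finite[OF compact_imp_bounded[OF cK]] by (intro integrable_mult_right) (simp add: integrable_indicator_iff)
        ultimately have "sq_norm lborel (u h) \<le> (LINT \<omega>|lborel. B * indicator K \<omega>)"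
          unfolding sq_norm_def using test_fun_L2[OF ut[OF h]] by (intro integral_mono) (auto simp: L2_def)
        then show ?thesis by simp
      qed
      then show ?thesis using True by (auto intro!: ennreal_leI mult_left_mono)
    next
      case False
      then have "u h \<omega> = 0" for \<omega> using supp[of \<omega>] by (auto simp: u_def \<psi>_def indicator_def)
      then show ?thesis using False by (simp add: sq_norm_def)
    qed
    finally show ?thesis by (simp add: h_def)
  qed
  have "(\<integral>\<^sup>+p. ennreal ((cmod (C p))\<^sup>2) \<partial>haar) < \<infinity>"
  proof -
    let ?f = "\<lambda>p. ennreal ((cmod (C (orbit_param p)))\<^sup>2) * indicator (UNIV \<times> Orb) p"
    have Cr: "(\<lambda>p. ennreal ((cmod (C p))\<^sup>2)) \<in> borel_measurable (restrict_space borel (UNIV \<times> H))"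
    proof -
      have "C \<in> borel_measurable (restrict_space borel (UNIV \<times> H))"
        using Cm by (subst (asm) measurable_cong_sets[OF sets_haar refl])
      then show ?thesis by measurable
    qed
    have m1: "(\<lambda>p. ennreal ((cmod (C (orbit_param p)))\<^sup>2)) \<in> borel_measurable (restrict_space lborel (UNIV \<times> Orb))"
      by (rule measurable_compose[OF orbit_param_measurable Cr])
    then have "?f \<in> borel_measurable lborel"
      by (subst (asm) borel_measurable_restrict_space_iff_ennreal) auto
    then have m2: "?f \<in> borel_measurable (lborel \<Otimes>\<^sub>M lborel)" by (simp only: lborel_prod)
    have "(\<integral>\<^sup>+p. ennreal ((cmod (C p))\<^sup>2) \<partial>haar) = (\<integral>\<^sup>+p. ennreal ((cmod (C (orbit_param p)))\<^sup>2) \<partial>restrict_space lborel (UNIV \<times> Orb))"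
      unfolding haar_def by (rule nn_integral_distr[OF orbit_param_measurable]) (use Cr in simp)
    also have "\<dots> = (\<integral>\<^sup>+p. ?f p \<partial>lborel)" by (rule nn_integral_restrict_space) simp
    also have "\<dots> = (\<integral>\<^sup>+p. ?f p \<partial>(lborel \<Otimes>\<^sub>M lborel))" by (simp only: lborel_prod)
    also have "\<dots> = (\<integral>\<^sup>+\<xi>. \<integral>\<^sup>+x. ?f (x, \<xi>) \<partial>lborel \<partial>lborel)"
      by (rule lborel_pair.nn_integral_snd[OF m2, symmetric])
    also have "\<dots> \<le> (\<integral>\<^sup>+\<xi>. ennreal (?c\<^sup>2 * (?c * (B * measure lborel K))) * indicator K' \<xi> \<partial>lborel)"
    proof (rule nn_integral_mono)
      fix \<xi> :: "(real, 'n) vec"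
      show "(\<integral>\<^sup>+x. ?f (x, \<xi>) \<partial>lborel) \<le> ennreal (?c\<^sup>2 * (?c * (B * measure lborel K))) * indicator K' \<xi>"
      proof (cases "\<xi> \<in> Orb")
        case True
        then show ?thesis using inner[OF True] by (simp add: orbit_param_def)
      qed simp
    qed
    also have "\<dots> = ennreal (?c\<^sup>2 * (?c * (B * measure lborel K))) * emeasure lborel K'"
      by (simp add: nn_integral_cmult)
    also have "\<dots> < \<infinity>"
      using emeasure_bounded_finite[OF compact_imp_bounded[OF cK']] by (simp add: ennreal_mult_less_top)
    finally show ?thesis .
  qed
  then have "C \<in> L2 haar" using Cm by (simp add: L2_iff_nn_integral)
  then show ?thesis
    unfolding square_integrable_rep_def C_def using left_haar_haar W by blast
qed

theorem H_irreducibly_admissible: "irreducibly_admissible H"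
  unfolding irreducibly_admissible_def using H_closed H_irreducible H_square_integrable by blast

theorem compatible_one_param: "compatible S (one_param (diag_mat v))"
  unfolding compatible_def shearlet_dilation_group_def
proof (intro conjI)
  have "diag_mat v \<noteq> 0" using v_first by (auto simp: vec_eq_iff diag_mat_def intro!: exI[of _ first_ix])
  then show "\<exists>Y. diagonal_mat Y \<and> Y \<noteq> 0 \<and> one_param (diag_mat v) = one_param Y"
    using diagonal_diag_mat by blast
qed (use H_irreducibly_admissible H_decomposition H_eq in \<open>auto simp: dilation_group_def\<close>)

end

section \<open>Compatible scaling subgroups are adapted\<close>

lemma L2_inner_quasi_regular:
  fixes h :: "'n::{finite,wellorder} sqmat"
  assumes h: "invertible h" and f: "f \<in> L2 lborel" and g: "g \<in> L2 lborel"
  shows "L2_inner lborel (quasi_regular (x, h) f) (quasi_regular (x, h) g) = L2_inner lborel f g"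
proof -
  have "sq_norm lborel (\<lambda>y. quasi_regular (x, h) f y + c * quasi_regular (x, h) g y) = sq_norm lborel (\<lambda>y. f y + c * g y)" for c
  proof -
    have "(\<lambda>y. quasi_regular (x, h) f y + c * quasi_regular (x, h) g y) = quasi_regular (x, h) (\<lambda>y. f y + c * g y)"
      by (auto simp: quasi_regular_def algebra_simps)
    then show ?thesis using sq_norm_quasi_regular[OF h L2_add[OF f L2_cmult[OF g]]] by simp
  qed
  from this[of 1] this[of \<i>] show ?thesis
    unfolding polarization_identity[OF quasi_regular_L2[OF h f] quasi_regular_L2[OF h g]] polarization_identity[OF f g]
    by (simp add: sq_norm_quasi_regular[OF h] f g)
qed

text \<open>If all dilations preserve the absolute value of the first coordinate on the Fourier side, then the functions that are
  band-limited in this coordinate form a proper invariant subspace.\<close>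

theorem band_limited_reducible:
  fixes G :: "'n::{finite,wellorder} sqmat set"
  assumes G: "\<And>h. h \<in> G \<Longrightarrow> invertible h"
    and abs: "\<And>h \<omega>. h \<in> G \<Longrightarrow> \<bar>(transpose h *v \<omega>) $ first_ix\<bar> = \<bar>\<omega> $ first_ix\<bar>"
  shows "\<not> irreducible_rep (semidirect G) lborel quasi_regular"
proof
  assume irr: "irreducible_rep (semidirect G) lborel quasi_regular"
  define T :: "((real, 'n) vec \<Rightarrow> complex) set" where
    "T = {\<psi> \<in> test_fun. \<forall>\<omega>. \<bar>\<omega> $ first_ix\<bar> \<le> 1 \<longrightarrow> \<psi> \<omega> = 0}"
  define V where "V = {f \<in> L2 lborel. \<forall>\<psi>\<in>T. L2_inner lborel f (fourier \<psi>) = 0}"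
  have TL: "fourier \<psi> \<in> L2 lborel" if "\<psi> \<in> T" for \<psi> using that by (auto simp: T_def intro: fourier_test_fun_L2)
  have closed: "L2_closed_subspace lborel V"
    unfolding L2_closed_subspace_def
  proof (intro conjI allI ballI impI)
    show "(\<lambda>x. 0) \<in> V" by (simp add: V_def L2_inner_def)
    show "(\<lambda>x. f x + g x) \<in> V" if "f \<in> V" "g \<in> V" for f g
      using that by (auto simp: V_def L2_add L2_inner_add_left TL)
    show "(\<lambda>x. c * f x) \<in> V" if "f \<in> V" for c f
      using that by (auto simp: V_def L2_cmult L2_inner_cmult_left)
    fix u f assume u: "(\<forall>n. u n \<in> V) \<and> f \<in> L2 lborel \<and> (\<lambda>n. L2_dist lborel (u n) f) \<longlonglongrightarrow> 0"
    show "f \<in> V"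
      unfolding V_def
    proof (intro CollectI conjI ballI)
      fix \<psi> assume \<psi>: "\<psi> \<in> T"
      have "(\<lambda>n. L2_inner lborel (u n) (fourier \<psi>)) \<longlonglongrightarrow> L2_inner lborel f (fourier \<psi>)"
        by (rule tendsto_L2_inner) (use u TL[OF \<psi>] in \<open>auto simp: V_def L2_dist_def\<close>)
      moreover have "L2_inner lborel (u n) (fourier \<psi>) = 0" for n using u \<psi> by (auto simp: V_def)
      ultimately show "L2_inner lborel f (fourier \<psi>) = 0" by (simp add: LIMSEQ_const_iff)
    qed (use u in simp)
  qed (auto simp: V_def)
  have inv: "quasi_regular p f \<in> V" if p: "p \<in> carrier (semidirect G)" and f: "f \<in> V" for p f
  proof -
    obtain x h where xh: "p = (x, h)" "h \<in> G" using p by (auto simp: semidirect_def)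
    have h: "invertible h" using xh G by simp
    have fL: "f \<in> L2 lborel" using f by (simp add: V_def)
    have "L2_inner lborel (quasi_regular (x, h) f) (fourier \<psi>) = 0" if \<psi>: "\<psi> \<in> T" for \<psi>
    proof -
      have \<psi>t: "\<psi> \<in> test_fun" using \<psi> by (simp add: T_def)
      define B where "B = transpose (matrix_inv h)"
      have B: "invertible B" unfolding B_def by (intro invertible_transpose invertible_matrix_inv h)
      have Bh: "B *v (transpose h *v \<omega>) = \<omega>" "transpose h *v (B *v \<omega>) = \<omega>" for \<omega>
        unfolding B_def matrix_vector_mul_assoc matrix_transpose_mul[symmetric] matrix_inv_mult[OF h]
        by (simp_all only: transpose_mat matrix_vector_mul_lid)
      define \<phi> where "\<phi> \<eta> = of_real (\<bar>det h\<bar> powr (-1/2)) * cis ((B *v \<eta>) \<bullet> x) * \<psi> (B *v \<eta>)" for \<eta>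
      have [measurable]: "(\<lambda>\<eta>. cis ((B *v \<eta>) \<bullet> x)) \<in> borel_measurable borel"
        by (rule measurable_compose[OF matrix_mult_measurable]) measurable
      have "\<phi> \<in> test_fun"
        unfolding \<phi>_def
        by (rule test_fun_bounded_mult[of _ _ "\<bar>det h\<bar> powr (-1/2)"])
           (use test_fun_affine[OF B \<psi>t, of 0] in \<open>auto simp: norm_mult\<close>)
      moreover have "\<phi> \<eta> = 0" if "\<bar>\<eta> $ first_ix\<bar> \<le> 1" for \<eta>
      proof -
        have "\<bar>(B *v \<eta>) $ first_ix\<bar> \<le> 1" using abs[OF xh(2), of "B *v \<eta>"] that by (simp only: Bh)
        then show ?thesis using \<psi> by (simp add: \<phi>_def T_def)
      qed
      ultimately have \<phi>: "\<phi> \<in> T" by (simp add: T_def)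
      have "dual_action (- x, h) \<phi> = \<psi>"
      proof
        fix \<omega>
        have d: "\<bar>det h\<bar> > 0" using h by (simp add: invertible_det_nz)
        have "dual_action (- x, h) \<phi> \<omega> = of_real (\<bar>det h\<bar> powr (1/2) * \<bar>det h\<bar> powr (-1/2)) * (cis (\<omega> \<bullet> - x) * cis (\<omega> \<bullet> x)) * \<psi> \<omega>"
          unfolding dual_action_def prod.case \<phi>_def Bh by (simp only: of_real_mult mult_ac)
        also have "\<bar>det h\<bar> powr (1/2) * \<bar>det h\<bar> powr (-1/2) = 1" using d by (simp add: powr_add[symmetric])
        also have "cis (\<omega> \<bullet> - x) * cis (\<omega> \<bullet> x) = 1" by (simp add: cis_mult)
        finally show "dual_action (- x, h) \<phi> \<omega> = \<psi> \<omega>" by simp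
      qed
      then have "fourier \<psi> = quasi_regular (x, h) (fourier \<phi>)"
        using quasi_regular_fourier[OF h, of \<phi> x] \<phi> by (auto simp: T_def test_fun_measurable)
      then have "L2_inner lborel (quasi_regular (x, h) f) (fourier \<psi>) = L2_inner lborel f (fourier \<phi>)"
        by (simp add: L2_inner_quasi_regular[OF h fL TL[OF \<phi>]])
      then show ?thesis using f \<phi> by (simp add: V_def)
    qed
    then show ?thesis using quasi_regular_L2[OF h fL, of x] by (simp add: V_def xh)
  qed
  have "V = L2_null lborel \<or> V = L2 lborel"
    using irr closed inv unfolding irreducible_rep_def by blast
  moreover have "V \<noteq> L2_null lborel"
  proof -
    define \<psi>1 :: "(real, 'n) vec \<Rightarrow> complex" where "\<psi>1 = indicator (cball 0 1)"
    have \<psi>1: "\<psi>1 \<in> test_fun" "fourier \<psi>1 \<in> L2 lborel - L2_null lborel"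
      unfolding \<psi>1_def by (rule fourier_indicator_cball, simp)+
    have "L2_inner lborel (fourier \<psi>1) (fourier \<psi>) = 0" if \<psi>: "\<psi> \<in> T" for \<psi>
    proof -
      have "\<psi>1 \<omega> * cnj (\<psi> \<omega>) = 0" for \<omega>
        using \<psi> component_le_norm_cart[of \<omega> first_ix] by (auto simp: T_def \<psi>1_def indicator_def)
      then have "(\<lambda>\<omega>. \<psi>1 \<omega> * cnj (\<psi> \<omega>)) = (\<lambda>_. 0)" by (rule ext)
      then have "L2_inner lborel \<psi>1 \<psi> = 0" unfolding L2_inner_def by simp
      then show ?thesis using \<psi> \<psi>1(1) by (simp add: Plancherel_inner T_def)
    qed
    then have "fourier \<psi>1 \<in> V" using \<psi>1 by (simp add: V_def)
    then show ?thesis using \<psi>1 by blast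
  qed
  moreover have "V \<noteq> L2 lborel"
  proof
    assume VL: "V = L2 lborel"
    define \<psi>2 :: "(real, 'n) vec \<Rightarrow> complex" where "\<psi>2 = indicator (cball (axis first_ix 3) 1)"
    have \<psi>2: "\<psi>2 \<in> test_fun" "fourier \<psi>2 \<in> L2 lborel - L2_null lborel"
      unfolding \<psi>2_def by (rule fourier_indicator_cball, simp)+
    have "\<psi>2 \<omega> = 0" if "\<bar>\<omega> $ first_ix\<bar> \<le> 1" for \<omega>
      using that component_le_norm_cart[of "axis first_ix 3 - \<omega>" first_ix]
      by (auto simp: \<psi>2_def indicator_def dist_norm)
    then have "\<psi>2 \<in> T" using \<psi>2 by (simp add: T_def)
    moreover have "fourier \<psi>2 \<in> V" using \<psi>2 VL by simp
    ultimately have "L2_inner lborel (fourier \<psi>2) (fourier \<psi>2) = 0" by (simp add: V_def)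
    then show False using \<psi>2 by (simp add: L2_inner_self L2_null_iff)
  qed
  ultimately show False by blast
qed

context shearing
begin

text \<open>The product of a shear and a scaling \<open>d\<close> lies in the group \<open>\<plusminus> D S\<close>, and its first diagonal entry identifies the scaling factor as
  \<open>d\<close> itself. So \<open>D\<close> normalizes \<open>S\<close>; for the shear \<open>1 + X\<^sub>i\<close> this yields the equations of adaptedness.\<close>

theorem compatible_adapted:
  assumes "compatible S D"
  obtains v where "adapted v" "D = one_param (diag_mat v)"
proof -
  obtain Y where Y: "diagonal_mat Y" "D = one_param Y"
    and adm: "irreducibly_admissible (dilation_group S D)"
    using assms by (auto simp: compatible_def shearlet_dilation_group_def dilation_group_def)
  obtain w where w: "D = one_param (diag_mat w)" using Y by (auto elim: diagonal_matE)
  have sub: "subgroup (dilation_group S D) GL" and irr: "irreducible_rep (semidirect (dilation_group S D)) lborel quasi_regular"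
    using adm by (auto simp: irreducibly_admissible_def closed_subgroup_def)
  have elem: "\<exists>\<epsilon> a x. (\<epsilon> = 1 \<or> \<epsilon> = -1) \<and> a > 0 \<and> x $ first_ix = 1 \<and> h = \<epsilon> *\<^sub>R (scaling w a ** L x)"
    if "h \<in> dilation_group S D" for h
    using that unfolding dilation_group_def w one_param_scaling S_eq by force
  have w1: "w first_ix \<noteq> 0"
  proof
    assume w0: "w first_ix = 0"
    have "\<bar>(transpose h *v \<omega>) $ first_ix\<bar> = \<bar>\<omega> $ first_ix\<bar>" if hin: "h \<in> dilation_group S D" for h \<omega>
    proof -
      obtain \<epsilon> a x where h: "\<epsilon> = 1 \<or> \<epsilon> = -1" "a > 0" "x $ first_ix = 1" "h = \<epsilon> *\<^sub>R (scaling w a ** L x)"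
        using elem[OF hin] by blast
      have e: "h $ i $ j = \<epsilon> * (a powr w i * L x $ i $ j)" for i j
        by (simp add: h(4) scaling_def diag_mat_mult_left)
      have "level 0 h" using L_level_0[of x] unfolding level_def e by auto
      moreover have "\<bar>h $ first_ix $ first_ix\<bar> = 1" unfolding e using h w0 by auto
      ultimately show ?thesis by (simp add: transpose_matrix_vector first_mult_upper abs_mult)
    qed
    then show False
      using band_limited_reducible[of "dilation_group S D"] sub irr by (auto simp: subgroup_GL_iff)
  qed
  define v where "v i = w i / w first_ix" for i
  have v1: "v first_ix = 1" using w1 by (simp add: v_def)
  have Dv: "D = one_param (diag_mat v)"
    unfolding w one_param_diag
  proof (rule equalityI; rule subsetI)
    fix A assume "A \<in> {diag_mat (\<lambda>i. exp (r * w i)) | r. True}"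
    then obtain r where "A = diag_mat (\<lambda>i. exp (r * w i))" by blast
    then have "A = diag_mat (\<lambda>i. exp ((r * w first_ix) * v i))" using w1 by (simp add: v_def)
    then show "A \<in> {diag_mat (\<lambda>i. exp (r * v i)) | r. True}" by blast
  next
    fix A assume "A \<in> {diag_mat (\<lambda>i. exp (r * v i)) | r. True}"
    then obtain r where "A = diag_mat (\<lambda>i. exp (r * v i))" by blast
    then have "A = diag_mat (\<lambda>i. exp ((r / w first_ix) * w i))" by (simp add: v_def)
    then show "A \<in> {diag_mat (\<lambda>i. exp (r * w i)) | r. True}" by blast
  qed
  have "adapted v"
    unfolding adapted_def
  proof (intro conjI v1 allI impI)
    fix i j k assume i: "i \<noteq> first_ix" and nz: "X i $ j $ k \<noteq> 0"
    \<comment> \<open>Any scaling parameter other than \<open>1\<close> separates exponents.\<close>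
    define a where "a = exp (1::real)"
    have a: "a > 1" by (simp add: a_def)
    define x where "x = axis first_ix 1 + axis i (1::real)"
    have Lx: "L (axis first_ix 1 + c *\<^sub>R axis i 1) = mat 1 + c *\<^sub>R X i" for c
      using linear_L i by (simp add: linear_add linear_scale L_one X_eq_L)
    have "L x \<in> S" "scaling v a \<in> D" "mat 1 \<in> D" "mat 1 \<in> S"
      using i a S_subgroup scaling_one[of v]
      by (auto simp: S_eq x_def axis_def Dv one_param_scaling subgroup_GL_iff intro: exI[of _ 1])
    then have "mat 1 ** L x \<in> dilation_group S D" "scaling v a ** mat 1 \<in> dilation_group S D"
      unfolding dilation_group_def by blast+
    then have "L x ** scaling v a \<in> dilation_group S D" using sub by (simp add: subgroup_GL_iff)
    then obtain \<epsilon> b y where h: "\<epsilon> = 1 \<or> \<epsilon> = -1" "b > 0" "y $ first_ix = 1" "L x ** scaling v a = \<epsilon> *\<^sub>R (scaling v b ** L y)"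
      unfolding dilation_group_def Dv one_param_scaling S_eq by force
    have e: "L x $ r $ s * a powr v s = \<epsilon> * (b powr v r * L y $ r $ s)" for r s
    proof -
      have "(L x ** scaling v a) $ r $ s = (\<epsilon> *\<^sub>R (scaling v b ** L y)) $ r $ s" by (simp only: h(4))
      then show ?thesis by (simp add: scaling_def diag_mat_mult_left diag_mat_mult_right)
    qed
    have "a = \<epsilon> * b" using e[of first_ix first_ix] h a i by (simp add: v1 x_def axis_def)
    then have \<epsilon>: "\<epsilon> = 1" "b = a" using h a by auto
    have y: "y = axis first_ix 1 + (a powr (v i - 1)) *\<^sub>R axis i 1"
    proof -
      have "x $ s * a powr v s = a * y $ s" for s using e[of first_ix s] a by (simp add: \<epsilon> v1)
      then have "y $ s = x $ s * a powr (v s - 1)" for s using a by (simp add: powr_diff field_simps)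
      then show ?thesis using a i by (auto simp: vec_eq_iff x_def axis_def v1)
    qed
    have jk: "j \<noteq> k" using nz level_1_diagonal[OF lie_algebra_strict[OF X_lie[OF i]]] by auto
    have "L x $ j $ k = X i $ j $ k" using Lx[of 1] jk by (simp add: x_def mat_def)
    moreover have "L y $ j $ k = a powr (v i - 1) * X i $ j $ k" using Lx[of "a powr (v i - 1)"] jk by (simp add: y mat_def)
    ultimately have "a powr v k = a powr (v j + (v i - 1))"
      using e[of j k] nz by (simp add: \<epsilon> powr_add)
    then have "v k = v j + (v i - 1)" using a by (simp add: powr_inj)
    then show "v j - v k = 1 - v i" by simp
  qed
  then show ?thesis using Dv by (rule that)
qed

end

section \<open>Scaling subgroups and solutions of the linear system\<close>

lemma one_param_diag_inj:
  fixes v w :: "'n::{finite,wellorder} \<Rightarrow> real"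
  assumes "one_param (diag_mat v) = one_param (diag_mat w)" and v1: "v first_ix = 1" and w1: "w first_ix = 1"
  shows "v = w"
proof -
  have "diag_mat (\<lambda>i. exp (1 * v i)) \<in> one_param (diag_mat v)"
    unfolding one_param_diag by blast
  then have "diag_mat (\<lambda>i. exp (1 * v i)) \<in> one_param (diag_mat w)" by (simp only: assms(1))
  then obtain r where "(\<lambda>i. exp (1 * v i)) = (\<lambda>i. exp (r * w i))"
    by (auto simp: one_param_diag diag_mat_eq_iff)
  then have e: "v i = r * w i" for i by (metis exp_inj_iff mult_1)
  then have "r = 1" using v1 w1 by (metis mult.right_neutral)
  then show ?thesis using e by auto
qed

lemma isotropic_iff:
  fixes v :: "'n::{finite,wellorder} \<Rightarrow> real"
  assumes "v first_ix = 1"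
  shows "isotropic (one_param (diag_mat v)) \<longleftrightarrow> v = (\<lambda>_. 1)"
proof
  assume "isotropic (one_param (diag_mat v))"
  then have "one_param (diag_mat v) = one_param (diag_mat (\<lambda>_. 1))"
    by (simp add: isotropic_def normalized_generator_def diag_mat_one)
  then show "v = (\<lambda>_. 1)" using assms by (intro one_param_diag_inj) auto
next
  assume "v = (\<lambda>_. 1)"
  then show "isotropic (one_param (diag_mat v))"
    by (simp add: isotropic_def normalized_generator_def diag_mat_one diagonal_mat_def mat_def)
qed

theorem lemma9:
  fixes S :: "'n::{finite,wellorder} sqmat set"
    and X :: "'n \<Rightarrow> 'n sqmat"
    and c :: "'n \<Rightarrow> 'n \<Rightarrow> 'n \<Rightarrow> real"
  assumes "shearing_subgroup S"
    and "canonical_basis (lie_algebra S) X"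
    and "\<And>i j k. c i j k = X i $ j $ k"
  shows "(\<forall>i>first_ix. X i = unit_mat first_ix i
             + (\<Sum>j\<in>{first_ix<..}. \<Sum>k\<in>{j<..}. c i j k *\<^sub>R unit_mat j k)) \<and>
         (\<forall>l :: 'n \<Rightarrow> real.
             (\<forall>A\<in>lie_algebra S.
                 commutator (diag_mat (\<lambda>i. if i = first_ix then 1 else l i)) A \<in> lie_algebra S)
             \<longleftrightarrow> (\<exists>\<mu>\<in>solutions c. \<forall>i>first_ix. l i = 1 + \<mu> i)) \<and>
         bij_betw (\<lambda>\<mu>. one_param (diag_mat (\<lambda>i. if i = first_ix then 1 else 1 + \<mu> i)))
           (nonzero_solutions c) {D. compatible S D \<and> \<not> isotropic D}"
proof (intro conjI)
  interpret shearing S X using assms(1,2) by (rule shearing_subgroup_shearing)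
  show "\<forall>i>first_ix. X i = unit_mat first_ix i
      + (\<Sum>j\<in>{first_ix<..}. \<Sum>k\<in>{j<..}. c i j k *\<^sub>R unit_mat j k)"
    using X_expansion by (simp add: assms(3) first_ix_less_iff)
  show "\<forall>l :: 'n \<Rightarrow> real. (\<forall>A\<in>lie_algebra S.
      commutator (diag_mat (\<lambda>i. if i = first_ix then 1 else l i)) A \<in> lie_algebra S)
      \<longleftrightarrow> (\<exists>\<mu>\<in>solutions c. \<forall>i>first_ix. l i = 1 + \<mu> i)"
    by (intro allI, subst commutator_invariant_iff, simp, rule adapted_iff_solution, rule assms(3))
  define gen :: "('n \<Rightarrow> real) \<Rightarrow> 'n \<Rightarrow> real" where "gen \<mu> = (\<lambda>i. if i = first_ix then 1 else 1 + \<mu> i)" for \<mu>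
  have gen1: "gen \<mu> first_ix = 1" for \<mu> by (simp add: gen_def)
  have ext: "\<mu> = \<nu>" if "\<mu> \<in> solutions c" "\<nu> \<in> solutions c" "gen \<mu> = gen \<nu>" for \<mu> \<nu>
  proof (rule extensionalityI[of _ "{first_ix<..}"])
    fix i :: 'n assume "i \<in> {first_ix<..}"
    then have "i \<noteq> first_ix" by auto
    then show "\<mu> i = \<nu> i" using fun_cong[OF that(3), of i] by (simp add: gen_def)
  qed (use that in \<open>auto simp: solutions_def PiE_def\<close>)
  have "bij_betw (\<lambda>\<mu>. one_param (diag_mat (gen \<mu>))) (nonzero_solutions c) {D. compatible S D \<and> \<not> isotropic D}"
    unfolding bij_betw_def
  proof (intro conjI inj_onI equalityI subsetI)
    fix \<mu> \<nu> assume "\<mu> \<in> nonzero_solutions c" "\<nu> \<in> nonzero_solutions c"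
      "one_param (diag_mat (gen \<mu>)) = one_param (diag_mat (gen \<nu>))"
    then show "\<mu> = \<nu>" using one_param_diag_inj[of "gen \<mu>" "gen \<nu>"] gen1 ext by (auto simp: nonzero_solutions_def)
  next
    fix D assume "D \<in> (\<lambda>\<mu>. one_param (diag_mat (gen \<mu>))) ` nonzero_solutions c"
    then obtain \<mu> where \<mu>: "\<mu> \<in> solutions c" "\<exists>i>first_ix. \<mu> i \<noteq> 0" "D = one_param (diag_mat (gen \<mu>))"
      by (auto simp: nonzero_solutions_def)
    have "adapted (gen \<mu>)"
      unfolding gen_def using adapted_iff_solution[of c "\<lambda>i. 1 + \<mu> i"] assms(3) \<mu>(1) by blast
    then interpret shearlet S X "gen \<mu>" by unfold_locales
    have "gen \<mu> \<noteq> (\<lambda>_. 1)"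
    proof
      assume g: "gen \<mu> = (\<lambda>_. 1)"
      obtain i where "i > first_ix" "\<mu> i \<noteq> 0" using \<mu>(2) by blast
      then show False using fun_cong[OF g, of i] by (auto simp: gen_def first_ix_less_iff)
    qed
    then show "D \<in> {D. compatible S D \<and> \<not> isotropic D}"
      using compatible_one_param isotropic_iff[of "gen \<mu>", OF gen1] by (simp add: \<mu>(3))
  next
    fix D assume "D \<in> {D. compatible S D \<and> \<not> isotropic D}"
    then have D: "compatible S D" "\<not> isotropic D" by auto
    obtain v where v: "adapted v" "D = one_param (diag_mat v)" by (rule compatible_adapted[OF D(1)])
    have v1: "v first_ix = 1" using v(1) by (simp add: adapted_def)
    then have "v = (\<lambda>i. if i = first_ix then 1 else v i)" by auto
    then obtain \<mu> where \<mu>: "\<mu> \<in> solutions c" "\<forall>i>first_ix. v i = 1 + \<mu> i"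
      using v(1) adapted_iff_solution[of c v] assms(3) by metis
    have g: "gen \<mu> = v" using \<mu>(2) v1 by (auto simp: gen_def first_ix_less_iff)
    have "v \<noteq> (\<lambda>_. 1)" using D(2) isotropic_iff[of v, OF v1] v(2) by simp
    then obtain i where i: "v i \<noteq> 1" by auto
    then have "i \<noteq> first_ix" using v1 by auto
    then have "i > first_ix" by (simp add: first_ix_less_iff)
    then have "i > first_ix" "\<mu> i \<noteq> 0" using i \<mu>(2) by auto
    then have "\<mu> \<in> nonzero_solutions c" using \<mu>(1) by (auto simp: nonzero_solutions_def)
    then show "D \<in> (\<lambda>\<mu>. one_param (diag_mat (gen \<mu>))) ` nonzero_solutions c"
      using g v(2) by auto
  qed
  then show "bij_betw (\<lambda>\<mu>. one_param (diag_mat (\<lambda>i. if i = first_ix then 1 else 1 + \<mu> i)))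
      (nonzero_solutions c) {D. compatible S D \<and> \<not> isotropic D}"
    by (simp add: gen_def)
qed

end
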